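(* Let $N$ be a marked Poisson cluster process (as described in the context) with cluster totals $D_i$ and residue $\varepsilon_t$. Suppose that the $D_i$ are regularly varying with index $\alpha\in(1,2)$, let $D$ be a random variable with the law of $D_1$, $\mu_D=\mathbb{E}D$, and let $(a_n)$ be a sequence with $a_n\to\infty$ and $n\,\mathbb{P}(D>a_n)\to1$; put $a_t=a_{\lfloor t\rfloor}$ for real $t\ge1$. If $\varepsilon_t=o_P(a_t)$ as $t\to\infty$, then there exists an $\alpha$-stable random variable $G_\alpha$ such that, as $t\to\infty$, $$\frac{S(t)-t\,\nu\,\mu_D}{a_{\nu t}}\ \stackrel{d}{\longrightarrow}\ G_\alpha .$$
   Context: Marked Poisson cluster model. Let $\mathbb{S}$ be a completely metrizable separable space with Borel $\sigma$-algebra $\mathcal S$, $Q$ a probability measure on $\mathbb{S}$, and $\nu>0$ a constant. Let $N^0=\sum_{i\ge1}\delta_{\Gamma_i,A_i}$ be a Poisson point process on $[0,\infty)\times\mathbb{S}$ with intensity $(\nu\,\mathrm{Leb})\times Q$, where $\Gamma_1\le\Gamma_2\le\cdots$. Let $M_p$ be the space of locally finite point measures on $[0,\infty)\times\mathbb{S}$. There is a probability kernel from $\mathbb{S}$ to $M_p$, denoted $\mathcal K$, such that, conditionally on $N^0$, point processes $G^{A_i}$, $i\ge1$, are independent, a.s. finite, with $G^{A_i}$ having law $\mathcal K(A_i,\cdot)$. Write $G^{A_i}=\sum_{j=1}^{K_i}\delta_{T_{ij},A_{ij}}$, where $K_i$ is $\mathbb{N}_0$-valued and $T_{ij}\ge0$;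 $K_i$ may depend on $A_i$, and it is assumed that $\mathbb{E}K_i<\infty$. Set $T_{i0}=0$, $A_{i0}=A_i$. The cluster process is $N=\sum_{i\ge1}\sum_{j=0}^{K_i}\delta_{\Gamma_i+T_{ij},A_{ij}}$. Let $f:\mathbb{S}\to[0,\infty)$ be measurable and $X_{ij}=f(A_{ij})$. Total claim amount: $S(t)=\int_{[0,t]\times\mathbb{S}}f(a)\,N(ds,da)$. Cluster totals: $D_i=\sum_{j=0}^{K_i}X_{ij}$ (i.i.d. in $i$). Residue at time $t\ge 0$: $\varepsilon_t=\sum_{i,j:\ 0\le\Gamma_i\le t<\Gamma_i+T_{ij}}X_{ij}$ (with $1\le j\le K_i$). A nonnegative random variable $Z$ is regularly varying with index $\alpha>0$ if $\mathbb{P}(Z>x)=x^{-\alpha}\ell(x)$ with $\ell$ slowly varying at infinity. $\varepsilon_t=o_P(a_t)$ means $\varepsilon_t/a_t\to0$ in probability. Stable random variables are understood to be non-degenerate. *)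

theory Defs
  imports "HOL-Probability.Probability"
begin

subsection \<open>Point processes on \<open>[0,\<infinity>) \<times> \<S>\<close>\<close>

definition state_space :: "(real \<times> 'a::polish_space) measure" where
  "state_space = restrict_space borel ({0..} \<times> UNIV)"

text \<open>The point measure \<open>\<Sum>i\<in>I. \<delta>\<^bsub>x i\<^esub>\<close>, with multiplicities: the push-forward of counting measure.\<close>

definition dirac_sum :: "'i set \<Rightarrow> ('i \<Rightarrow> real \<times> 'a::polish_space) \<Rightarrow> (real \<times> 'a) measure" where
  "dirac_sum I x = distr (count_space I) state_space x"

definition point_measures :: "(real \<times> 'a::polish_space) measure set" where
  "point_measures = {\<mu>.
     (\<exists>(I::nat set) x. x ` I \<subseteq> space state_space \<and> \<mu> = dirac_sum I x) \<and>
     (\<forall>p\<in>space state_space. \<exists>U. open U \<and> p \<in> U \<and> emeasure \<mu> (U \<inter> space state_space) < \<infinity>)}"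

text \<open>The measurable space \<open>M\<^sub>p\<close>; its sigma-algebra is generated by the evaluations
  \<open>\<mu> \<mapsto> \<mu> B\<close>, as for \<^const>\<open>subprob_algebra\<close>.\<close>

definition Mp :: "(real \<times> 'a::polish_space) measure measure" where
  "Mp = (SUP B \<in> sets state_space. vimage_algebra point_measures (\<lambda>\<mu>. emeasure \<mu> B) borel)"

text \<open>The Poisson probabilities are written out because \<^const>\<open>poisson_pmf\<close> is unspecified
  at rate \<open>0\<close>, which has to be allowed here.\<close>

definition poisson_point_process ::
    "'w measure \<Rightarrow> (real \<times> 'a::polish_space) measure \<Rightarrow> ('w \<Rightarrow> (real \<times> 'a) measure) \<Rightarrow> bool" where
  "poisson_point_process M \<Lambda> N \<longleftrightarrow>
     N \<in> M \<rightarrow>\<^sub>M Mp \<and>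
     (\<forall>B\<in>sets state_space. emeasure \<Lambda> B < \<infinity> \<longrightarrow>
        (\<forall>k::nat. measure M {\<omega>\<in>space M. emeasure (N \<omega>) B = of_nat k} =
                  measure \<Lambda> B ^ k / fact k * exp (- measure \<Lambda> B))) \<and>
     (\<forall>B\<in>sets state_space. emeasure \<Lambda> B = \<infinity> \<longrightarrow> (AE \<omega> in M. emeasure (N \<omega>) B = \<infinity>)) \<and>
     (\<forall>(n::nat) B. (\<forall>k<n. B k \<in> sets state_space) \<and> disjoint_family_on B {..<n} \<longrightarrow>
        prob_space.indep_vars M (\<lambda>_. borel) (\<lambda>k \<omega>. emeasure (N \<omega>) (B k)) {..<n})"

subsection \<open>The marked Poisson cluster model\<close>

text \<open>Clusters are numbered from \<open>0\<close> instead of \<open>1\<close>.  In cluster \<open>i\<close>, \<open>T i j\<close> and \<open>A i j\<close> are the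
  delay and the mark of point \<open>j \<le> K i\<close>; \<open>j = 0\<close> is the parent, so \<open>A i 0\<close> is the mark
  \<open>A\<^sub>i\<close> of the Poisson point at \<open>\<Gamma> i\<close>.  Values at \<open>j > K i\<close> are irrelevant.\<close>

definition parent_process ::
    "(nat \<Rightarrow> 'w \<Rightarrow> real) \<Rightarrow> (nat \<Rightarrow> nat \<Rightarrow> 'w \<Rightarrow> 'a::polish_space) \<Rightarrow> 'w \<Rightarrow> (real \<times> 'a) measure" where
  "parent_process \<Gamma> A \<omega> = dirac_sum UNIV (\<lambda>i. (\<Gamma> i \<omega>, A i 0 \<omega>))"

definition progeny_process ::
    "(nat \<Rightarrow> 'w \<Rightarrow> nat) \<Rightarrow> (nat \<Rightarrow> nat \<Rightarrow> 'w \<Rightarrow> real) \<Rightarrow> (nat \<Rightarrow> nat \<Rightarrow> 'w \<Rightarrow> 'a::polish_space)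
      \<Rightarrow> nat \<Rightarrow> 'w \<Rightarrow> (real \<times> 'a) measure" where
  "progeny_process K T A i \<omega> = dirac_sum {1..K i \<omega>} (\<lambda>j. (T i j \<omega>, A i j \<omega>))"

definition cluster_process ::
    "(nat \<Rightarrow> 'w \<Rightarrow> real) \<Rightarrow> (nat \<Rightarrow> 'w \<Rightarrow> nat) \<Rightarrow> (nat \<Rightarrow> nat \<Rightarrow> 'w \<Rightarrow> real)
      \<Rightarrow> (nat \<Rightarrow> nat \<Rightarrow> 'w \<Rightarrow> 'a::polish_space) \<Rightarrow> 'w \<Rightarrow> (real \<times> 'a) measure" where
  "cluster_process \<Gamma> K T A \<omega> =
     dirac_sum (SIGMA i:UNIV. {0..K i \<omega>}) (\<lambda>(i, j). (\<Gamma> i \<omega> + T i j \<omega>, A i j \<omega>))"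

text \<open>The sigma-algebra of the parent process, generated by its points listed in order of time.\<close>

definition parent_sigma ::
    "'w measure \<Rightarrow> (nat \<Rightarrow> 'w \<Rightarrow> real) \<Rightarrow> (nat \<Rightarrow> nat \<Rightarrow> 'w \<Rightarrow> 'a::polish_space) \<Rightarrow> 'w measure" where
  "parent_sigma M \<Gamma> A =
     vimage_algebra (space M) (\<lambda>\<omega> i. (\<Gamma> i \<omega>, A i 0 \<omega>)) (\<Pi>\<^sub>M i\<in>UNIV. borel)"

locale marked_poisson_cluster = prob_space M
  for M :: "'w measure" +
  fixes \<nu> :: real
    and Q :: "'a::polish_space measure"
    and \<kappa> :: "'a \<Rightarrow> (real \<times> 'a) measure measure"
    and \<Gamma> :: "nat \<Rightarrow> 'w \<Rightarrow> real"
    and K :: "nat \<Rightarrow> 'w \<Rightarrow> nat"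
    and T :: "nat \<Rightarrow> nat \<Rightarrow> 'w \<Rightarrow> real"
    and A :: "nat \<Rightarrow> nat \<Rightarrow> 'w \<Rightarrow> 'a"
  assumes nu_pos: "\<nu> > 0"
    and mark_law: "prob_space Q" "sets Q = sets borel"
    and kernel: "\<kappa> \<in> borel \<rightarrow>\<^sub>M prob_algebra Mp"
    and \<Gamma>_measurable: "\<And>i. \<Gamma> i \<in> borel_measurable M"
    and K_measurable: "\<And>i. K i \<in> M \<rightarrow>\<^sub>M count_space UNIV"
    and T_measurable: "\<And>i j. T i j \<in> borel_measurable M"
    and A_measurable: "\<And>i j. A i j \<in> borel_measurable M"
    and \<Gamma>_nonneg: "\<And>i \<omega>. \<omega> \<in> space M \<Longrightarrow> 0 \<le> \<Gamma> i \<omega>"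
    and \<Gamma>_ordered: "\<And>i \<omega>. \<omega> \<in> space M \<Longrightarrow> \<Gamma> i \<omega> \<le> \<Gamma> (Suc i) \<omega>"
    and T_parent: "\<And>i \<omega>. \<omega> \<in> space M \<Longrightarrow> T i 0 \<omega> = 0"
    and T_nonneg: "\<And>i j \<omega>. \<omega> \<in> space M \<Longrightarrow> 1 \<le> j \<Longrightarrow> j \<le> K i \<omega> \<Longrightarrow> 0 \<le> T i j \<omega>"
    and parents_poisson:
      "poisson_point_process M
         (scale_measure (ennreal \<nu>) (restrict_space lborel {0..}) \<Otimes>\<^sub>M Q) (parent_process \<Gamma> A)"
    and progeny_measurable: "\<And>i. progeny_process K T A i \<in> M \<rightarrow>\<^sub>M Mp"
    and progeny_conditional_law:
      "\<And>J C. finite J \<Longrightarrow> (\<And>i. i \<in> J \<Longrightarrow> C i \<in> sets Mp) \<Longrightarrow>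
         AE \<omega> in M.
           real_cond_exp M (parent_sigma M \<Gamma> A)
             (indicator {\<omega>\<in>space M. \<forall>i\<in>J. progeny_process K T A i \<omega> \<in> C i}) \<omega> =
           (\<Prod>i\<in>J. measure (\<kappa> (A i 0 \<omega>)) (C i))"
    and K_integrable: "\<And>i. integrable M (\<lambda>\<omega>. real (K i \<omega>))"

definition total_claim :: "('a::polish_space \<Rightarrow> real) \<Rightarrow> (real \<times> 'a) measure \<Rightarrow> real \<Rightarrow> real" where
  "total_claim f N t = (LINT p:{0..t} \<times> UNIV|N. f (snd p))"

definition cluster_total ::
    "('a \<Rightarrow> real) \<Rightarrow> (nat \<Rightarrow> 'w \<Rightarrow> nat) \<Rightarrow> (nat \<Rightarrow> nat \<Rightarrow> 'w \<Rightarrow> 'a) \<Rightarrow> nat \<Rightarrow> 'w \<Rightarrow> real" where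
  "cluster_total f K A i \<omega> = (\<Sum>j=0..K i \<omega>. f (A i j \<omega>))"

definition residue ::
    "('a \<Rightarrow> real) \<Rightarrow> (nat \<Rightarrow> 'w \<Rightarrow> real) \<Rightarrow> (nat \<Rightarrow> 'w \<Rightarrow> nat) \<Rightarrow> (nat \<Rightarrow> nat \<Rightarrow> 'w \<Rightarrow> real)
      \<Rightarrow> (nat \<Rightarrow> nat \<Rightarrow> 'w \<Rightarrow> 'a) \<Rightarrow> real \<Rightarrow> 'w \<Rightarrow> real" where
  "residue f \<Gamma> K T A t \<omega> =
     (\<Sum>\<^sub>\<infinity>(i, j)\<in>{(i, j). 0 \<le> \<Gamma> i \<omega> \<and> \<Gamma> i \<omega> \<le> t \<and> t < \<Gamma> i \<omega> + T i j \<omega> \<and> 1 \<le> j \<and> j \<le> K i \<omega>}.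
        f (A i j \<omega>))"

subsection \<open>Regular variation, stable laws and modes of convergence\<close>

definition slowly_varying :: "(real \<Rightarrow> real) \<Rightarrow> bool" where
  "slowly_varying l \<longleftrightarrow> l \<in> borel_measurable borel \<and> (\<forall>\<^sub>F x in at_top. 0 < l x) \<and>
     (\<forall>c>0. ((\<lambda>x. l (c * x) / l x) \<longlongrightarrow> 1) at_top)"

definition regularly_varying_rv :: "'w measure \<Rightarrow> real \<Rightarrow> ('w \<Rightarrow> real) \<Rightarrow> bool" where
  "regularly_varying_rv M \<alpha> Z \<longleftrightarrow> Z \<in> borel_measurable M \<and>
     (\<exists>l. slowly_varying l \<and>
       (\<forall>x>0. measure M {\<omega>\<in>space M. Z \<omega> > x} = x powr (- \<alpha>) * l x))"

text \<open>The defining property of \<open>\<alpha>\<close>-stability for independent copies \<open>X, Y\<close> of \<open>G\<close>: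
  \<open>a X + b Y\<close> and \<open>(a\<^sup>\<alpha> + b\<^sup>\<alpha>)\<^bsup>1/\<alpha>\<^esup> X + d\<close> have the same law; degenerate laws are excluded.\<close>

definition stable_law :: "real \<Rightarrow> real measure \<Rightarrow> bool" where
  "stable_law \<alpha> G \<longleftrightarrow> real_distribution G \<and> (\<nexists>c. G = return borel c) \<and>
     (\<forall>a>0. \<forall>b>0. \<exists>d.
        distr (G \<Otimes>\<^sub>M G) borel (\<lambda>(x, y). a * x + b * y) =
        distr G borel (\<lambda>x. (a powr \<alpha> + b powr \<alpha>) powr (1 / \<alpha>) * x + d))"

text \<open>\<open>Y\<^sub>t = o\<^sub>P(b\<^sub>t)\<close> as \<open>t \<rightarrow> \<infinity>\<close>.\<close>

definition small_o_in_prob :: "'w measure \<Rightarrow> (real \<Rightarrow> 'w \<Rightarrow> real) \<Rightarrow> (real \<Rightarrow> real) \<Rightarrow> bool" where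
  "small_o_in_prob M Y b \<longleftrightarrow>
     (\<forall>\<delta>>0. ((\<lambda>t. measure M {\<omega>\<in>space M. \<bar>Y t \<omega> / b t\<bar> > \<delta>}) \<longlongrightarrow> 0) at_top)"

text \<open>The counterpart of \<^const>\<open>weak_conv_m\<close> for a continuous parameter tending to infinity.\<close>

definition converges_in_distribution ::
    "'w measure \<Rightarrow> (real \<Rightarrow> 'w \<Rightarrow> real) \<Rightarrow> real measure \<Rightarrow> bool" where
  "converges_in_distribution M Z G \<longleftrightarrow>
     (\<forall>t. Z t \<in> borel_measurable M) \<and>
     (\<forall>x. isCont (cdf G) x \<longrightarrow> ((\<lambda>t. cdf (distr M borel (Z t)) x) \<longlongrightarrow> cdf G x) at_top)"

end

theory Submission
  imports Defs "HOL-Real_Asymp.Real_Asymp"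
begin

text \<open>The claims of all clusters whose parent arrives by time \<open>t\<close> add up to
\<open>W t = (\<Sum>i<N t. D i)\<close>, where \<open>N t\<close> is the number of these parents, and
\<open>S t = W t - \<epsilon> t\<close> almost surely: what \<open>W t\<close> counts too much is exactly the residue.
The residue is negligible by assumption, so everything rests on \<open>W t\<close>.

Conditionally on the parent process the clusters are independent, and the parents form a Poisson process
with i.i.d. marks. Hence \<open>W t\<close> is a compound Poisson sum: averaging first over the clusters
(\<open>cluster_totals_given_parents\<close>) turns its characteristic function into the generating functional
of the parent process (\<open>generating_functional\<close>), and since the first mark has law \<open>Q\<close>
(\<open>first_mark_law\<close>), the result is \<open>exp (\<nu> t (\<phi> u - 1))\<close> with \<open>\<phi>\<close>
the characteristic function of \<open>D\<close> (\<open>char_immigrant_total\<close>).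

After centring and scaling by \<open>b = a\<^bsub>\<lfloor>\<nu> t\<rfloor>\<^esub>\<close> the exponent becomes
\<open>\<nu> t E(exp (i u D / b) - 1 - i u D / b)\<close>. Integration by parts writes it as
\<open>\<integral>\<^sub>0\<^sup>\<infinity> i u (exp (i u x) - 1) \<nu> t P(D > b x) dx\<close>
(\<open>char_scaled_tail_formula\<close>). Regular variation and the choice of \<open>a\<close> make
\<open>\<nu> t P(D > b x)\<close> converge to \<open>x\<^bsup>-\<alpha>\<^esup>\<close>, and the Potter bounds, together with
\<open>1 < \<alpha> < 2\<close>, allow dominated convergence (\<open>scaled_tail_integral_tendsto\<close>). The limit
\<open>\<Psi> u\<close> of the exponent is homogeneous, \<open>\<Psi> (c u) = c\<^sup>\<alpha> \<Psi> u\<close> for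
\<open>c > 0\<close>, which is strict \<open>\<alpha>\<close>-stability, and it is continuous at \<open>0\<close>, so that by
tightness \<open>exp \<Psi>\<close> is the characteristic function of a law (\<open>levy_limit_exists\<close>).

The residue is controlled at scale \<open>a\<^bsub>\<lfloor>t\<rfloor>\<^esub>\<close> while the claims are divided by
\<open>a\<^bsub>\<lfloor>\<nu> t\<rfloor>\<^esub>\<close>. The two scales are comparable
(\<open>norming_sequence_ratio_bounded\<close>), and a perturbation that vanishes in probability does not change
the limit of the characteristic functions (\<open>char_perturbation\<close>).\<close>

section \<open>Regularly varying tails\<close>

text \<open>The tail \<open>x \<mapsto> P(Z > x)\<close> of a regularly varying variable. Monotonicity takes the place of the
uniform convergence theorem for slowly varying functions: it extends estimates along a geometric sequence to the whole
half-line.\<close>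

locale regularly_varying_tail =
  fixes F :: "real \<Rightarrow> real" and \<alpha> :: real
  assumes antimono: "x \<le> y \<Longrightarrow> F y \<le> F x"
    and pos: "0 < F x"
    and le_1: "F x \<le> 1"
    and ratio: "0 < c \<Longrightarrow> ((\<lambda>x. F (c * x) / F x) \<longlongrightarrow> c powr (- \<alpha>)) at_top"
begin

text \<open>Far out, doubling the argument multiplies \<open>F\<close> by a factor close to \<open>2\<^bsup>-\<alpha>\<^esup>\<close>, hence
between \<open>2\<^bsup>-p\<^esup>\<close> and \<open>2\<^bsup>-q\<^esup>\<close>. Iterating this gives the bounds at \<open>y = 2\<^sup>k x\<close>; for the
other \<open>y\<close> monotonicity costs one more doubling, which is the constant.\<close>

lemma potter_bound:
  assumes "0 < q" "q < \<alpha>" "\<alpha> < p"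
  obtains C x0 where "0 < C" "0 < x0"
    "\<And>x y. x0 \<le> x \<Longrightarrow> x \<le> y \<Longrightarrow> F y \<le> C * (y / x) powr (- q) * F x"
    "\<And>x y. x0 \<le> x \<Longrightarrow> x \<le> y \<Longrightarrow> F x \<le> C * (y / x) powr p * F y"
proof -
  have "eventually (\<lambda>x. F (2 * x) / F x < 2 powr (- q)) at_top"
    using assms by (intro order_tendstoD[OF ratio]) auto
  moreover have "eventually (\<lambda>x. 2 powr (- p) < F (2 * x) / F x) at_top"
    using assms by (intro order_tendstoD[OF ratio]) auto
  ultimately have "eventually (\<lambda>x. F (2 * x) \<le> 2 powr (- q) * F x \<and> F x \<le> 2 powr p * F (2 * x)) at_top"
  proof eventually_elim
    case (elim x)
    then show ?case using pos[of x] pos[of "2 * x"]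
      by (auto simp: field_simps powr_minus)
  qed
  then obtain x1 where x1: "\<And>x. x1 \<le> x \<Longrightarrow> F (2 * x) \<le> 2 powr (- q) * F x \<and> F x \<le> 2 powr p * F (2 * x)"
    by (auto simp: eventually_at_top_linorder)
  \<comment> \<open>A positive threshold, so that doubling moves an argument above it further to the right.\<close>
  define x0 where "x0 = max x1 1"
  have iter: "F (2 ^ k * x) \<le> (2 ^ k) powr (- q) * F x \<and> F x \<le> (2 ^ k) powr p * F (2 ^ k * x)"
    if "x0 \<le> x" for k :: nat and x
  proof (induction k)
    case (Suc k)
    have "1 * x \<le> 2 ^ k * x"
      using that by (intro mult_right_mono) (auto simp: x0_def)
    then have *: "x1 \<le> 2 ^ k * x" using that unfolding x0_def by linarith
    have "F (2 ^ Suc k * x) \<le> 2 powr (- q) * F (2 ^ k * x)"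
      using x1[OF *] by (simp add: mult.assoc)
    also have "\<dots> \<le> 2 powr (- q) * ((2 ^ k) powr (- q) * F x)"
      using Suc by (intro mult_left_mono) auto
    also have "\<dots> = (2 ^ Suc k) powr (- q) * F x"
      by (simp add: powr_mult)
    finally have 1: "F (2 ^ Suc k * x) \<le> (2 ^ Suc k) powr (- q) * F x" .
    have "F x \<le> (2 ^ k) powr p * F (2 ^ k * x)" using Suc by simp
    also have "\<dots> \<le> (2 ^ k) powr p * (2 powr p * F (2 ^ Suc k * x))"
      using x1[OF *] by (intro mult_left_mono) (auto simp: mult.assoc)
    also have "\<dots> = (2 ^ Suc k) powr p * F (2 ^ Suc k * x)"
      by (simp add: powr_mult)
    finally show ?case using 1 by simp
  qed simp
  have main: "F y \<le> 2 powr p * (y / x) powr (- q) * F x \<and> F x \<le> 2 powr p * (y / x) powr p * F y"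
    if xy: "x0 \<le> x" "x \<le> y" for x y
  proof -
    have x: "0 < x" using xy by (auto simp: x0_def)
    \<comment> \<open>\<open>2\<^sup>k \<le> y / x < 2\<^bsup>k+1\<^esup>\<close>\<close>
    define k where "k = nat \<lfloor>log 2 (y / x)\<rfloor>"
    have l: "0 \<le> log 2 (y / x)" using x xy by (subst zero_le_log_cancel_iff) auto
    have "2 powr real k \<le> 2 powr (log 2 (y / x))"
      using l unfolding k_def by (intro powr_mono) auto
    then have k1: "2 ^ k \<le> y / x" using x xy by (simp add: powr_realpow)
    have "2 powr (log 2 (y / x)) \<le> 2 powr (real k + 1)"
      using l unfolding k_def by (intro powr_mono) linarith+
    then have k2: "y / x \<le> 2 ^ Suc k" using x xy by (simp add: powr_realpow powr_add)
    have "F y \<le> F (2 ^ k * x)" using k1 x by (intro antimono) (auto simp: field_simps)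
    also have "\<dots> \<le> (2 ^ k) powr (- q) * F x" using iter[OF xy(1)] by blast
    also have "\<dots> \<le> ((y / x) / 2) powr (- q) * F x"
      using k2 assms pos[of x] x xy
      by (intro mult_right_mono powr_mono2') (auto simp: field_simps)
    also have "((y / x) / 2) powr (- q) = 2 powr q * (y / x) powr (- q)"
      using x xy by (simp add: powr_divide powr_minus powr_mult field_simps)
    also have "\<dots> * F x \<le> 2 powr p * (y / x) powr (- q) * F x"
      using assms pos[of x] by (intro mult_right_mono) (auto intro: powr_mono)
    finally have 1: "F y \<le> 2 powr p * (y / x) powr (- q) * F x" .
    have "F x \<le> (2 ^ Suc k) powr p * F (2 ^ Suc k * x)" using iter[OF xy(1)] by blast
    also have "\<dots> \<le> (2 * (y / x)) powr p * F y"
      using k1 k2 x xy assms pos[of "2 ^ Suc k * x"] 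
      by (intro mult_mono powr_mono2 antimono) (auto simp: field_simps less_imp_le)
    also have "\<dots> = 2 powr p * (y / x) powr p * F y" using x xy by (simp add: powr_divide powr_mult)
    finally show ?thesis using 1 by simp
  qed
  show thesis
    by (rule that[of "2 powr p" x0]) (use main in \<open>auto simp: x0_def\<close>)
qed

text \<open>A bound uniform in the scale \<open>b\<close> and valid for every \<open>x > 0\<close>, as dominated convergence requires.
Where \<open>b x\<close> is below the threshold of the Potter bounds, \<open>F \<le> 1\<close> is enough: by the lower bound \<open>F b\<close> is at
least of order \<open>(b / x0)\<^bsup>-p\<^esup>\<close>, and \<open>b / x0 < 1 / x\<close> there.\<close>

lemma scaled_tail_bound:
  assumes "0 < q" "q < \<alpha>" "\<alpha> < p"
  obtains C x0 where "0 < C" "0 < x0"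
    "\<And>b x. x0 \<le> b \<Longrightarrow> 0 < x \<Longrightarrow> F (b * x) \<le> C * (x powr (- p) + x powr (- q)) * F b"
proof -
  obtain C x0 where C: "0 < C" "0 < x0"
    and up: "\<And>x y. x0 \<le> x \<Longrightarrow> x \<le> y \<Longrightarrow> F y \<le> C * (y / x) powr (- q) * F x"
    and lo: "\<And>x y. x0 \<le> x \<Longrightarrow> x \<le> y \<Longrightarrow> F x \<le> C * (y / x) powr p * F y"
    using potter_bound[OF assms] by metis
  \<comment> \<open>The summand \<open>C / F x0\<close> pays for the bound \<open>F \<le> 1\<close> below the threshold.\<close>
  define C' where "C' = C * (1 + 1 / F x0)"
  have C': "C \<le> C'" "C / F x0 \<le> C'" "0 < C'"
    using C pos[of x0] by (auto simp: C'_def distrib_left intro: add_pos_pos)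
  have *: "F (b * x) \<le> C' * (x powr (- p) + x powr (- q)) * F b" if b: "x0 \<le> b" and x: "0 < x" for b x
  proof -
    have b0: "0 < b" using b C by simp
    consider "1 \<le> x" | "x < 1" "x0 \<le> b * x" | "x < 1" "b * x < x0" by linarith
    then have "\<exists>r\<in>{- p, - q}. F (b * x) \<le> C' * x powr r * F b"
    proof cases
      case 1
      have "F (b * x) \<le> C * (b * x / b) powr (- q) * F b" using b b0 1 by (intro up) auto
      also have "b * x / b = x" using b0 by simp
      also have "C * x powr (- q) * F b \<le> C' * x powr (- q) * F b"
        using b0 C' pos[of b] by (intro mult_right_mono) auto
      finally show ?thesis by blast
    next
      case 2
      have "F (b * x) \<le> C * (b / (b * x)) powr p * F b" using b0 2 by (intro lo) auto
      also have "(b / (b * x)) powr p = x powr (- p)"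
        using b0 x by (simp add: powr_minus powr_divide field_simps)
      also have "C * x powr (- p) * F b \<le> C' * x powr (- p) * F b"
        using b0 C' pos[of b] by (intro mult_right_mono) auto
      finally show ?thesis by blast
    next
      case 3
      have "F (b * x) * F x0 \<le> 1 * F x0"
        using le_1 pos[of x0] by (intro mult_right_mono) auto
      also have "\<dots> \<le> C * (b / x0) powr p * F b" using lo[of x0 b] b by simp
      also have "\<dots> \<le> C * (1 / x) powr p * F b"
        using C b0 x 3 pos[of b] assms
        by (intro mult_right_mono mult_left_mono powr_mono2) (auto simp: field_simps)
      also have "\<dots> = C * x powr (- p) * F b" using x by (simp add: powr_minus powr_divide field_simps)
      finally have "F (b * x) \<le> C / F x0 * x powr (- p) * F b"
        using pos[of x0] by (simp add: field_simps)
      also have "\<dots> \<le> C' * x powr (- p) * F b"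
        using b0 C' pos[of b] by (intro mult_right_mono) auto
      finally show ?thesis by blast
    qed
    then obtain r where r: "r = - p \<or> r = - q" "F (b * x) \<le> C' * x powr r * F b" by blast
    have "x powr r \<le> x powr (- p) + x powr (- q)" using r(1) by auto
    then have "C' * x powr r * F b \<le> C' * (x powr (- p) + x powr (- q)) * F b"
      using C' pos[of b] by (intro mult_right_mono mult_left_mono) auto
    with r(2) show ?thesis by linarith
  qed
  show thesis by (rule that[of C' x0]) (use * C C' in auto)
qed

end

section \<open>The exponent of the stable limit\<close>

text \<open>The factor \<open>min x 1\<close> is the size of the kernel of the exponent, which vanishes linearly at \<open>0\<close> and stays
bounded at infinity. So \<open>r < 2\<close> is what integrability at \<open>0\<close> needs, and \<open>r > 1\<close> at infinity.\<close>

lemma integrable_min_powr: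
  fixes r :: real
  assumes "1 < r" "r < 2"
  shows "integrable lborel (\<lambda>x::real. indicator {0<..} x * (min x 1 * x powr (- r)))"
proof -
  have "(\<lambda>x::real. x powr (1 - r)) absolutely_integrable_on {0..1}"
    using assms by (subst absolutely_integrable_on_iff_nonneg) (auto intro!: integrable_on_powr_from_0)
  then have "integrable lborel (\<lambda>x::real. indicator {0..1} x *\<^sub>R x powr (1 - r))"
    unfolding set_integrable_def by (subst (asm) integrable_completion) auto
  moreover have "(\<lambda>x::real. x powr (- r)) integrable_on {1..}"
    using has_integral_powr_to_inf[of "- r" 1] assms by (auto simp: integrable_on_def)
  then have "(\<lambda>x::real. x powr (- r)) absolutely_integrable_on {1..}"
    by (subst absolutely_integrable_on_iff_nonneg) auto
  then have "integrable lborel (\<lambda>x::real. indicator {1..} x *\<^sub>R x powr (- r))"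
    unfolding set_integrable_def by (subst (asm) integrable_completion) auto
  ultimately have "integrable lborel (\<lambda>x::real. indicator {0..1} x *\<^sub>R x powr (1 - r) +
      indicator {1..} x *\<^sub>R x powr (- r))"
    by (rule Bochner_Integration.integrable_add)
  then show ?thesis
    by (rule Bochner_Integration.integrable_bound)
       (auto split: split_indicator simp: min_def powr_diff powr_minus field_simps)
qed

text \<open>The derivative of \<open>exp (i u x) - 1 - i u x\<close> in \<open>x\<close>.\<close>

definition stable_kernel :: "real \<Rightarrow> real \<Rightarrow> complex" where
  "stable_kernel u x = \<i> * u * (iexp (u * x) - 1)"

lemma stable_kernel_measurable [measurable]: "stable_kernel u \<in> borel_measurable borel"
  unfolding stable_kernel_def by measurable

lemma norm_stable_kernel_le:
  assumes "0 < x"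
  shows "norm (stable_kernel u x) \<le> (2 * \<bar>u\<bar> + u\<^sup>2) * min x 1"
proof -
  have "norm (iexp (u * x) - 1) \<le> min (\<bar>u * x\<bar>) 2"
    using iexp_approx1[of "u * x" 0] iexp_approx2[of "u * x" 0] by simp
  also have "\<dots> \<le> (\<bar>u\<bar> + 2) * min x 1"
    using assms by (auto simp: min_def abs_mult field_simps)
  finally have "\<bar>u\<bar> * norm (iexp (u * x) - 1) \<le> \<bar>u\<bar> * ((\<bar>u\<bar> + 2) * min x 1)"
    by (intro mult_left_mono) auto
  also have "\<dots> = (2 * \<bar>u\<bar> + u\<^sup>2) * min x 1"
    by (auto simp: power2_eq_square algebra_simps)
  finally show ?thesis by (simp add: stable_kernel_def norm_mult)
qed

text \<open>The Levy--Khinchin exponent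
\<open>\<integral>\<^sub>0\<^sup>\<infinity> (exp (i u x) - 1 - i u x) \<alpha> x\<^bsup>-\<alpha>-1\<^esup> dx\<close> of the spectrally positive \<open>\<alpha>\<close>-stable law, after an
integration by parts. In this form it is the limit of integrals against distribution tails.\<close>

definition stable_exponent :: "real \<Rightarrow> real \<Rightarrow> complex" where
  "stable_exponent \<alpha> u = (\<integral>x. (indicator {0<..} x * x powr (- \<alpha>)) *\<^sub>R stable_kernel u x \<partial>lborel)"

lemma integrable_stable_exponent:
  assumes "1 < \<alpha>" "\<alpha> < 2"
  shows "integrable lborel (\<lambda>x. (indicator {0<..} x * x powr (- \<alpha>)) *\<^sub>R stable_kernel u x)"
proof (rule Bochner_Integration.integrable_bound)
  show "integrable lborel (\<lambda>x::real. (2 * \<bar>u\<bar> + u\<^sup>2) * (indicator {0<..} x * (min x 1 * x powr (- \<alpha>))))"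
    by (intro integrable_mult_right integrable_min_powr assms)
  show "AE x in lborel. norm ((indicator {0<..} x * x powr (- \<alpha>)) *\<^sub>R stable_kernel u x)
      \<le> norm ((2 * \<bar>u\<bar> + u\<^sup>2) * (indicator {0<..} x * (min x 1 * x powr (- \<alpha>))))"
  proof (rule AE_I2)
    fix x :: real
    show "norm ((indicator {0<..} x * x powr (- \<alpha>)) *\<^sub>R stable_kernel u x)
      \<le> norm ((2 * \<bar>u\<bar> + u\<^sup>2) * (indicator {0<..} x * (min x 1 * x powr (- \<alpha>))))"
      using mult_left_mono[OF norm_stable_kernel_le[of x u], of "x powr (- \<alpha>)"]
      by (cases "0 < x") (auto simp: abs_mult mult_ac)
  qed
qed measurable

text \<open>Substitution \<open>x \<mapsto> c x\<close> in the integral. The homogeneity yields continuity at \<open>0\<close> and strict stability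
without evaluating the integral.\<close>

lemma stable_exponent_scale:
  assumes "0 < c"
  shows "stable_exponent \<alpha> (c * u) = (c powr \<alpha>) *\<^sub>R stable_exponent \<alpha> u"
proof -
  have "stable_exponent \<alpha> u = c *\<^sub>R
      (\<integral>x. (indicator {0<..} (c * x) * (c * x) powr (- \<alpha>)) *\<^sub>R stable_kernel u (c * x) \<partial>lborel)"
    unfolding stable_exponent_def using assms
    by (subst lborel_integral_real_affine[of c _ 0]) auto
  also have "(\<lambda>x. (indicator {0<..} (c * x) * (c * x) powr (- \<alpha>)) *\<^sub>R stable_kernel u (c * x)) =
      (\<lambda>x. (c powr (- \<alpha>) / c) *\<^sub>R ((indicator {0<..} x * x powr (- \<alpha>)) *\<^sub>R stable_kernel (c * u) x))"
    using assms
    by (auto simp: fun_eq_iff stable_kernel_def powr_mult zero_less_mult_iff scaleR_conv_of_real field_simps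
        split: split_indicator)
  also have "c *\<^sub>R (\<integral>x. \<dots> x \<partial>lborel) = c powr (- \<alpha>) *\<^sub>R stable_exponent \<alpha> (c * u)"
    using assms by (subst integral_scaleR_right) (simp add: stable_exponent_def)
  finally show ?thesis using assms by (simp add: powr_minus)
qed

lemma stable_exponent_0 [simp]: "stable_exponent \<alpha> 0 = 0"
  by (simp add: stable_exponent_def stable_kernel_def)

text \<open>By homogeneity \<open>\<bar>\<Psi> u\<bar>\<close> is \<open>\<bar>u\<bar>\<^sup>\<alpha>\<close> times one of the two values \<open>\<bar>\<Psi> 1\<bar>\<close> and
\<open>\<bar>\<Psi> (-1)\<bar>\<close>.\<close>

lemma isCont_stable_exponent_0:
  assumes "0 < \<alpha>"
  shows "isCont (stable_exponent \<alpha>) 0"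
proof -
  define B where "B = norm (stable_exponent \<alpha> 1) + norm (stable_exponent \<alpha> (- 1))"
  have "norm (stable_exponent \<alpha> u) \<le> \<bar>u\<bar> powr \<alpha> * B" for u
  proof (cases "u = 0")
    case False
    have "stable_exponent \<alpha> u = \<bar>u\<bar> powr \<alpha> *\<^sub>R stable_exponent \<alpha> (sgn u)"
      using False stable_exponent_scale[of "\<bar>u\<bar>" \<alpha> "sgn u"] by (simp add: abs_mult_sgn)
    moreover have "norm (stable_exponent \<alpha> (sgn u)) \<le> B"
      using False by (auto simp: B_def sgn_if)
    ultimately show ?thesis by (simp add: mult_left_mono)
  qed simp
  then have ev: "eventually (\<lambda>u. norm (stable_exponent \<alpha> u) \<le> \<bar>u\<bar> powr \<alpha> * B) (at 0)"
    by (intro always_eventually allI)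
  have "((\<lambda>u::real. \<bar>u\<bar>) \<longlongrightarrow> 0) (at 0)" by (intro tendsto_rabs_zero tendsto_ident_at)
  then have "((\<lambda>u. \<bar>u\<bar> powr \<alpha>) \<longlongrightarrow> 0) (at 0)"
    by (rule tendsto_zero_powrI[OF _ tendsto_const]) (use assms in auto)
  then have "((\<lambda>u. \<bar>u\<bar> powr \<alpha> * B) \<longlongrightarrow> 0) (at 0)"
    by (rule tendsto_mult_left_zero)
  then show ?thesis
    unfolding isCont_def stable_exponent_0 by (rule Lim_null_comparison[OF ev])
qed

text \<open>The imaginary part is the integral of \<open>x\<^bsup>-\<alpha>\<^esup> (cos x - 1)\<close>, which is nowhere positive and negative on
\<open>(1, 2)\<close>. It is what rules out a degenerate limit.\<close>

lemma Im_stable_exponent_less_0: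
  assumes "1 < \<alpha>" "\<alpha> < 2"
  shows "Im (stable_exponent \<alpha> 1) < 0"
proof -
  define g where "g x = indicator {0<..} x * x powr (- \<alpha>) * (1 - cos x)" for x :: real
  have Im: "Im ((indicator {0<..} x * x powr (- \<alpha>)) *\<^sub>R stable_kernel 1 x) = - g x" for x
    by (simp add: stable_kernel_def g_def Re_exp Im_exp algebra_simps)
  have int: "integrable lborel g"
    using integrable_Im[OF integrable_stable_exponent[OF assms, of 1]] unfolding Im by simp
  have eq: "Im (stable_exponent \<alpha> 1) = - integral\<^sup>L lborel g"
    unfolding stable_exponent_def
    by (subst integral_Im[symmetric, OF integrable_stable_exponent[OF assms]]) (simp only: Im, simp)
  have nonneg: "0 \<le> g x" for x by (auto simp: g_def)
  have "integral\<^sup>L lborel g \<noteq> 0"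
  proof
    assume "integral\<^sup>L lborel g = 0"
    then have "AE x in lborel. g x = 0"
      using integral_nonneg_eq_0_iff_AE[OF int] nonneg by simp
    then have "AE x in lborel. x \<notin> {1<..<2::real}"
    proof eventually_elim
      case (elim x)
      show ?case
      proof
        assume x: "x \<in> {1<..<2}"
        then have "cos x = 1" using elim by (simp add: g_def)
        moreover have "cos x < cos 0"
          using x pi_gt3 by (intro cos_monotone_0_pi) auto
        ultimately show False by simp
      qed
    qed
    then have "{1<..<2::real} \<in> null_sets lborel"
      by (subst AE_iff_null_sets) auto
    then have "emeasure lborel {1<..<2::real} = 0" by (rule null_setsD1)
    then show False by (subst (asm) emeasure_lborel_Ioo) auto
  qed
  moreover have "0 \<le> integral\<^sup>L lborel g" using nonneg by (rule Bochner_Integration.integral_nonneg)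
  ultimately show ?thesis unfolding eq by simp
qed

context regularly_varying_tail
begin

lemma tail_measurable [measurable]: "F \<in> borel_measurable borel"
proof -
  have "(\<lambda>x. - F x) \<in> borel_measurable borel"
    by (intro borel_measurable_mono) (auto simp: mono_def antimono)
  then have "(\<lambda>x. - (- F x)) \<in> borel_measurable borel" by (rule borel_measurable_uminus)
  then show ?thesis by simp
qed

lemma scaled_tail_tendsto:
  assumes a: "filterlim a at_top sequentially" and na: "(\<lambda>n. real n * F (a n)) \<longlonglongrightarrow> 1" and x: "0 < x"
  shows "(\<lambda>n. real n * F (a n * x)) \<longlonglongrightarrow> x powr (- \<alpha>)"
proof -
  have "(\<lambda>n. F (x * a n) / F (a n)) \<longlonglongrightarrow> x powr (- \<alpha>)"
    using filterlim_compose[OF ratio[OF x] a] .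
  then have "(\<lambda>n. (F (x * a n) / F (a n)) * (real n * F (a n))) \<longlonglongrightarrow> x powr (- \<alpha>) * 1"
    by (intro tendsto_mult na)
  then show ?thesis using pos by (simp add: mult.commute less_imp_neq[symmetric])
qed

text \<open>Dominated convergence. The exponents \<open>p\<close> and \<open>q\<close> of the bound are chosen on the two sides of \<open>\<alpha>\<close>
but still inside \<open>(1, 2)\<close>, so that the majorant is integrable both at \<open>0\<close> and at infinity.\<close>

lemma scaled_tail_integral_tendsto:
  assumes \<alpha>: "1 < \<alpha>" "\<alpha> < 2"
    and a: "filterlim a at_top sequentially" and na: "(\<lambda>n. real n * F (a n)) \<longlonglongrightarrow> 1"
  shows "(\<lambda>n. real n *\<^sub>R (\<integral>x. (indicator {0<..} x * F (a n * x)) *\<^sub>R stable_kernel u x \<partial>lborel))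
    \<longlonglongrightarrow> stable_exponent \<alpha> u"
proof -
  define p q where "p = (\<alpha> + 2) / 2" and "q = (\<alpha> + 1) / 2"
  have pq: "1 < q" "q < \<alpha>" "\<alpha> < p" "p < 2" "0 < q" "q < 2" "1 < p" using \<alpha> by (auto simp: p_def q_def)
  obtain C x0 where C: "0 < C" "0 < x0"
    "\<And>b x. x0 \<le> b \<Longrightarrow> 0 < x \<Longrightarrow> F (b * x) \<le> C * (x powr (- p) + x powr (- q)) * F b"
    using scaled_tail_bound[of q p] pq by metis
  have "eventually (\<lambda>n. x0 \<le> a n \<and> real n * F (a n) \<le> 2) sequentially"
    using a order_tendstoD(2)[OF na, of 2]
    by (auto simp: filterlim_at_top elim: eventually_elim2)
  then obtain N where N: "\<And>n. N \<le> n \<Longrightarrow> x0 \<le> a n \<and> real n * F (a n) \<le> 2"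
    by (auto simp: eventually_sequentially)
  define w where "w x = 2 * C * (2 * \<bar>u\<bar> + u\<^sup>2) * (indicator {0<..} x * (min x 1 * x powr (- p)) +
      indicator {0<..} x * (min x 1 * x powr (- q)))" for x :: real
  define s where "s n x = (indicator {0<..} x * (real n * F (a n * x))) *\<^sub>R stable_kernel u x" for n x
  have bound: "norm (s n x) \<le> w x" if n: "N \<le> n" for n x
  proof (cases "0 < x")
    case True
    have "real n * F (a n * x) \<le> real n * (C * (x powr (- p) + x powr (- q)) * F (a n))"
      using N[OF n] True by (intro mult_left_mono C(3)) auto
    also have "\<dots> = (real n * F (a n)) * (C * (x powr (- p) + x powr (- q)))" by simp
    also have "\<dots> \<le> 2 * (C * (x powr (- p) + x powr (- q)))"
      using N[OF n] C by (intro mult_right_mono) auto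
    finally have *: "real n * F (a n * x) \<le> 2 * (C * (x powr (- p) + x powr (- q)))" .
    have "norm (s n x) = (real n * F (a n * x)) * norm (stable_kernel u x)"
      using True pos[of "a n * x"] by (simp add: s_def abs_mult)
    also have "\<dots> \<le> (2 * (C * (x powr (- p) + x powr (- q)))) * ((2 * \<bar>u\<bar> + u\<^sup>2) * min x 1)"
      using True C by (intro mult_mono * norm_stable_kernel_le) auto
    also have "\<dots> = w x" using True by (simp add: w_def algebra_simps)
    finally show ?thesis .
  qed (simp add: s_def w_def)
  have "(\<lambda>n. integral\<^sup>L lborel (s (n + N))) \<longlonglongrightarrow> stable_exponent \<alpha> u"
    unfolding stable_exponent_def
  proof (rule integral_dominated_convergence)
    show "integrable lborel w" unfolding w_def using pq
      by (intro integrable_mult_right Bochner_Integration.integrable_add integrable_min_powr)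
    show "AE x in lborel. (\<lambda>n. s (n + N) x) \<longlonglongrightarrow> (indicator {0<..} x * x powr (- \<alpha>)) *\<^sub>R stable_kernel u x"
    proof (rule AE_I2)
      fix x :: real
      show "(\<lambda>n. s (n + N) x) \<longlonglongrightarrow> (indicator {0<..} x * x powr (- \<alpha>)) *\<^sub>R stable_kernel u x"
      proof (cases "0 < x")
        case True
        have "(\<lambda>n. s n x) \<longlonglongrightarrow> (indicator {0<..} x * x powr (- \<alpha>)) *\<^sub>R stable_kernel u x"
          unfolding s_def by (intro tendsto_intros scaled_tail_tendsto a na True)
        then show ?thesis by (rule LIMSEQ_ignore_initial_segment)
      qed (simp add: s_def)
    qed
    show "AE x in lborel. norm (s (n + N) x) \<le> w x" for n
      by (intro AE_I2 bound) auto
  qed (auto simp: s_def[abs_def])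
  then have "(\<lambda>n. integral\<^sup>L lborel (s n)) \<longlonglongrightarrow> stable_exponent \<alpha> u"
    by (rule LIMSEQ_offset)
  moreover have "integral\<^sup>L lborel (s n) =
      real n *\<^sub>R (\<integral>x. (indicator {0<..} x * F (a n * x)) *\<^sub>R stable_kernel u x \<partial>lborel)" for n
    unfolding s_def by (subst integral_scaleR_right[symmetric]) (simp add: mult_ac)
  ultimately show ?thesis by simp
qed

end

section \<open>Characteristic functions and tails\<close>

text \<open>Integration by parts in the form of Fubini's theorem: \<open>exp (i u y) - 1 - i u y\<close> is the integral of the kernel over
\<open>(0, y)\<close>, and exchanging the integrals leaves \<open>P(y > x)\<close>.\<close>

lemma char_tail_formula:
  assumes "real_distribution \<mu>" and nonneg: "AE y in \<mu>. 0 \<le> y" and int: "integrable \<mu> (\<lambda>y. y)"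
  shows "char \<mu> u - 1 - \<i> * u * (\<integral>y. y \<partial>\<mu>) =
    (\<integral>x. (indicator {0<..} x * measure \<mu> {x<..}) *\<^sub>R stable_kernel u x \<partial>lborel)"
proof -
  interpret \<mu>: real_distribution \<mu> by fact
  interpret pair_sigma_finite \<mu> lborel ..
  define h where
    "h = (\<lambda>(y, x). (indicator {0<..} x * (if x < y then 1 else 0)) *\<^sub>R stable_kernel u x)"
  have h_meas [measurable]: "h \<in> borel_measurable (\<mu> \<Otimes>\<^sub>M lborel)"
    unfolding h_def by measurable
  have h_le: "norm (h (y, x)) \<le> 2 * \<bar>u\<bar> * indicator {0..\<bar>y\<bar>} x" for x y
    using iexp_approx2[of "u * x" 0]
    by (auto simp: h_def stable_kernel_def norm_mult mult_ac intro!: mult_left_mono split: split_indicator)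
  have h_int1: "integrable lborel (\<lambda>x. h (y, x))" for y
    by (rule Bochner_Integration.integrable_bound[where f = "\<lambda>x. 2 * \<bar>u\<bar> * indicator {0..\<bar>y\<bar>} x"])
       (use h_le in \<open>auto simp: abs_mult\<close>)
  have h_int: "integrable (\<mu> \<Otimes>\<^sub>M lborel) h"
  proof (rule Fubini_integrable)
    show "integrable \<mu> (\<lambda>y. \<integral>x. norm (h (y, x)) \<partial>lborel)"
    proof (rule Bochner_Integration.integrable_bound)
      show "integrable \<mu> (\<lambda>y. 2 * \<bar>u\<bar> * \<bar>y\<bar>)" using int by auto
      have "(\<integral>x. norm (h (y, x)) \<partial>lborel) \<le> 2 * \<bar>u\<bar> * \<bar>y\<bar>" for y
      proof -
        have "(\<integral>x. norm (h (y, x)) \<partial>lborel) \<le> (\<integral>x. 2 * \<bar>u\<bar> * indicator {0..\<bar>y\<bar>} x \<partial>lborel)"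
          using h_int1 h_le by (intro integral_mono) auto
        then show ?thesis by simp
      qed
      then show "AE y in \<mu>. norm (\<integral>x. norm (h (y, x)) \<partial>lborel) \<le> norm (2 * \<bar>u\<bar> * \<bar>y\<bar>)"
        by (auto simp: abs_mult)
    qed measurable
  qed (use h_int1 in auto)
  have inner: "(\<integral>x. h (y, x) \<partial>lborel) = iexp (u * y) - 1 - \<i> * u * y" if "0 \<le> y" for y
  proof -
    have "(\<integral>x. h (y, x) \<partial>lborel) = (\<integral>x. indicator {0..y} x *\<^sub>R stable_kernel u x \<partial>lborel)"
    proof (rule integral_cong_AE)
      show "AE x in lborel. h (y, x) = indicator {0..y} x *\<^sub>R stable_kernel u x"
        using AE_lborel_singleton[of y]
        by eventually_elim (auto simp: h_def stable_kernel_def split: split_indicator)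
    qed measurable
    also have "\<dots> = (iexp (u * y) - \<i> * u * y) - (iexp (u * 0) - \<i> * u * of_real 0)"
    proof (rule integral_FTC_atLeastAtMost[where F = "\<lambda>x. iexp (u * x) - \<i> * u * of_real x"])
      show "((\<lambda>x. iexp (u * x) - \<i> * u * of_real x) has_vector_derivative stable_kernel u x) (at x within {0..y})" for x
      proof -
        have "((\<lambda>x. cos (u * x)) has_field_derivative - u * sin (u * x)) (at x within {0..y})"
          by (auto intro!: derivative_eq_intros)
        moreover have "((\<lambda>x. sin (u * x) - u * x) has_field_derivative u * cos (u * x) - u) (at x within {0..y})"
          by (auto intro!: derivative_eq_intros)
        ultimately show ?thesis
          by (simp add: has_vector_derivative_complex_iff stable_kernel_def Re_exp Im_exp algebra_simps)
      qed
      show "continuous_on {0..y} (stable_kernel u)"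
        unfolding stable_kernel_def by (intro continuous_intros)
    qed fact
    finally show ?thesis by simp
  qed
  have iexp_int: "integrable \<mu> (\<lambda>y. iexp (u * y))"
    by (intro \<mu>.integrable_iexp) auto
  have "char \<mu> u - 1 - \<i> * u * (\<integral>y. y \<partial>\<mu>) = (\<integral>y. iexp (u * y) - 1 - \<i> * u * of_real y \<partial>\<mu>)"
    using int iexp_int \<mu>.prob_space by (simp add: char_def)
  also have "\<dots> = (\<integral>y. (\<integral>x. h (y, x) \<partial>lborel) \<partial>\<mu>)"
    using nonneg inner by (intro integral_cong_AE) auto
  also have "\<dots> = (\<integral>x. (\<integral>y. h (y, x) \<partial>\<mu>) \<partial>lborel)"
    using Fubini_integral[of "\<lambda>y x. h (y, x)"] h_int by (simp add: case_prod_beta')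
  also have "(\<lambda>x. \<integral>y. h (y, x) \<partial>\<mu>) =
      (\<lambda>x. (indicator {0<..} x * measure \<mu> {x<..}) *\<^sub>R stable_kernel u x)"
  proof
    fix x :: real
    have "(\<integral>y. h (y, x) \<partial>\<mu>) = (\<integral>y. indicator {x<..} y *\<^sub>R (indicator {0<..} x *\<^sub>R stable_kernel u x) \<partial>\<mu>)"
      by (intro Bochner_Integration.integral_cong) (auto simp: h_def split: split_indicator)
    also have "\<dots> = measure \<mu> {x<..} *\<^sub>R (indicator {0<..} x *\<^sub>R stable_kernel u x)"
      by (subst integral_scaleR_left) (auto intro!: integrable_real_indicator simp: \<mu>.emeasure_eq_measure)
    also have "\<dots> = (indicator {0<..} x * measure \<mu> {x<..}) *\<^sub>R stable_kernel u x"
      by simp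
    finally show "(\<integral>y. h (y, x) \<partial>\<mu>) = (indicator {0<..} x * measure \<mu> {x<..}) *\<^sub>R stable_kernel u x" .
  qed
  finally show ?thesis .
qed

lemma char_scaled_tail_formula:
  assumes "real_distribution \<mu>" and nonneg: "AE y in \<mu>. 0 \<le> y" and int: "integrable \<mu> (\<lambda>y. y)"
    and b: "0 < b"
  shows "char \<mu> (u / b) - 1 - \<i> * (u / b) * (\<integral>y. y \<partial>\<mu>) =
    (\<integral>x. (indicator {0<..} x * measure \<mu> {b * x<..}) *\<^sub>R stable_kernel u x \<partial>lborel)"
proof -
  have kernel: "stable_kernel (u / b) (b * x) = (1 / b) *\<^sub>R stable_kernel u x" for x
    using b by (simp add: stable_kernel_def scaleR_conv_of_real field_simps)
  have "char \<mu> (u / b) - 1 - \<i> * (u / b) * (\<integral>y. y \<partial>\<mu>) = b *\<^sub>R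
      (\<integral>x. (indicator {0<..} (b * x) * measure \<mu> {b * x<..}) *\<^sub>R stable_kernel (u / b) (b * x) \<partial>lborel)"
    using b by (subst char_tail_formula[OF assms(1-3)], subst lborel_integral_real_affine[of b _ 0]) auto
  also have "(\<lambda>x. (indicator {0<..} (b * x) * measure \<mu> {b * x<..}) *\<^sub>R stable_kernel (u / b) (b * x)) =
      (\<lambda>x. (1 / b) *\<^sub>R ((indicator {0<..} x * measure \<mu> {b * x<..}) *\<^sub>R stable_kernel u x))"
    using b unfolding kernel by (auto simp: fun_eq_iff zero_less_mult_iff split: split_indicator)
  also have "b *\<^sub>R (\<integral>x. \<dots> x \<partial>lborel) =
      (\<integral>x. (indicator {0<..} x * measure \<mu> {b * x<..}) *\<^sub>R stable_kernel u x \<partial>lborel)"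
    using b by (subst integral_scaleR_right) simp
  finally show ?thesis .
qed

text \<open>The mean is the integral of the tail, which the Potter bound compares with \<open>x\<^bsup>-q\<^esup>\<close> for some
\<open>q \<in> (1, \<alpha>)\<close>.\<close>

lemma integrable_of_regularly_varying_tail:
  assumes "real_distribution \<mu>" and nonneg: "AE y in \<mu>. 0 \<le> y"
    and F: "regularly_varying_tail (\<lambda>x. measure \<mu> {x<..}) \<alpha>" and \<alpha>: "1 < \<alpha>"
  shows "integrable \<mu> (\<lambda>y. y)"
proof -
  interpret \<mu>: real_distribution \<mu> by fact
  interpret F: regularly_varying_tail "\<lambda>x. measure \<mu> {x<..}" \<alpha> by fact
  interpret pair_sigma_finite \<mu> lborel ..
  define q where "q = (1 + \<alpha>) / 2"
  have q: "1 < q" "q < \<alpha>" using \<alpha> by (auto simp: q_def)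
  have "0 < q" "q < \<alpha>" "\<alpha> < \<alpha> + 1" using q by auto
  from F.potter_bound[OF this] obtain C x0 where C: "0 < C" "0 < x0" and
    up: "\<And>x y. x0 \<le> x \<Longrightarrow> x \<le> y \<Longrightarrow> measure \<mu> {y<..} \<le> C * (y / x) powr (- q) * measure \<mu> {x<..}" by metis
  define C' where "C' = C * x0 powr q"
  have C': "0 < C'" using C by (simp add: C'_def)
  have le: "measure \<mu> {x<..} \<le> C' * x powr (- q)" if "x0 \<le> x" for x
  proof -
    have "measure \<mu> {x<..} \<le> C * (x / x0) powr (- q) * 1"
      using that C by (intro order_trans[OF up[of x0 x]] mult_left_mono) auto
    also have "\<dots> = C' * x powr (- q)" using that C by (simp add: C'_def powr_divide powr_minus field_simps)
    finally show ?thesis .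
  qed
  have "(\<lambda>x::real. x powr (- q)) integrable_on {x0..}"
    using has_integral_powr_to_inf[of "- q" x0] q C by (auto simp: integrable_on_def)
  then have "(\<lambda>x::real. x powr (- q)) absolutely_integrable_on {x0..}"
    by (subst absolutely_integrable_on_iff_nonneg) auto
  then have "integrable lborel (\<lambda>x::real. indicator {x0..} x *\<^sub>R x powr (- q))"
    unfolding set_integrable_def by (subst (asm) integrable_completion) auto
  then have int_bd: "integrable lborel (\<lambda>x::real. indicator {0..x0} x + C' * (indicator {x0..} x *\<^sub>R x powr (- q)))"
    by (intro Bochner_Integration.integrable_add integrable_mult_right integrable_real_indicator) (use C in auto)
  have "(\<integral>\<^sup>+y. ennreal (norm y) \<partial>\<mu>) = (\<integral>\<^sup>+y. (\<integral>\<^sup>+x. indicator {0<..} x * (if x < y then 1 else 0) \<partial>lborel) \<partial>\<mu>)"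
  proof (rule nn_integral_cong_AE)
    show "AE y in \<mu>. ennreal (norm y) = (\<integral>\<^sup>+x. indicator {0<..} x * (if x < y then 1 else 0) \<partial>lborel)"
      using nonneg
    proof eventually_elim
      case (elim y)
      have "(\<integral>\<^sup>+x. indicator {0<..} x * (if x < y then 1 else 0) \<partial>lborel) = (\<integral>\<^sup>+x. indicator {0<..<y} x \<partial>lborel)"
        by (intro nn_integral_cong) (auto split: split_indicator)
      also have "\<dots> = ennreal y" using elim by simp
      finally show ?case using elim by simp
    qed
  qed
  also have "\<dots> = (\<integral>\<^sup>+x. (\<integral>\<^sup>+y. indicator {0<..} x * (if x < y then 1 else 0) \<partial>\<mu>) \<partial>lborel)"
    by (rule Fubini'[symmetric]) measurable
  also have "\<dots> = (\<integral>\<^sup>+x. indicator {0<..} x * ennreal (measure \<mu> {x<..}) \<partial>lborel)"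
  proof (rule nn_integral_cong)
    fix x :: real
    have "(\<integral>\<^sup>+y. indicator {0<..} x * (if x < y then 1 else 0) \<partial>\<mu>) =
        (\<integral>\<^sup>+y. indicator {0<..} x * indicator {x<..} y \<partial>\<mu>)"
      by (intro nn_integral_cong) (auto split: split_indicator)
    then show "(\<integral>\<^sup>+y. indicator {0<..} x * (if x < y then 1 else 0) \<partial>\<mu>) =
        indicator {0<..} x * ennreal (measure \<mu> {x<..})"
      by (simp add: nn_integral_cmult \<mu>.emeasure_eq_measure)
  qed
  also have "\<dots> \<le> (\<integral>\<^sup>+x. ennreal (indicator {0..x0} x + C' * (indicator {x0..} x *\<^sub>R x powr (- q))) \<partial>lborel)"
  proof (rule nn_integral_mono)
    fix x :: real
    have "indicator {0<..} x * measure \<mu> {x<..} \<le> indicator {0..x0} x + C' * (indicator {x0..} x *\<^sub>R x powr (- q))"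
      using le[of x] C' \<mu>.prob_le_1[of "{x<..}"] by (auto split: split_indicator)
    then show "indicator {0<..} x * ennreal (measure \<mu> {x<..}) \<le>
        ennreal (indicator {0..x0} x + C' * (indicator {x0..} x *\<^sub>R x powr (- q)))"
      by (auto split: split_indicator simp: ennreal_leI)
  qed
  also have "\<dots> < \<infinity>"
    using int_bd C' by (subst nn_integral_eq_integral) auto
  finally show ?thesis by (intro integrableI_bounded) auto
qed

section \<open>Limit laws from characteristic functions\<close>

text \<open>By Fubini, averaging a characteristic function over a Gaussian frequency integrates the Gaussian
characteristic function against the law.\<close>

lemma gaussian_average_char:
  assumes "real_distribution \<mu>"
  shows "(\<integral>z. char \<mu> (e * z) \<partial>std_normal_distribution) =
    complex_of_real (\<integral>x. exp (- ((e * x)\<^sup>2) / 2) \<partial>\<mu>)"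
proof -
  interpret \<mu>: real_distribution \<mu> by fact
  interpret \<gamma>: real_distribution std_normal_distribution by (rule real_dist_normal_dist)
  interpret pair_prob_space std_normal_distribution \<mu> ..
  have int: "integrable (std_normal_distribution \<Otimes>\<^sub>M \<mu>) (\<lambda>(z, x). iexp (e * z * x))"
    by (intro P.integrable_const_bound[where B = 1]) (auto simp: case_prod_beta')
  have "(\<integral>z. char \<mu> (e * z) \<partial>std_normal_distribution) =
      (\<integral>x. (\<integral>z. iexp (e * z * x) \<partial>std_normal_distribution) \<partial>\<mu>)"
    unfolding char_def using Fubini_integral[OF int] by simp
  also have "\<dots> = (\<integral>x. char std_normal_distribution (e * x) \<partial>\<mu>)"
    unfolding char_def by (simp add: mult_ac)
  also have "\<dots> = (\<integral>x. complex_of_real (exp (- ((e * x)\<^sup>2) / 2)) \<partial>\<mu>)"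
    by (simp add: char_std_normal_distribution)
  finally show ?thesis by simp
qed

text \<open>The function \<open>exp (-(e x)\<^sup>2 / 2)\<close> is at most \<open>1\<close>, and at most \<open>1 / 2\<close> outside
\<open>[-2/e, 2/e]\<close>; its mean can be read off from the characteristic function. Thus a characteristic function close to
\<open>1\<close> near \<open>0\<close> forces small tails.\<close>

lemma tail_le_gaussian_average:
  assumes "real_distribution \<mu>" and e: "0 < e"
  shows "1 - 2 * (1 - Re (\<integral>z. char \<mu> (e * z) \<partial>std_normal_distribution)) \<le> measure \<mu> {- 2 / e..2 / e}"
proof -
  interpret \<mu>: real_distribution \<mu> by fact
  have int: "integrable \<mu> (\<lambda>x. exp (- ((e * x)\<^sup>2) / 2))"
    by (intro \<mu>.integrable_const_bound[where B = 1]) auto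
  have exp2: "exp (- 2 :: real) \<le> 1 / 2"
    using exp_ge_add_one_self[of "2::real"] by (simp add: exp_minus field_simps)
  have "(\<integral>x. 1 - 2 * (1 - exp (- ((e * x)\<^sup>2) / 2)) \<partial>\<mu>) \<le> (\<integral>x. indicator {- 2 / e..2 / e} x \<partial>\<mu>)"
  proof (rule integral_mono)
    fix x
    show "1 - 2 * (1 - exp (- ((e * x)\<^sup>2) / 2)) \<le> indicator {- 2 / e..2 / e} x"
    proof (cases "x \<in> {- 2 / e..2 / e}")
      case False
      then have "2 \<le> \<bar>e * x\<bar>" using e by (auto simp: abs_mult field_simps abs_if)
      then have "2\<^sup>2 \<le> \<bar>e * x\<bar>\<^sup>2" by (rule power_mono) auto
      then have "exp (- ((e * x)\<^sup>2) / 2) \<le> exp (- 2)" by simp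
      then have "1 - 2 * (1 - exp (- ((e * x)\<^sup>2) / 2)) \<le> 0" using exp2 by argo
      then show ?thesis using False by simp
    qed simp
  qed (use int in \<open>auto intro!: integrable_real_indicator simp: \<mu>.emeasure_eq_measure\<close>)
  moreover have "(\<integral>x. 1 - 2 * (1 - exp (- ((e * x)\<^sup>2) / 2)) \<partial>\<mu>) = 1 - 2 * (1 - (\<integral>x. exp (- ((e * x)\<^sup>2) / 2) \<partial>\<mu>))"
    using int \<mu>.prob_space by simp
  ultimately show ?thesis by (simp add: gaussian_average_char[OF assms(1)])
qed

text \<open>The part of Levy's continuity theorem in which the limit is not known in advance to be a characteristic
function. The Gaussian averages of the limit are close to \<open>1\<close> for small \<open>e\<close> by continuity at \<open>0\<close>, so
the previous bound gives tightness; Helly's theorem provides a limit law along a subsequence, which must have the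
prescribed characteristic function.\<close>

lemma levy_limit_exists:
  assumes \<mu>: "\<And>n. real_distribution (\<mu> n)"
    and lim: "\<And>u. (\<lambda>n. char (\<mu> n) u) \<longlonglongrightarrow> \<Phi> u" and cont: "isCont \<Phi> 0"
  obtains G where "real_distribution G" "\<And>u. char G u = \<Phi> u"
proof -
  interpret \<gamma>: real_distribution std_normal_distribution by (rule real_dist_normal_dist)
  have [measurable]: "char (\<mu> n) \<in> borel_measurable borel" for n
    using real_distribution.char_measurable[OF \<mu>] .
  have [measurable]: "\<Phi> \<in> borel_measurable borel"
    by (rule borel_measurable_LIMSEQ_metric[of "\<lambda>n. char (\<mu> n)"]) (auto simp: lim)
  have le1: "norm (char (\<mu> n) u) \<le> 1" for n u
    using real_distribution.cmod_char_le_1[OF \<mu>] .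
  have \<Phi>_le1: "norm (\<Phi> u) \<le> 1" for u
    using le1 by (intro LIMSEQ_le_const2[OF tendsto_norm[OF lim]]) auto
  have "\<Phi> 0 = 1"
    using real_distribution.char_zero[OF \<mu>] LIMSEQ_unique[OF lim[of 0], of 1] by simp
  have "(\<lambda>m. \<integral>z. \<Phi> (inverse (real (Suc m)) * z) \<partial>std_normal_distribution) \<longlonglongrightarrow>
      (\<integral>z. 1 \<partial>std_normal_distribution)"
  proof (rule integral_dominated_convergence[where w = "\<lambda>_. 1"])
    show "AE z in std_normal_distribution. (\<lambda>m. \<Phi> (inverse (real (Suc m)) * z)) \<longlonglongrightarrow> 1"
    proof (rule AE_I2)
      fix z :: real
      have "(\<lambda>m. inverse (real (Suc m)) * z) \<longlonglongrightarrow> 0"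
        by (rule tendsto_mult_left_zero[OF LIMSEQ_inverse_real_of_nat])
      from isCont_tendsto_compose[OF cont this] show "(\<lambda>m. \<Phi> (inverse (real (Suc m)) * z)) \<longlonglongrightarrow> 1"
        by (simp add: \<open>\<Phi> 0 = 1\<close>)
    qed
  qed (auto simp: \<Phi>_le1)
  then have avg: "(\<lambda>m. Re (\<integral>z. \<Phi> (inverse (real (Suc m)) * z) \<partial>std_normal_distribution)) \<longlonglongrightarrow> 1"
    using tendsto_Re \<gamma>.prob_space by fastforce
  have "tight \<mu>"
    unfolding tight_def
  proof (intro conjI allI impI \<mu>)
    fix \<epsilon> :: real assume "0 < \<epsilon>"
    then have "eventually (\<lambda>m. 1 - \<epsilon> / 2 < Re (\<integral>z. \<Phi> (inverse (real (Suc m)) * z) \<partial>std_normal_distribution)) sequentially"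
      by (intro order_tendstoD(1)[OF avg]) auto
    then obtain m where m: "1 - \<epsilon> / 2 < Re (\<integral>z. \<Phi> (inverse (real (Suc m)) * z) \<partial>std_normal_distribution)"
      by (auto simp: eventually_sequentially)
    define e where "e = inverse (real (Suc m))"
    have e: "0 < e" by (simp add: e_def)
    have "(\<lambda>n. \<integral>z. char (\<mu> n) (e * z) \<partial>std_normal_distribution) \<longlonglongrightarrow> (\<integral>z. \<Phi> (e * z) \<partial>std_normal_distribution)"
      by (rule integral_dominated_convergence[where w = "\<lambda>_. 1"]) (auto simp: lim le1)
    then have "eventually (\<lambda>n. 1 - \<epsilon> / 2 < Re (\<integral>z. char (\<mu> n) (e * z) \<partial>std_normal_distribution)) sequentially"
      using m by (intro order_tendstoD(1)[OF tendsto_Re]) (auto simp: e_def)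
    then obtain N where N: "\<And>n. N \<le> n \<Longrightarrow> 1 - \<epsilon> / 2 < Re (\<integral>z. char (\<mu> n) (e * z) \<partial>std_normal_distribution)"
      by (auto simp: eventually_sequentially)
    \<comment> \<open>The finitely many laws before \<open>N\<close> are tight one by one.\<close>
    have "eventually (\<lambda>k. 1 - \<epsilon> < measure (\<mu> n) {- real k<..real k}) sequentially" for n
    proof -
      interpret \<mu>: real_distribution "\<mu> n" by (rule \<mu>)
      have "(\<lambda>k. measure (\<mu> n) {- real k<..real k}) \<longlonglongrightarrow> measure (\<mu> n) (\<Union>k. {- real k<..real k})"
        by (intro \<mu>.finite_Lim_measure_incseq) (auto simp: incseq_def)
      also have "(\<Union>k. {- real k<..real k}) = UNIV"
      proof -
        have "\<exists>k. - real k < x \<and> x \<le> real k" for x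
        proof -
          obtain k where "\<bar>x\<bar> < real k" using reals_Archimedean2 by blast
          then show ?thesis by (intro exI[of _ k]) auto
        qed
        then show ?thesis by auto
      qed
      finally have "(\<lambda>k. measure (\<mu> n) {- real k<..real k}) \<longlonglongrightarrow> 1"
        using \<mu>.prob_space by simp
      then show ?thesis using \<open>0 < \<epsilon>\<close> by (intro order_tendstoD(1)) auto
    qed
    then have "eventually (\<lambda>k. \<forall>n\<in>{..<N}. 1 - \<epsilon> < measure (\<mu> n) {- real k<..real k}) sequentially"
      by (intro eventually_ball_finite) auto
    moreover have "eventually (\<lambda>k. 2 / e < real k) sequentially"
      using filterlim_real_sequentially by (auto simp: filterlim_at_top_dense)
    ultimately have "eventually (\<lambda>k. (\<forall>n<N. 1 - \<epsilon> < measure (\<mu> n) {- real k<..real k}) \<and> 2 / e < real k) sequentially"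
      by eventually_elim auto
    then obtain k where k: "\<And>n. n < N \<Longrightarrow> 1 - \<epsilon> < measure (\<mu> n) {- real k<..real k}" "2 / e < real k"
      by (auto simp: eventually_sequentially)
    have "1 - \<epsilon> < measure (\<mu> n) {- real k<..real k}" for n
    proof (cases "n < N")
      case False
      interpret \<mu>: real_distribution "\<mu> n" by (rule \<mu>)
      have "1 - \<epsilon> < 1 - 2 * (1 - Re (\<integral>z. char (\<mu> n) (e * z) \<partial>std_normal_distribution))"
        using N[of n] False by simp
      also have "\<dots> \<le> measure (\<mu> n) {- 2 / e..2 / e}"
        by (rule tail_le_gaussian_average[OF \<mu> e])
      also have "\<dots> \<le> measure (\<mu> n) {- real k<..real k}"
        using k(2) by (intro \<mu>.finite_measure_mono) auto
      finally show ?thesis .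
    qed (rule k)
    moreover have "- real k < real k" using k(2) e by (smt (verit) divide_pos_pos)
    ultimately show "\<exists>a b. a < b \<and> (\<forall>n. 1 - \<epsilon> < measure (\<mu> n) {a<..b})" by blast
  qed
  from tight_imp_convergent_subsubsequence[OF this strict_mono_id]
  obtain r G where r: "strict_mono (r :: nat \<Rightarrow> nat)" and G: "real_distribution G"
    and w: "weak_conv_m (\<mu> \<circ> id \<circ> r) G" by (auto simp: id_def)
  have "char G u = \<Phi> u" for u
  proof (rule LIMSEQ_unique)
    show "(\<lambda>n. char ((\<mu> \<circ> id \<circ> r) n) u) \<longlonglongrightarrow> char G u"
      by (rule levy_continuity1[OF _ G w]) (auto intro: \<mu>)
    show "(\<lambda>n. char ((\<mu> \<circ> id \<circ> r) n) u) \<longlonglongrightarrow> \<Phi> u"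
      using LIMSEQ_subseq_LIMSEQ[OF lim r] by (simp add: comp_def)
  qed
  with G show thesis by (rule that)
qed

lemma char_distr_affine_pair:
  assumes "real_distribution G"
  shows "char (distr (G \<Otimes>\<^sub>M G) borel (\<lambda>(x, y). a * x + b * y)) u = char G (a * u) * char G (b * u)"
proof -
  interpret G: real_distribution G by fact
  interpret pair_prob_space G G ..
  have int: "integrable (G \<Otimes>\<^sub>M G) (\<lambda>(x, y). iexp (a * u * x) * iexp (b * u * y))"
    by (intro P.integrable_const_bound[where B = 1]) (auto simp: case_prod_beta' norm_mult)
  have "char (distr (G \<Otimes>\<^sub>M G) borel (\<lambda>(x, y). a * x + b * y)) u =
      (\<integral>(x, y). iexp (a * u * x) * iexp (b * u * y) \<partial>(G \<Otimes>\<^sub>M G))"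
    unfolding char_def
    by (subst integral_distr)
       (auto simp: case_prod_beta' exp_add[symmetric] algebra_simps intro!: Bochner_Integration.integral_cong)
  also have "\<dots> = (\<integral>x. (\<integral>y. iexp (a * u * x) * iexp (b * u * y) \<partial>G) \<partial>G)"
    using integral_fst'[OF int] by simp
  also have "\<dots> = char G (a * u) * char G (b * u)"
    by (simp add: char_def)
  finally show ?thesis .
qed

text \<open>Homogeneity of the exponent says that \<open>a X + b Y\<close> and \<open>(a\<^sup>\<alpha> + b\<^sup>\<alpha>)\<^bsup>1/\<alpha>\<^esup> X\<close> have the same
characteristic function, with no shift. A point mass \<open>c\<close> with this property would satisfy
\<open>2 c = 2\<^bsup>1/\<alpha>\<^esup> c\<close>, hence \<open>c = 0\<close>; then the exponent would take all its values in \<open>2 \<pi> i \<int>\<close>, which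
fails because its imaginary part runs through \<open>(-\<infinity>, 0)\<close>.\<close>

lemma stable_law_of_char:
  assumes \<alpha>: "1 < \<alpha>" "\<alpha> < 2" and G: "real_distribution G"
    and char: "\<And>u. char G u = exp (stable_exponent \<alpha> u)"
  shows "stable_law \<alpha> G"
  unfolding stable_law_def
proof (intro conjI allI impI notI G)
  interpret G: real_distribution G by fact
  interpret pair_prob_space G G ..
  show "\<exists>d. distr (G \<Otimes>\<^sub>M G) borel (\<lambda>(x, y). a * x + b * y) =
        distr G borel (\<lambda>x. (a powr \<alpha> + b powr \<alpha>) powr (1 / \<alpha>) * x + d)" if ab: "0 < a" "0 < b" for a b :: real
  proof (intro exI[of _ 0] Levy_uniqueness ext)
    show "real_distribution (distr (G \<Otimes>\<^sub>M G) borel (\<lambda>(x, y). a * x + b * y))"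
      by (intro P.real_distribution_distr) (auto simp: case_prod_beta')
    show "real_distribution (distr G borel (\<lambda>x. (a powr \<alpha> + b powr \<alpha>) powr (1 / \<alpha>) * x + 0))"
      by (intro G.real_distribution_distr) auto
    fix u
    define c where "c = (a powr \<alpha> + b powr \<alpha>) powr (1 / \<alpha>)"
    have "0 < a powr \<alpha> + b powr \<alpha>" using ab by (intro add_pos_pos) auto
    then have c: "0 < c" "c powr \<alpha> = a powr \<alpha> + b powr \<alpha>"
      using \<alpha> by (auto simp: c_def powr_powr)
    have "char (distr G borel (\<lambda>x. c * x + 0)) u = char G (c * u)"
      unfolding char_def by (subst integral_distr) (auto simp: mult_ac)
    then show "char (distr (G \<Otimes>\<^sub>M G) borel (\<lambda>(x, y). a * x + b * y)) u =
        char (distr G borel (\<lambda>x. (a powr \<alpha> + b powr \<alpha>) powr (1 / \<alpha>) * x + 0)) u"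
      using ab c unfolding char_distr_affine_pair[OF G] c_def[symmetric]
      by (simp add: char stable_exponent_scale scaleR_left_distrib exp_add)
  qed
  assume "\<exists>c. G = return borel c"
  then obtain c where c: "G = return borel c" by blast
  have norm1: "exp (stable_exponent \<alpha> u) = iexp (u * c)" for u
    using char[of u] unfolding c char_def by (subst (asm) integral_return) auto
  \<comment> \<open>The contradiction in both steps: an exponential equal to \<open>1\<close> whose argument has imaginary part \<open>\<pi>\<close> or \<open>-\<pi>\<close>.\<close>
  have pi_ne: "exp w \<noteq> 1" if "Im w = pi \<or> Im w = - pi" for w :: complex
  proof
    assume "exp w = 1"
    then have "Re (exp w) = 1" by simp
    moreover have "Re (exp w) = - exp (Re w)" using that by (auto simp: Re_exp)
    ultimately show False using exp_gt_zero[of "Re w"] by linarith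
  qed
  define k where "k = c * (2 - 2 powr (1 / \<alpha>))"
  have k1: "iexp (u * k) = 1" for u
  proof -
    have "stable_exponent \<alpha> (2 powr (1 / \<alpha>) * u) = 2 * stable_exponent \<alpha> u"
      using \<alpha> by (subst stable_exponent_scale) (auto simp: powr_powr scaleR_conv_of_real)
    then have "iexp (2 powr (1 / \<alpha>) * u * c) = exp (stable_exponent \<alpha> u + stable_exponent \<alpha> u)"
      unfolding norm1[of "2 powr (1 / \<alpha>) * u", symmetric] by simp
    then have "iexp (2 powr (1 / \<alpha>) * u * c) = iexp (u * c) * iexp (u * c)"
      by (simp only: exp_add norm1)
    moreover have "iexp (u * c) * iexp (u * c) = iexp (u * k) * iexp (2 powr (1 / \<alpha>) * u * c)"
      by (simp add: k_def exp_add[symmetric] algebra_simps)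
    ultimately show ?thesis by simp
  qed
  have "k = 0"
  proof (rule ccontr)
    assume "k \<noteq> 0"
    then have "Im (\<i> * of_real (pi / k * k)) = pi" by simp
    then show False using k1[of "pi / k"] pi_ne by blast
  qed
  moreover have "2 powr (1 / \<alpha>) < 2 powr (1 :: real)"
    using \<alpha> by (intro powr_less_mono) auto
  ultimately have "c = 0" by (simp add: k_def)
  define s where "s = pi / - Im (stable_exponent \<alpha> 1)"
  have s: "0 < s" using Im_stable_exponent_less_0[OF \<alpha>] by (simp add: s_def divide_pos_neg)
  have "stable_exponent \<alpha> (s powr (1 / \<alpha>) * 1) = s *\<^sub>R stable_exponent \<alpha> 1"
    using s \<alpha> by (subst stable_exponent_scale) (auto simp: powr_powr)
  then have "exp (s *\<^sub>R stable_exponent \<alpha> 1) = 1"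
    using norm1[of "s powr (1 / \<alpha>) * 1"] \<open>c = 0\<close> by simp
  moreover have "Im (s *\<^sub>R stable_exponent \<alpha> 1) = - pi"
    using Im_stable_exponent_less_0[OF \<alpha>] by (simp add: s_def)
  ultimately show False using pi_ne by blast
qed

section \<open>Kernels, random indices and Poisson counts\<close>

lemma norm_prod_le_1: "(\<And>i. norm (w i :: complex) \<le> 1) \<Longrightarrow> norm (\<Prod>i\<in>S. w i) \<le> 1"
  by (simp add: prod_norm[symmetric] prod_le_1)

lemma (in prob_space) norm_integral_le_1:
  fixes w :: "'a \<Rightarrow> complex"
  assumes "\<And>x. norm (w x) \<le> 1"
  shows "norm (\<integral>x. w x \<partial>M) \<le> 1"
proof -
  have "norm (\<integral>x. w x \<partial>M) \<le> (\<integral>x. norm (w x) \<partial>M)" by (rule integral_norm_bound)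
  also have "\<dots> \<le> 1"
  proof (cases "integrable M (\<lambda>x. norm (w x))")
    case True
    then show ?thesis using assms by (intro integral_le_const) auto
  qed (simp add: not_integrable_integral_eq)
  finally show ?thesis .
qed

text \<open>Radial projection onto the unit disc keeps the approximants simple. The uniform bound \<open>1\<close>, rather than the
usual bound \<open>2\<close>, keeps products with a random number of factors bounded.\<close>

lemma bounded_simple_approximation:
  fixes g :: "'a \<Rightarrow> complex"
  assumes [measurable]: "g \<in> borel_measurable M" and le: "\<And>x. x \<in> space M \<Longrightarrow> norm (g x) \<le> 1"
  obtains F where "\<And>i. simple_function M (F i)" "\<And>x. x \<in> space M \<Longrightarrow> (\<lambda>i. F i x) \<longlonglongrightarrow> g x"
    "\<And>i x. norm (F i x) \<le> 1"
proof -
  from borel_measurable_implies_sequence_metric[OF assms(1), of 0]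
  obtain s where s: "\<And>i. simple_function M (s i)" "\<And>x. x \<in> space M \<Longrightarrow> (\<lambda>i. s i x) \<longlonglongrightarrow> g x"
    by metis
  define F where "F i x = s i x / of_real (max 1 (norm (s i x)))" for i x
  show thesis
  proof (rule that[of F])
    show "simple_function M (F i)" for i
      unfolding F_def by (rule simple_function_compose1[OF s(1), of "\<lambda>z. z / of_real (max 1 (norm z))"])
    show "norm (F i x) \<le> 1" for i x
      by (simp add: F_def norm_divide)
    fix x assume x: "x \<in> space M"
    have "(\<lambda>i. F i x) \<longlonglongrightarrow> g x / of_real (max 1 (norm (g x)))"
      unfolding F_def by (intro tendsto_intros s x) (auto simp: max_def)
    then show "(\<lambda>i. F i x) \<longlonglongrightarrow> g x" using le[OF x] by (simp add: max_absorb1)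
  qed
qed

lemma simple_function_sum_indicator:
  fixes g :: "'a \<Rightarrow> complex"
  assumes "simple_function M g" "x \<in> space M"
  shows "g x = (\<Sum>y\<in>g ` space M. indicator (g -` {y} \<inter> space M) x *\<^sub>R y)"
proof -
  have "(\<Sum>y\<in>g ` space M. indicator (g -` {y} \<inter> space M) x *\<^sub>R y) = (\<Sum>y\<in>g ` space M. if y = g x then y else 0)"
    using assms by (intro sum.cong) (auto split: split_indicator)
  also have "\<dots> = g x" using assms by (simp add: simple_function_def)
  finally show ?thesis ..
qed

text \<open>Passes from indicators to bounded functions, by linearity and dominated convergence. The two weights
\<open>Y\<close> and \<open>Z\<close> differ so that the lemma can be applied to one factor of a product at a time, with the remaining
factors already integrated against their kernels in \<open>Z\<close> but not in \<open>Y\<close>.\<close>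

lemma (in prob_space) conditional_expectation_of_kernel:
  fixes Y Z :: "'a \<Rightarrow> complex"
  assumes Y [measurable]: "Y \<in> borel_measurable M" "\<And>\<omega>. norm (Y \<omega>) \<le> 1"
    and Z [measurable]: "Z \<in> borel_measurable M" "\<And>\<omega>. norm (Z \<omega>) \<le> 1"
    and G [measurable]: "G \<in> M \<rightarrow>\<^sub>M N" and k [measurable]: "k \<in> M \<rightarrow>\<^sub>M prob_algebra N"
    and eq: "\<And>C. C \<in> sets N \<Longrightarrow>
      (\<integral>\<omega>. Y \<omega> * of_real (indicator C (G \<omega>)) \<partial>M) = (\<integral>\<omega>. Z \<omega> * of_real (measure (k \<omega>) C) \<partial>M)"
    and v [measurable]: "v \<in> borel_measurable N" and v_le: "\<And>x. norm (v x) \<le> 1"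
  shows "(\<integral>\<omega>. Y \<omega> * v (G \<omega>) \<partial>M) = (\<integral>\<omega>. Z \<omega> * (\<integral>x. v x \<partial>k \<omega>) \<partial>M)"
proof -
  have k_sub [measurable]: "k \<in> M \<rightarrow>\<^sub>M subprob_algebra N" using k by (rule measurable_prob_algebraD)
  have k_prob: "prob_space (k \<omega>)" "sets (k \<omega>) = sets N" "space (k \<omega>) = space N" if "\<omega> \<in> space M" for \<omega>
    using measurable_space[OF k that] by (auto simp: space_prob_algebra dest: sets_eq_imp_space_eq)
  have int_meas [measurable]: "(\<lambda>\<omega>. \<integral>x. w x \<partial>k \<omega>) \<in> borel_measurable M"
    if [measurable]: "w \<in> borel_measurable N" for w :: "_ \<Rightarrow> complex"
    using measurable_compose[OF k_sub integral_measurable_subprob_algebra[OF that]] .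
  have int_le: "norm (\<integral>x. w x \<partial>k \<omega>) \<le> 1" if "\<omega> \<in> space M" "\<And>x. norm (w x) \<le> 1" for w :: "_ \<Rightarrow> complex" and \<omega>
  proof -
    interpret k: prob_space "k \<omega>" by (rule k_prob that)+
    show ?thesis using that(2) by (rule k.norm_integral_le_1)
  qed
  have simple: "(\<integral>\<omega>. Y \<omega> * w (G \<omega>) \<partial>M) = (\<integral>\<omega>. Z \<omega> * (\<integral>x. w x \<partial>k \<omega>) \<partial>M)"
    if w: "simple_function N w" for w :: "_ \<Rightarrow> complex"
  proof -
    define C where "C y = w -` {y} \<inter> space N" for y
    have fin: "finite (w ` space N)" using w by (rule simple_functionD)
    have C [measurable]: "C y \<in> sets N" for y unfolding C_def using w by (rule simple_functionD)
    have intY: "integrable M (\<lambda>\<omega>. Y \<omega> * of_real (indicator (C y) (G \<omega>)) * y)" for y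
      by (intro integrable_mult_left integrable_const_bound[where B = 1])
         (auto simp: norm_mult Y split: split_indicator)
    have intZ: "integrable M (\<lambda>\<omega>. Z \<omega> * of_real (measure (k \<omega>) (C y)) * y)" for y
    proof (intro integrable_mult_left integrable_const_bound[where B = 1] AE_I2)
      fix \<omega> assume \<omega>: "\<omega> \<in> space M"
      interpret k: prob_space "k \<omega>" by (rule k_prob \<omega>)+
      show "norm (Z \<omega> * of_real (measure (k \<omega>) (C y))) \<le> 1"
        using Z(2)[of \<omega>] by (simp add: norm_mult mult_le_one)
    qed measurable
    have "(\<integral>\<omega>. Y \<omega> * w (G \<omega>) \<partial>M) =
        (\<integral>\<omega>. (\<Sum>y\<in>w ` space N. Y \<omega> * of_real (indicator (C y) (G \<omega>)) * y) \<partial>M)"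
    proof (rule Bochner_Integration.integral_cong[OF refl])
      fix \<omega> assume "\<omega> \<in> space M"
      then have "G \<omega> \<in> space N" by (rule measurable_space[OF G])
      then show "Y \<omega> * w (G \<omega>) = (\<Sum>y\<in>w ` space N. Y \<omega> * of_real (indicator (C y) (G \<omega>)) * y)"
        by (subst simple_function_sum_indicator[OF w])
           (simp_all add: C_def sum_distrib_left scaleR_conv_of_real mult.assoc)
    qed
    also have "\<dots> = (\<Sum>y\<in>w ` space N. (\<integral>\<omega>. Y \<omega> * of_real (indicator (C y) (G \<omega>)) \<partial>M) * y)"
      using intY by (simp add: Bochner_Integration.integral_sum)
    also have "\<dots> = (\<Sum>y\<in>w ` space N. (\<integral>\<omega>. Z \<omega> * of_real (measure (k \<omega>) (C y)) \<partial>M) * y)"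
      by (intro sum.cong refl arg_cong2[where f = "(*)"] eq C)
    also have "\<dots> = (\<integral>\<omega>. (\<Sum>y\<in>w ` space N. Z \<omega> * of_real (measure (k \<omega>) (C y)) * y) \<partial>M)"
      using intZ by (simp add: Bochner_Integration.integral_sum)
    also have "\<dots> = (\<integral>\<omega>. Z \<omega> * (\<integral>x. w x \<partial>k \<omega>) \<partial>M)"
    proof (rule Bochner_Integration.integral_cong[OF refl])
      fix \<omega> assume \<omega>: "\<omega> \<in> space M"
      interpret k: prob_space "k \<omega>" by (rule k_prob \<omega>)+
      have [measurable_cong]: "sets (k \<omega>) = sets N" by (rule k_prob \<omega>)+
      have "(\<integral>x. w x \<partial>k \<omega>) = (\<integral>x. (\<Sum>y\<in>w ` space N. indicator (C y) x *\<^sub>R y) \<partial>k \<omega>)"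
        unfolding C_def
        by (intro Bochner_Integration.integral_cong refl simple_function_sum_indicator[OF w])
           (simp add: k_prob \<omega>)
      also have "\<dots> = (\<Sum>y\<in>w ` space N. measure (k \<omega>) (C y) *\<^sub>R y)"
      proof -
        have "integrable (k \<omega>) (\<lambda>x. indicator (C y) x *\<^sub>R y)" for y
          by (intro integrable_scaleR_left impI integrable_real_indicator) (auto simp: k.emeasure_eq_measure k_prob \<omega>)
        then show ?thesis
          using C by (simp add: Bochner_Integration.integral_sum k.emeasure_eq_measure k_prob \<omega> sets.Int_space_eq2 del: C)
      qed
      finally show "(\<Sum>y\<in>w ` space N. Z \<omega> * of_real (measure (k \<omega>) (C y)) * y) = Z \<omega> * (\<integral>x. w x \<partial>k \<omega>)"
        by (simp add: sum_distrib_left scaleR_conv_of_real mult.assoc)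
    qed
    finally show ?thesis .
  qed
  obtain F where F: "\<And>i. simple_function N (F i)" "\<And>x. x \<in> space N \<Longrightarrow> (\<lambda>i. F i x) \<longlonglongrightarrow> v x"
    "\<And>i x. norm (F i x) \<le> 1"
    using bounded_simple_approximation[OF v v_le] by metis
  have [measurable]: "F i \<in> borel_measurable N" for i using F(1) by (rule borel_measurable_simple_function)
  have "(\<lambda>i. \<integral>\<omega>. Y \<omega> * F i (G \<omega>) \<partial>M) \<longlonglongrightarrow> (\<integral>\<omega>. Y \<omega> * v (G \<omega>) \<partial>M)"
  proof (rule integral_dominated_convergence[where w = "\<lambda>_. 1"])
    show "AE \<omega> in M. (\<lambda>i. Y \<omega> * F i (G \<omega>)) \<longlonglongrightarrow> Y \<omega> * v (G \<omega>)"
      using measurable_space[OF G] by (intro AE_I2 tendsto_mult tendsto_const F(2)) auto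
    show "AE \<omega> in M. norm (Y \<omega> * F i (G \<omega>)) \<le> 1" for i
      using Y(2) F(3) by (intro AE_I2) (simp add: norm_mult mult_le_one)
  qed auto
  moreover have "(\<lambda>i. \<integral>\<omega>. Z \<omega> * (\<integral>x. F i x \<partial>k \<omega>) \<partial>M) \<longlonglongrightarrow> (\<integral>\<omega>. Z \<omega> * (\<integral>x. v x \<partial>k \<omega>) \<partial>M)"
  proof (rule integral_dominated_convergence[where w = "\<lambda>_. 1"])
    show "AE \<omega> in M. (\<lambda>i. Z \<omega> * (\<integral>x. F i x \<partial>k \<omega>)) \<longlonglongrightarrow> Z \<omega> * (\<integral>x. v x \<partial>k \<omega>)"
    proof (intro AE_I2 tendsto_mult tendsto_const)
      fix \<omega> assume \<omega>: "\<omega> \<in> space M"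
      interpret k: prob_space "k \<omega>" by (rule k_prob \<omega>)+
      have [measurable_cong]: "sets (k \<omega>) = sets N" by (rule k_prob \<omega>)+
      show "(\<lambda>i. \<integral>x. F i x \<partial>k \<omega>) \<longlonglongrightarrow> (\<integral>x. v x \<partial>k \<omega>)"
        by (rule integral_dominated_convergence[where w = "\<lambda>_. 1"])
           (auto simp: F k_prob \<omega>)
    qed
    show "AE \<omega> in M. norm (Z \<omega> * (\<integral>x. F i x \<partial>k \<omega>)) \<le> 1" for i
      using Z(2) int_le[OF _ F(3)] by (intro AE_I2) (simp add: norm_mult mult_le_one)
  qed auto
  ultimately show ?thesis unfolding simple[OF F(1)] by (rule LIMSEQ_unique)
qed

lemma indicator_discrete_measurable [measurable (raw)]:
  "N \<in> M \<rightarrow>\<^sub>M count_space UNIV \<Longrightarrow> (\<lambda>\<omega>. indicator S (N \<omega>) :: real) \<in> borel_measurable M"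
  by (rule measurable_compose[where N = "count_space UNIV"]) auto

text \<open>Decomposes the expectation of a quantity with a random index according to the value of the index, so that
statements for a fixed number of parents carry over to a random number.\<close>

lemma (in prob_space) integral_over_countable_value:
  fixes Y :: "nat \<Rightarrow> 'a \<Rightarrow> complex" and N :: "'a \<Rightarrow> nat"
  assumes [measurable]: "N \<in> M \<rightarrow>\<^sub>M count_space UNIV" "\<And>n. Y n \<in> borel_measurable M"
    and le: "\<And>n \<omega>. \<omega> \<in> space M \<Longrightarrow> norm (Y n \<omega>) \<le> 1"
  shows "(\<lambda>n. \<integral>\<omega>. of_real (indicator {n} (N \<omega>)) * Y n \<omega> \<partial>M) sums (\<integral>\<omega>. Y (N \<omega>) \<omega> \<partial>M)"
proof -
  have single: "(\<lambda>n. of_real (indicator {n} (N \<omega>)) * Y n \<omega>) sums Y (N \<omega>) \<omega>" for \<omega>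
    using sums_single[of "N \<omega>" "\<lambda>n. Y n \<omega>"]
    by (rule sums_cong[THEN iffD1, rotated]) (auto split: split_indicator)
  have norm_le: "norm (of_real (indicator {n} (N \<omega>)) * Y n \<omega>) \<le> indicator {n} (N \<omega>)" if "\<omega> \<in> space M" for n \<omega>
    using le[OF that] by (auto split: split_indicator)
  have int: "integrable M (\<lambda>\<omega>. of_real (indicator {n} (N \<omega>)) * Y n \<omega>)" for n
  proof (intro integrable_const_bound[where B = 1] AE_I2)
    fix \<omega> assume "\<omega> \<in> space M"
    from norm_le[OF this, of n] show "norm (of_real (indicator {n} (N \<omega>)) * Y n \<omega>) \<le> 1"
      by (rule order_trans) (simp split: split_indicator)
  qed measurable
  have "(\<lambda>n. prob {\<omega>\<in>space M. N \<omega> = n}) sums prob (\<Union>n. {\<omega>\<in>space M. N \<omega> = n})"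
    by (intro finite_measure_UNION) (auto simp: disjoint_family_on_def)
  then have summ: "summable (\<lambda>n. prob {\<omega>\<in>space M. N \<omega> = n})" by (rule sums_summable)
  have "summable (\<lambda>n. \<integral>\<omega>. norm (of_real (indicator {n} (N \<omega>)) * Y n \<omega>) \<partial>M)"
  proof (rule summable_comparison_test'[OF summ])
    fix n
    have "(\<integral>\<omega>. norm (of_real (indicator {n} (N \<omega>)) * Y n \<omega>) \<partial>M) \<le> (\<integral>\<omega>. indicator {\<omega>\<in>space M. N \<omega> = n} \<omega> \<partial>M)"
    proof (rule integral_mono)
      fix \<omega> assume "\<omega> \<in> space M"
      with norm_le[OF this, of n]
      show "norm (of_real (indicator {n} (N \<omega>)) * Y n \<omega>) \<le> indicator {\<omega>\<in>space M. N \<omega> = n} \<omega>"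
        by (simp split: split_indicator_asm split_indicator)
    qed (use int in \<open>auto simp: emeasure_eq_measure intro!: integrable_real_indicator\<close>)
    also have "\<dots> = prob {\<omega>\<in>space M. N \<omega> = n}" by simp
    finally show "norm (\<integral>\<omega>. norm (of_real (indicator {n} (N \<omega>)) * Y n \<omega>) \<partial>M) \<le> prob {\<omega>\<in>space M. N \<omega> = n}"
      by simp
  qed
  moreover have "AE \<omega> in M. summable (\<lambda>n. norm (of_real (indicator {n} (N \<omega>)) * Y n \<omega>))"
  proof (rule AE_I2)
    fix \<omega>
    show "summable (\<lambda>n. norm (of_real (indicator {n} (N \<omega>)) * Y n \<omega>))"
      by (rule summable_finite[of "{N \<omega>}"]) auto
  qed
  ultimately have "(\<lambda>n. \<integral>\<omega>. of_real (indicator {n} (N \<omega>)) * Y n \<omega> \<partial>M) sums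
      (\<integral>\<omega>. (\<Sum>n. of_real (indicator {n} (N \<omega>)) * Y n \<omega>) \<partial>M)"
    using int by (intro sums_integral)
  also have "(\<lambda>\<omega>. \<Sum>n. of_real (indicator {n} (N \<omega>)) * Y n \<omega>) = (\<lambda>\<omega>. Y (N \<omega>) \<omega>)"
    using sums_unique[OF single] by (simp add: fun_eq_iff)
  finally show ?thesis .
qed

definition nat_value :: "ennreal \<Rightarrow> nat" where
  "nat_value x = nat \<lfloor>enn2real x\<rfloor>"

lemma nat_value_of_nat [simp]: "nat_value (of_nat n) = n"
  by (simp add: nat_value_def)

lemma nat_value_measurable [measurable]: "nat_value \<in> borel \<rightarrow>\<^sub>M count_space UNIV"
  unfolding nat_value_def by measurable

text \<open>The Poisson weights add up to \<open>1\<close>, so a count with these weights is almost surely finite; its generating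
function is the exponential series.\<close>

lemma (in prob_space)
  fixes Z :: "'a \<Rightarrow> ennreal"
  assumes Z [measurable]: "Z \<in> borel_measurable M"
    and law: "\<And>k::nat. prob {\<omega>\<in>space M. Z \<omega> = of_nat k} = r ^ k / fact k * exp (- r)"
  shows poisson_AE_of_nat: "AE \<omega> in M. Z \<omega> = of_nat (nat_value (Z \<omega>))"
    and poisson_generating_function:
      "norm z \<le> 1 \<Longrightarrow> (\<integral>\<omega>. z ^ nat_value (Z \<omega>) \<partial>M) = exp (of_real r * (z - 1 :: complex))"
proof -
  have "(\<lambda>k. prob {\<omega>\<in>space M. Z \<omega> = of_nat k}) sums prob (\<Union>k. {\<omega>\<in>space M. Z \<omega> = of_nat k})"
    by (intro finite_measure_UNION) (auto simp: disjoint_family_on_def)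
  moreover have "(\<lambda>k. prob {\<omega>\<in>space M. Z \<omega> = of_nat k}) sums (exp r * exp (- r))"
    unfolding law using exp_converges[of r] by (intro sums_mult2) (simp add: field_simps)
  ultimately have "prob (\<Union>k. {\<omega>\<in>space M. Z \<omega> = of_nat k}) = exp r * exp (- r)"
    by (rule sums_unique2)
  then have "prob (\<Union>k. {\<omega>\<in>space M. Z \<omega> = of_nat k}) = 1" by (simp add: exp_minus)
  then have "AE \<omega> in M. \<omega> \<in> (\<Union>k. {\<omega>\<in>space M. Z \<omega> = of_nat k})"
    by (subst (asm) prob_eq_1) auto
  then show AE: "AE \<omega> in M. Z \<omega> = of_nat (nat_value (Z \<omega>))"
    by eventually_elim auto
  assume z: "norm z \<le> 1"
  have "(\<lambda>k. \<integral>\<omega>. of_real (indicator {k} (nat_value (Z \<omega>))) * z ^ k \<partial>M) sums (\<integral>\<omega>. z ^ nat_value (Z \<omega>) \<partial>M)"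
    by (intro integral_over_countable_value) (auto simp: norm_power power_le_one z)
  moreover have "(\<integral>\<omega>. of_real (indicator {k} (nat_value (Z \<omega>))) * z ^ k \<partial>M) =
      exp (- of_real r) * ((of_real r * z) ^ k /\<^sub>R fact k)" for k
  proof -
    have "(\<integral>\<omega>. of_real (indicator {k} (nat_value (Z \<omega>))) * z ^ k \<partial>M) =
        (\<integral>\<omega>. of_real (indicator {\<omega>\<in>space M. Z \<omega> = of_nat k} \<omega>) \<partial>M) * z ^ k"
    proof (subst integral_mult_left_zero[symmetric], rule integral_cong_AE)
      show "AE \<omega> in M. of_real (indicator {k} (nat_value (Z \<omega>))) * z ^ k =
          of_real (indicator {\<omega>\<in>space M. Z \<omega> = of_nat k} \<omega>) * z ^ k"
        using AE AE_space by eventually_elim (auto split: split_indicator)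
    qed measurable
    also have "\<dots> = of_real (r ^ k / fact k * exp (- r)) * z ^ k"
      by (simp add: law)
    also have "\<dots> = exp (- of_real r) * ((of_real r * z) ^ k /\<^sub>R fact k)"
      by (simp add: scaleR_conv_of_real power_mult_distrib field_simps flip: exp_of_real)
    finally show ?thesis .
  qed
  moreover have "(\<lambda>k. exp (- of_real r) * ((of_real r * z) ^ k /\<^sub>R fact k)) sums (exp (- of_real r) * exp (of_real r * z))"
    by (intro sums_mult exp_converges)
  ultimately have "(\<integral>\<omega>. z ^ nat_value (Z \<omega>) \<partial>M) = exp (- of_real r) * exp (of_real r * z)"
    by (metis (no_types, lifting) ext sums_unique2)
  also have "\<dots> = exp (of_real r * (z - 1))"
    by (simp add: exp_add[symmetric] algebra_simps)
  finally show "(\<integral>\<omega>. z ^ nat_value (Z \<omega>) \<partial>M) = exp (of_real r * (z - 1))" .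
qed

section \<open>Point measures and the parent process\<close>

lemma space_state_space: "space state_space = {0..} \<times> UNIV"
  by (simp add: state_space_def space_restrict_space)

lemma Times_in_state_space:
  assumes "S \<in> sets borel" "S \<subseteq> {0..}" "B \<in> sets borel"
  shows "S \<times> B \<in> sets state_space"
proof -
  have "S \<times> B = ({0..} \<times> UNIV) \<inter> (S \<times> B)" using assms by auto
  then show ?thesis
    using assms unfolding state_space_def sets_restrict_space by (blast intro: borel_Times)
qed

lemma sets_dirac_sum [simp]: "sets (dirac_sum I x) = sets state_space"
  by (simp add: dirac_sum_def)

lemma nn_integral_dirac_sum:
  assumes "\<And>i. i \<in> I \<Longrightarrow> x i \<in> space state_space" and [measurable]: "g \<in> borel_measurable state_space"
  shows "(\<integral>\<^sup>+p. g p \<partial>dirac_sum I x) = (\<integral>\<^sup>+i. g (x i) \<partial>count_space I)"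
  unfolding dirac_sum_def using assms by (subst nn_integral_distr) auto

lemma emeasure_dirac_sum:
  assumes "\<And>i. i \<in> I \<Longrightarrow> x i \<in> space state_space" "B \<in> sets state_space"
  shows "emeasure (dirac_sum I x) B = emeasure (count_space I) {i\<in>I. x i \<in> B}"
  unfolding dirac_sum_def using assms
  by (subst emeasure_distr) (auto intro!: arg_cong2[where f = emeasure])

lemma space_Mp: "space Mp = point_measures"
  unfolding Mp_def by (auto simp: space_Sup_eq_UN)

lemma emeasure_measurable_Mp [measurable]:
  "B \<in> sets state_space \<Longrightarrow> (\<lambda>\<mu>. emeasure \<mu> B) \<in> borel_measurable Mp"
  unfolding Mp_def by (rule measurable_SUP1) (auto intro!: measurable_vimage_algebra1)

lemma sets_point_measure: "\<mu> \<in> space Mp \<Longrightarrow> sets \<mu> = sets state_space"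
  by (auto simp: space_Mp point_measures_def)

lemma measurable_point_measure:
  assumes "\<mu> \<in> space Mp" "g \<in> borel_measurable state_space"
  shows "g \<in> borel_measurable \<mu>"
  using assms(2) by (subst measurable_cong_sets[OF sets_point_measure[OF assms(1)] refl])

text \<open>The sigma-algebra on point measures is generated by the evaluations, that is, by the integrals of indicators;
the monotone class argument does the rest.\<close>

lemma nn_integral_measurable_Mp [measurable]:
  assumes "g \<in> borel_measurable state_space"
  shows "(\<lambda>\<mu>. \<integral>\<^sup>+p. g p \<partial>\<mu>) \<in> borel_measurable Mp"
  using assms
proof induct
  case (cong f g)
  have "(\<integral>\<^sup>+p. f p \<partial>\<mu>) = (\<integral>\<^sup>+p. g p \<partial>\<mu>)" if "\<mu> \<in> space Mp" for \<mu>
    using cong(3) sets_eq_imp_space_eq[OF sets_point_measure[OF that]] by (intro nn_integral_cong) auto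
  then have "((\<lambda>\<mu>. \<integral>\<^sup>+p. f p \<partial>\<mu>) \<in> borel_measurable Mp) \<longleftrightarrow>
      ((\<lambda>\<mu>. \<integral>\<^sup>+p. g p \<partial>\<mu>) \<in> borel_measurable Mp)"
    by (rule measurable_cong)
  then show ?case using cong(4) by (rule iffD2)
next
  case (set B)
  have "(\<integral>\<^sup>+p. indicator B p \<partial>\<mu>) = emeasure \<mu> B" if "\<mu> \<in> space Mp" for \<mu>
    using set sets_point_measure[OF that] by simp
  then have "((\<lambda>\<mu>. \<integral>\<^sup>+p. indicator B p \<partial>\<mu>) \<in> borel_measurable Mp) \<longleftrightarrow>
      ((\<lambda>\<mu>. emeasure \<mu> B) \<in> borel_measurable Mp)"
    by (rule measurable_cong)
  then show ?case using emeasure_measurable_Mp[OF set] by (rule iffD2)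
next
  case (mult u c)
  have "(\<integral>\<^sup>+p. c * u p \<partial>\<mu>) = c * (\<integral>\<^sup>+p. u p \<partial>\<mu>)" if "\<mu> \<in> space Mp" for \<mu>
    by (rule nn_integral_cmult[OF measurable_point_measure[OF that mult(2)]])
  then have "((\<lambda>\<mu>. \<integral>\<^sup>+p. c * u p \<partial>\<mu>) \<in> borel_measurable Mp) \<longleftrightarrow>
      ((\<lambda>\<mu>. c * (\<integral>\<^sup>+p. u p \<partial>\<mu>)) \<in> borel_measurable Mp)"
    by (rule measurable_cong)
  then show ?case
    using borel_measurable_times_ennreal[OF borel_measurable_const mult(4)] by (rule iffD2)
next
  case (add u v)
  have "(\<integral>\<^sup>+p. v p + u p \<partial>\<mu>) = (\<integral>\<^sup>+p. v p \<partial>\<mu>) + (\<integral>\<^sup>+p. u p \<partial>\<mu>)" if "\<mu> \<in> space Mp" for \<mu>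
    by (rule nn_integral_add[OF measurable_point_measure[OF that add(4)] measurable_point_measure[OF that add(1)]])
  then have "((\<lambda>\<mu>. \<integral>\<^sup>+p. v p + u p \<partial>\<mu>) \<in> borel_measurable Mp) \<longleftrightarrow>
      ((\<lambda>\<mu>. (\<integral>\<^sup>+p. v p \<partial>\<mu>) + (\<integral>\<^sup>+p. u p \<partial>\<mu>)) \<in> borel_measurable Mp)"
    by (rule measurable_cong)
  then show ?case
    using borel_measurable_add[OF add(7) add(3)] by (rule iffD2)
next
  case (seq U)
  have "(\<integral>\<^sup>+p. (SUP i. U i) p \<partial>\<mu>) = (SUP i. \<integral>\<^sup>+p. U i p \<partial>\<mu>)" if "\<mu> \<in> space Mp" for \<mu>
    unfolding SUP_apply
    by (rule nn_integral_monotone_convergence_SUP[OF seq(4) measurable_point_measure[OF that seq(1)]])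
  then have "((\<lambda>\<mu>. \<integral>\<^sup>+p. (SUP i. U i) p \<partial>\<mu>) \<in> borel_measurable Mp) \<longleftrightarrow>
      ((\<lambda>\<mu>. SUP i. \<integral>\<^sup>+p. U i p \<partial>\<mu>) \<in> borel_measurable Mp)"
    by (rule measurable_cong)
  then show ?case
    using borel_measurable_SUP[OF countableI_type seq(3)] by (rule iffD2)
qed

context marked_poisson_cluster
begin

lemmas model_measurable [measurable] =
  \<Gamma>_measurable K_measurable T_measurable A_measurable kernel progeny_measurable

abbreviation parent_count :: "real \<Rightarrow> 'w \<Rightarrow> nat" where
  "parent_count t \<omega> \<equiv> card {i. \<Gamma> i \<omega> \<le> t}"

abbreviation point_count :: "(real \<times> 'a) set \<Rightarrow> 'w \<Rightarrow> ennreal" where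
  "point_count B \<omega> \<equiv> emeasure (parent_process \<Gamma> A \<omega>) B"

abbreviation intensity :: "(real \<times> 'a) measure" where
  "intensity \<equiv> scale_measure (ennreal \<nu>) (restrict_space lborel {0..}) \<Otimes>\<^sub>M Q"

lemma point_count_measurable [measurable]:
  "B \<in> sets state_space \<Longrightarrow> point_count B \<in> borel_measurable M"
  using parents_poisson unfolding poisson_point_process_def
  by (intro measurable_compose[OF _ emeasure_measurable_Mp]) auto

lemma parent_in_state_space: "\<omega> \<in> space M \<Longrightarrow> (\<Gamma> i \<omega>, A i 0 \<omega>) \<in> space state_space"
  by (auto simp: space_state_space \<Gamma>_nonneg)

lemma point_count_eq:
  assumes "\<omega> \<in> space M" "B \<in> sets state_space"
  shows "point_count B \<omega> = emeasure (count_space UNIV) {i. (\<Gamma> i \<omega>, A i 0 \<omega>) \<in> B}"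
  unfolding parent_process_def using assms by (subst emeasure_dirac_sum) (auto simp: parent_in_state_space)

lemma intensity_Times:
  assumes "S \<in> sets borel" "S \<subseteq> {0..}" "B \<in> sets borel"
  shows "emeasure intensity (S \<times> B) = ennreal \<nu> * emeasure lborel S * emeasure Q B"
proof -
  interpret Q: prob_space Q by (rule mark_law)
  have "S \<in> sets (restrict_space lborel {0..})"
    using assms by (auto simp: sets_restrict_space image_iff intro!: bexI[of _ S])
  then show ?thesis
    using assms mark_law
    by (subst Q.emeasure_pair_measure_Times) (auto simp: emeasure_restrict_space)
qed

lemma point_count_law:
  assumes "S \<in> sets borel" "S \<subseteq> {0..}" "B \<in> sets borel" "emeasure lborel S = ennreal l" "0 \<le> l"
  shows "prob {\<omega>\<in>space M. point_count (S \<times> B) \<omega> = of_nat k} =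
    (\<nu> * l * measure Q B) ^ k / fact k * exp (- (\<nu> * l * measure Q B))"
proof -
  interpret Q: prob_space Q by (rule mark_law)
  have e: "emeasure intensity (S \<times> B) = ennreal (\<nu> * l * measure Q B)"
    using assms nu_pos by (simp add: intensity_Times Q.emeasure_eq_measure ennreal_mult)
  then have "measure intensity (S \<times> B) = \<nu> * l * measure Q B"
    using assms nu_pos by (simp add: measure_def)
  with e show ?thesis
    using parents_poisson Times_in_state_space[OF assms(1-3)] unfolding poisson_point_process_def by simp
qed

lemma point_counts_indep:
  assumes "\<And>k::nat. k < n \<Longrightarrow> B k \<in> sets state_space" "disjoint_family_on B {..<n}"
  shows "indep_vars (\<lambda>_. borel) (\<lambda>k. point_count (B k)) {..<n}"
  using assms
    parents_poisson[unfolded poisson_point_process_def, THEN conjunct2, THEN conjunct2, THEN conjunct2,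
      rule_format, of n B]
  by simp

lemma \<Gamma>_mono: "\<omega> \<in> space M \<Longrightarrow> i \<le> j \<Longrightarrow> \<Gamma> i \<omega> \<le> \<Gamma> j \<omega>"
  by (rule lift_Suc_mono_le[of "\<lambda>i. \<Gamma> i \<omega>"]) (auto intro: \<Gamma>_ordered)

text \<open>As the arrival times are ordered, the parents up to time \<open>t\<close> are an initial segment of the indices.\<close>

lemma parents_before_eq:
  assumes "\<omega> \<in> space M" "finite {i. \<Gamma> i \<omega> \<le> t}"
  shows "{i. \<Gamma> i \<omega> \<le> t} = {..<parent_count t \<omega>}"
proof -
  have "\<exists>n. {i. \<Gamma> i \<omega> \<le> t} = {..<n}"
  proof -
    obtain m where m: "\<not> \<Gamma> m \<omega> \<le> t"
      using assms(2) infinite_UNIV_nat by (metis (mono_tags, lifting) UNIV_eq_I mem_Collect_eq)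
    define n where "n = (LEAST m. \<not> \<Gamma> m \<omega> \<le> t)"
    have "\<not> \<Gamma> n \<omega> \<le> t" unfolding n_def by (rule LeastI[where P = "\<lambda>m. \<not> \<Gamma> m \<omega> \<le> t", OF m])
    then have "{i. \<Gamma> i \<omega> \<le> t} = {..<n}"
      using \<Gamma>_mono[OF assms(1)] not_less_Least[where P = "\<lambda>m. \<not> \<Gamma> m \<omega> \<le> t"] unfolding n_def[symmetric]
      by (auto simp: not_less[symmetric]) (meson linorder_not_less order_trans)
    then show ?thesis by blast
  qed
  then show ?thesis by (metis card_lessThan)
qed

lemma AE_finite_parents_before:
  assumes "0 \<le> t"
  shows "AE \<omega> in M. finite {i. \<Gamma> i \<omega> \<le> t}"
proof -
  interpret Q: prob_space Q by (rule mark_law)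
  have B: "({0..t} \<times> UNIV :: (real \<times> 'a) set) \<in> sets state_space" by (rule Times_in_state_space) auto
  have "AE \<omega> in M. point_count ({0..t} \<times> UNIV) \<omega> = of_nat (nat_value (point_count ({0..t} \<times> UNIV) \<omega>))"
    using B assms by (intro poisson_AE_of_nat[of _ "\<nu> * t * measure Q UNIV"] point_count_law) auto
  with AE_space show ?thesis
  proof eventually_elim
    case (elim \<omega>)
    have "emeasure (count_space UNIV) {i. \<Gamma> i \<omega> \<le> t} = point_count ({0..t} \<times> UNIV) \<omega>"
      using elim B by (simp add: point_count_eq \<Gamma>_nonneg)
    also have "\<dots> \<noteq> \<infinity>" using elim(2) by (metis ennreal_of_nat_neq_top infinity_ennreal_def)
    finally show ?case by (auto simp: emeasure_count_space split: if_splits)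
  qed
qed

section \<open>The generating functional of the parent process\<close>

lemma parent_count_measurable [measurable]: "parent_count t \<in> M \<rightarrow>\<^sub>M count_space UNIV"
  by (rule measurable_card) measurable

text \<open>If infinitely many parents arrive before \<open>t\<close>, both products are \<open>1\<close> by the conventions for infinite
index sets and for the cardinality of an infinite set.\<close>

lemma parent_product_eq:
  "\<omega> \<in> space M \<Longrightarrow> (\<Prod>i\<in>{i. \<Gamma> i \<omega> \<le> t}. h i) = (\<Prod>i<parent_count t \<omega>. h i :: complex)"
  using parents_before_eq[of \<omega> t] by (cases "finite {i. \<Gamma> i \<omega> \<le> t}") simp_all

lemma parent_product_measurable:
  fixes g :: "'a \<Rightarrow> complex"
  assumes [measurable]: "g \<in> borel_measurable borel"
  shows "(\<lambda>\<omega>. \<Prod>i<parent_count t \<omega>. g (A i 0 \<omega>)) \<in> borel_measurable M"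
proof (rule measurable_compose_countable[where f = "\<lambda>n \<omega>. \<Prod>i<n. g (A i 0 \<omega>)"])
  show "(\<lambda>\<omega>. \<Prod>i<n. g (A i 0 \<omega>)) \<in> borel_measurable M" for n
    by (intro borel_measurable_prod measurable_compose[OF A_measurable assms])
qed (rule parent_count_measurable)

text \<open>Sorting the parents by the value of \<open>g\<close> at their marks turns the product into powers of the values, with
the Poisson counts of the corresponding level sets as exponents. These counts are independent, and each power has the
expectation given by the Poisson generating function.\<close>

lemma generating_functional_simple:
  fixes g :: "'a \<Rightarrow> complex"
  assumes t: "0 \<le> t" and g: "simple_function borel g" and le: "\<And>x. norm (g x) \<le> 1"
  shows "(\<integral>\<omega>. (\<Prod>i<parent_count t \<omega>. g (A i 0 \<omega>)) \<partial>M) = exp (of_real (\<nu> * t) * ((\<integral>x. g x \<partial>Q) - 1))"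
proof -
  interpret Q: prob_space Q by (rule mark_law)
  have [simp, measurable_cong]: "sets Q = sets borel" by (rule mark_law)
  have spQ [simp]: "space Q = UNIV" using sets_eq_imp_space_eq[OF mark_law(2)] by simp
  have fin: "finite (range g)" using simple_functionD(1)[OF g] by simp
  define n where "n = card (range g)"
  obtain h where h: "bij_betw h {..<n} (range g)"
    using ex_bij_betw_nat_finite[OF fin] unfolding atLeast0LessThan n_def by blast
  define B where "B k = g -` {h k}" for k
  have B [measurable]: "B k \<in> sets borel" for k
    using simple_functionD(2)[OF g, of "{h k}"] unfolding B_def space_borel Int_UNIV_right .
  define P where "P k = {0..t} \<times> B k" for k
  have P: "P k \<in> sets state_space" for k 
    unfolding P_def by (rule Times_in_state_space[OF _ _ B]) auto
  have disj: "disjoint_family_on B {..<n}"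
    using bij_betw_imp_inj_on[OF h] unfolding disjoint_family_on_def B_def
    by (auto dest: inj_onD)
  have UNB: "(\<Union>k<n. B k) = UNIV"
  proof -
    have "x \<in> (\<Union>k<n. B k)" for x
    proof -
      have "g x \<in> h ` {..<n}" using h by (simp add: bij_betw_def)
      then obtain k where "k < n" "g x = h k" by (elim imageE) simp
      then show ?thesis by (auto simp: B_def)
    qed
    then show ?thesis by blast
  qed
  have h_le: "norm (h k) \<le> 1" if "k < n" for k
  proof -
    have "h k \<in> range g" using h that by (auto simp: bij_betw_def)
    then show ?thesis using le by auto
  qed
  have law: "prob {\<omega>\<in>space M. point_count (P k) \<omega> = of_nat j} =
      (\<nu> * t * measure Q (B k)) ^ j / fact j * exp (- (\<nu> * t * measure Q (B k)))" for k j
    unfolding P_def using t by (intro point_count_law) auto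
  have "AE \<omega> in M. (\<Prod>i<parent_count t \<omega>. g (A i 0 \<omega>)) = (\<Prod>k<n. h k ^ nat_value (point_count (P k) \<omega>))"
    using AE_space AE_finite_parents_before[OF t]
  proof eventually_elim
    case (elim \<omega>)
    let ?I = "{i. \<Gamma> i \<omega> \<le> t}"
    have card: "nat_value (point_count (P k) \<omega>) = card {i\<in>?I. g (A i 0 \<omega>) = h k}" for k
    proof -
      have "{i. (\<Gamma> i \<omega>, A i 0 \<omega>) \<in> P k} = {i\<in>?I. g (A i 0 \<omega>) = h k}"
        using elim by (auto simp: P_def B_def \<Gamma>_nonneg)
      then show ?thesis
        using elim P by (simp add: point_count_eq emeasure_count_space)
    qed
    have "(\<Prod>i\<in>?I. g (A i 0 \<omega>)) = (\<Prod>y\<in>range g. \<Prod>i\<in>{i\<in>?I. g (A i 0 \<omega>) = y}. g (A i 0 \<omega>))"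
      using elim fin by (subst prod.group) auto
    also have "\<dots> = (\<Prod>k<n. \<Prod>i\<in>{i\<in>?I. g (A i 0 \<omega>) = h k}. g (A i 0 \<omega>))"
      by (rule prod.reindex_bij_betw[OF h, symmetric])
    also have "\<dots> = (\<Prod>k<n. h k ^ nat_value (point_count (P k) \<omega>))"
      by (simp add: card)
    finally show ?case using elim by (simp add: parent_product_eq)
  qed
  then have "(\<integral>\<omega>. (\<Prod>i<parent_count t \<omega>. g (A i 0 \<omega>)) \<partial>M) =
      (\<integral>\<omega>. (\<Prod>k<n. h k ^ nat_value (point_count (P k) \<omega>)) \<partial>M)"
  proof (rule integral_cong_AE[rotated 2])
    show "(\<lambda>\<omega>. \<Prod>i<parent_count t \<omega>. g (A i 0 \<omega>)) \<in> borel_measurable M"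
      using g by (intro parent_product_measurable borel_measurable_simple_function)
    show "(\<lambda>\<omega>. \<Prod>k<n. h k ^ nat_value (point_count (P k) \<omega>)) \<in> borel_measurable M"
    proof (intro borel_measurable_prod)
      fix k
      have "(\<lambda>\<omega>. nat_value (point_count (P k) \<omega>)) \<in> M \<rightarrow>\<^sub>M count_space UNIV"
        using P by measurable
      then show "(\<lambda>\<omega>. h k ^ nat_value (point_count (P k) \<omega>)) \<in> borel_measurable M"
        by (rule measurable_compose) simp
    qed
  qed
  also have "\<dots> = (\<Prod>k<n. \<integral>\<omega>. h k ^ nat_value (point_count (P k) \<omega>) \<partial>M)"
  proof (rule indep_vars_lebesgue_integral)
    have "indep_vars (\<lambda>_. borel) (\<lambda>k. point_count (P k)) {..<n}"
      using disj P by (intro point_counts_indep) (auto simp: disjoint_family_on_def P_def)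
    then show ind: "indep_vars (\<lambda>_. borel) (\<lambda>k \<omega>. h k ^ nat_value (point_count (P k) \<omega>)) {..<n}"
      by (rule indep_vars_compose2) (rule measurable_compose[OF nat_value_measurable], simp)
    fix k assume "k \<in> {..<n}"
    then show "integrable M (\<lambda>\<omega>. h k ^ nat_value (point_count (P k) \<omega>))"
      using indep_vars_def2[THEN iffD1, OF ind] h_le
      by (intro integrable_const_bound[where B = 1] AE_I2) (simp_all add: norm_power power_le_one)
  qed simp
  also have "\<dots> = (\<Prod>k<n. exp (of_real (\<nu> * t * measure Q (B k)) * (h k - 1)))"
  proof (rule prod.cong[OF refl])
    fix k assume "k \<in> {..<n}"
    then show "(\<integral>\<omega>. h k ^ nat_value (point_count (P k) \<omega>) \<partial>M) = exp (of_real (\<nu> * t * measure Q (B k)) * (h k - 1))"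
      using poisson_generating_function[OF point_count_measurable[OF P[of k]] law h_le[of k]] by simp
  qed
  also have "\<dots> = exp (\<Sum>k<n. of_real (\<nu> * t * measure Q (B k)) * (h k - 1))"
    by (simp add: exp_sum)
  also have "(\<Sum>k<n. of_real (\<nu> * t * measure Q (B k)) * (h k - 1)) =
      of_real (\<nu> * t) * ((\<Sum>k<n. measure Q (B k) *\<^sub>R h k) - of_real (\<Sum>k<n. measure Q (B k)))"
    by (simp add: sum_subtractf[symmetric] sum_distrib_left scaleR_conv_of_real algebra_simps)
  also have "(\<Sum>k<n. measure Q (B k)) = measure Q (\<Union>k<n. B k)"
    using disj by (intro Q.finite_measure_finite_Union[symmetric]) auto
  also have "\<dots> = 1" using Q.prob_space UNB by simp
  also have "(\<Sum>k<n. measure Q (B k) *\<^sub>R h k) = (\<integral>x. g x \<partial>Q)"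
  proof -
    have "(\<integral>x. g x \<partial>Q) = (\<integral>x. (\<Sum>k<n. indicator (B k) x *\<^sub>R h k) \<partial>Q)"
    proof (rule Bochner_Integration.integral_cong[OF refl])
      fix x
      have "(\<Sum>k<n. indicator (B k) x *\<^sub>R h k) = (\<Sum>y\<in>range g. indicator (g -` {y}) x *\<^sub>R y)"
        unfolding B_def by (rule sum.reindex_bij_betw[OF h])
      with simple_function_sum_indicator[OF g, of x, unfolded space_borel Int_UNIV_right, OF UNIV_I]
      show "g x = (\<Sum>k<n. indicator (B k) x *\<^sub>R h k)" by (rule trans[OF _ sym])
    qed
    also have "\<dots> = (\<Sum>k<n. measure Q (B k) *\<^sub>R h k)"
    proof -
      have "integrable Q (\<lambda>x. indicator (B k) x *\<^sub>R h k)" for k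
        by (intro integrable_scaleR_left impI integrable_real_indicator) (auto simp: Q.emeasure_eq_measure)
      then show ?thesis by (subst Bochner_Integration.integral_sum) (simp_all add: Q.emeasure_eq_measure)
    qed
    finally show ?thesis ..
  qed
  finally show ?thesis by simp
qed

lemma generating_functional:
  fixes g :: "'a \<Rightarrow> complex"
  assumes t: "0 \<le> t" and g [measurable]: "g \<in> borel_measurable borel" and le: "\<And>x. norm (g x) \<le> 1"
  shows "(\<integral>\<omega>. (\<Prod>i<parent_count t \<omega>. g (A i 0 \<omega>)) \<partial>M) = exp (of_real (\<nu> * t) * ((\<integral>x. g x \<partial>Q) - 1))"
proof -
  interpret Q: prob_space Q by (rule mark_law)
  have [measurable_cong]: "sets Q = sets borel" by (rule mark_law)
  obtain F where F: "\<And>i. simple_function borel (F i)" "\<And>x. (\<lambda>i. F i x) \<longlonglongrightarrow> g x"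
    "\<And>i x. norm (F i x) \<le> 1"
    using bounded_simple_approximation[OF g le] by (metis UNIV_I space_borel)
  have [measurable]: "F i \<in> borel_measurable borel" for i using F(1) by (rule borel_measurable_simple_function)
  have "(\<lambda>j. \<integral>\<omega>. (\<Prod>i<parent_count t \<omega>. F j (A i 0 \<omega>)) \<partial>M) \<longlonglongrightarrow>
      (\<integral>\<omega>. (\<Prod>i<parent_count t \<omega>. g (A i 0 \<omega>)) \<partial>M)"
  proof (rule integral_dominated_convergence[where w = "\<lambda>_. 1"])
    show "AE \<omega> in M. (\<lambda>j. \<Prod>i<parent_count t \<omega>. F j (A i 0 \<omega>)) \<longlonglongrightarrow> (\<Prod>i<parent_count t \<omega>. g (A i 0 \<omega>))"
      by (intro AE_I2 tendsto_prod F(2))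
    show "AE \<omega> in M. norm (\<Prod>i<parent_count t \<omega>. F j (A i 0 \<omega>)) \<le> 1" for j
      by (intro AE_I2 norm_prod_le_1 F(3))
  qed (simp_all add: parent_product_measurable)
  moreover have "(\<lambda>j. exp (of_real (\<nu> * t) * ((\<integral>x. F j x \<partial>Q) - 1))) \<longlonglongrightarrow>
      exp (of_real (\<nu> * t) * ((\<integral>x. g x \<partial>Q) - 1))"
  proof (intro tendsto_intros)
    show "(\<lambda>j. \<integral>x. F j x \<partial>Q) \<longlonglongrightarrow> (\<integral>x. g x \<partial>Q)"
      by (rule integral_dominated_convergence[where w = "\<lambda>_. 1"]) (auto simp: F)
  qed
  ultimately show ?thesis
    unfolding generating_functional_simple[OF t F(1) F(3)] by (rule LIMSEQ_unique)
qed

section \<open>The mark of the first parent\<close>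

text \<open>Cut time into intervals of length \<open>d\<close>. The event that the first non-empty interval contains exactly one
parent, and that this parent has its mark in \<open>B\<close>, forces the first mark to lie in \<open>B\<close>. Summing the probabilities over the
position of the interval gives a geometric series, whose value tends to \<open>Q B\<close> as \<open>d \<rightarrow> 0\<close>.\<close>

lemma first_mark_ge:
  assumes B [measurable]: "B \<in> sets borel"
  shows "measure Q B \<le> prob {\<omega>\<in>space M. A 0 0 \<omega> \<in> B}"
proof (rule LIMSEQ_le_const2)
  interpret Q: prob_space Q by (rule mark_law)
  have setsQ [simp, measurable_cong]: "sets Q = sets borel" by (rule mark_law)
  define x where "x m = \<nu> / real (Suc m)" for m
  show "(\<lambda>m. measure Q B * (x m * exp (- x m) / (1 - exp (- x m)))) \<longlonglongrightarrow> measure Q B"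
  proof -
    have "((\<lambda>y::real. y * exp (- y) / (1 - exp (- y))) \<longlongrightarrow> 1) (at_right 0)" by real_asymp
    moreover have "filterlim x (at_right 0) sequentially"
      unfolding x_def using nu_pos by real_asymp
    ultimately have "(\<lambda>m. x m * exp (- x m) / (1 - exp (- x m))) \<longlonglongrightarrow> 1"
      by (rule filterlim_compose)
    from tendsto_mult[OF tendsto_const this] show ?thesis by simp
  qed
  show "\<exists>N. \<forall>m\<ge>N. measure Q B * (x m * exp (- x m) / (1 - exp (- x m))) \<le> prob {\<omega>\<in>space M. A 0 0 \<omega> \<in> B}"
  proof (intro exI[of _ 0] allI impI)
    fix m
    define d where "d = 1 / real (Suc m)"
    have d: "0 < d" by (simp add: d_def)
    have xd: "x m = \<nu> * d" by (simp add: x_def d_def)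
    have strip: "{d * real k..<d * real (Suc k)} \<subseteq> {0..}" for k
      using d by (auto intro: order_trans[of 0 "d * real k"])
    define P where "P k j = (if j = 0 then {0..<d * real k} \<times> UNIV
      else if j = 1 then {d * real k..<d * real (Suc k)} \<times> B
      else {d * real k..<d * real (Suc k)} \<times> (- B))" for k j :: nat
    have P: "P k j \<in> sets state_space" for k j
      unfolding P_def using strip by (auto intro!: Times_in_state_space simp del: of_nat_Suc)
    \<comment> \<open>No parent before \<open>d k\<close>, and in the interval that starts there one parent with mark in \<open>B\<close> and none with mark outside.\<close>
    define E where "E k = {\<omega>\<in>space M. point_count (P k 0) \<omega> = of_nat 0 \<and> point_count (P k 1) \<omega> = of_nat 1 \<and>
      point_count (P k 2) \<omega> = of_nat 0}" for k
    have E [measurable]: "E k \<in> sets M" for k unfolding E_def using P by measurable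
    have prob_E: "prob (E k) = measure Q B * x m * exp (- x m) ^ Suc k" for k
    proof -
      define v :: "nat \<Rightarrow> ennreal" where "v j = (if j = 1 then of_nat 1 else of_nat 0)" for j
      have ind: "indep_vars (\<lambda>_. borel) (\<lambda>j. point_count (P k j)) {..<3}"
        using P by (intro point_counts_indep) (auto simp: disjoint_family_on_def P_def split: if_splits)
      have E_eq: "E k = (\<Inter>j\<in>{..<3}. point_count (P k j) -` {v j} \<inter> space M)"
        by (auto simp: E_def v_def numeral_3_eq_3 numeral_2_eq_2 lessThan_Suc)
      have "prob (E k) = (\<Prod>j<3. prob (point_count (P k j) -` {v j} \<inter> space M))"
        unfolding E_eq by (rule indep_varsD_finite[OF ind]) (auto simp: lessThan_empty_iff)
      also have "\<dots> = prob {\<omega>\<in>space M. point_count (P k 0) \<omega> = of_nat 0} *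
          prob {\<omega>\<in>space M. point_count (P k 1) \<omega> = of_nat 1} * prob {\<omega>\<in>space M. point_count (P k 2) \<omega> = of_nat 0}"
        by (simp add: v_def numeral_3_eq_3 numeral_2_eq_2 lessThan_Suc vimage_def Int_def conj_commute mult_ac)
      also have "prob {\<omega>\<in>space M. point_count (P k 0) \<omega> = of_nat 0} = exp (- (\<nu> * (d * real k)))"
      proof -
        have "{0..<d * real k} \<subseteq> {0..}" by auto
        then show ?thesis
          using point_count_law[of "{0..<d * real k}" UNIV "d * real k" 0] d Q.prob_space
            sets_eq_imp_space_eq[OF setsQ] by (simp add: P_def)
      qed
      also have "prob {\<omega>\<in>space M. point_count (P k 1) \<omega> = of_nat 1} = \<nu> * d * measure Q B * exp (- (\<nu> * d * measure Q B))"
        using point_count_law[of "{d * real k..<d * real (Suc k)}" B d 1] strip d B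
        by (simp add: P_def algebra_simps)
      also have "prob {\<omega>\<in>space M. point_count (P k 2) \<omega> = of_nat 0} = exp (- (\<nu> * d * (1 - measure Q B)))"
      proof -
        have c: "measure Q (- B) = 1 - measure Q B"
          using Q.prob_compl[of B] sets_eq_imp_space_eq[OF setsQ] by (simp add: Compl_eq_Diff_UNIV)
        have l: "emeasure lborel {d * real k..<d * real (Suc k)} = ennreal d"
          using d by (simp add: algebra_simps)
        show ?thesis
          using point_count_law[OF _ strip _ l, of "- B" 0] d B by (simp add: P_def c)
      qed
      also have "exp (- (\<nu> * (d * real k))) * (\<nu> * d * measure Q B * exp (- (\<nu> * d * measure Q B))) *
          exp (- (\<nu> * d * (1 - measure Q B))) = measure Q B * x m * exp (- x m) ^ Suc k"
        unfolding exp_of_nat_mult[symmetric] xd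
        by (simp add: exp_add[symmetric] algebra_simps)
      finally show ?thesis .
    qed
    have E_sub: "\<omega> \<in> space M \<and> A 0 0 \<omega> \<in> B \<and> \<Gamma> 0 \<omega> \<in> {d * real k..<d * real (Suc k)}" if "\<omega> \<in> E k" for \<omega> k
    proof -
      have \<omega>: "\<omega> \<in> space M" using that by (simp add: E_def)
      have count: "point_count (P k j) \<omega> = emeasure (count_space UNIV) {i. (\<Gamma> i \<omega>, A i 0 \<omega>) \<in> P k j}" for j
        by (rule point_count_eq[OF \<omega> P])
      have none: "{i. (\<Gamma> i \<omega>, A i 0 \<omega>) \<in> P k j} = {}" if "point_count (P k j) \<omega> = 0" for j
        using that unfolding count by (simp add: emeasure_count_space_eq_0)
      have "{i. (\<Gamma> i \<omega>, A i 0 \<omega>) \<in> P k 1} \<noteq> {}"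
      proof
        assume "{i. (\<Gamma> i \<omega>, A i 0 \<omega>) \<in> P k 1} = {}"
        then have "point_count (P k 1) \<omega> = 0" unfolding count by simp
        then show False using that by (simp add: E_def)
      qed
      then obtain i where i: "(\<Gamma> i \<omega>, A i 0 \<omega>) \<in> P k 1" by auto
      have "(\<Gamma> 0 \<omega>, A 0 0 \<omega>) \<notin> P k 0" "(\<Gamma> 0 \<omega>, A 0 0 \<omega>) \<notin> P k 2"
        using none[of 0] none[of 2] that by (auto simp: E_def)
      moreover have "0 \<le> \<Gamma> 0 \<omega>" "\<Gamma> 0 \<omega> \<le> \<Gamma> i \<omega>"
        using \<omega> by (auto intro: \<Gamma>_nonneg \<Gamma>_mono)
      ultimately show ?thesis using i \<omega> by (auto simp: P_def)
    qed
    have disj: "disjoint_family E"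
    proof -
      have "j = k" if "\<omega> \<in> E j" "\<omega> \<in> E k" for j k \<omega>
      proof -
        have "d * real j < d * real (Suc k)" "d * real k < d * real (Suc j)"
          using E_sub[OF that(1)] E_sub[OF that(2)] by auto
        then have "j < Suc k" "k < Suc j" using d by (auto simp del: of_nat_Suc)
        then show ?thesis by simp
      qed
      then show ?thesis by (auto simp: disjoint_family_on_def)
    qed
    have "(\<lambda>k. measure Q B * x m * exp (- x m) ^ Suc k) sums prob (\<Union>k. E k)"
    proof -
      have "range E \<subseteq> events" using E by blast
      from finite_measure_UNION[OF this disj] show ?thesis unfolding prob_E .
    qed
    moreover have "(\<lambda>k. measure Q B * x m * exp (- x m) ^ Suc k) sums
        (measure Q B * x m * exp (- x m) * (1 / (1 - exp (- x m))))"
    proof -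
      have "0 < x m" using nu_pos by (simp add: x_def)
      then have "(\<lambda>k. exp (- x m) ^ k) sums (1 / (1 - exp (- x m)))"
        by (intro geometric_sums) auto
      from sums_mult[OF this, of "measure Q B * x m * exp (- x m)"] show ?thesis
        by (simp add: mult.assoc)
    qed
    ultimately have "measure Q B * (x m * exp (- x m) / (1 - exp (- x m))) = prob (\<Union>k. E k)"
      by (simp add: sums_unique2 mult.assoc)
    also have "\<dots> \<le> prob {\<omega>\<in>space M. A 0 0 \<omega> \<in> B}"
      using E_sub by (intro finite_measure_mono) auto
    finally show "measure Q B * (x m * exp (- x m) / (1 - exp (- x m))) \<le> prob {\<omega>\<in>space M. A 0 0 \<omega> \<in> B}" .
  qed
qed

text \<open>The lower bounds for \<open>B\<close> and for its complement add up to \<open>1\<close>, so both are equalities.\<close>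

lemma first_mark_law: "distr M borel (A 0 0) = Q"
proof (rule measure_eqI)
  interpret Q: prob_space Q by (rule mark_law)
  have sp: "space Q = UNIV" using sets_eq_imp_space_eq[OF mark_law(2)] by simp
  fix B assume "B \<in> sets (distr M borel (A 0 0))"
  then have B [measurable]: "B \<in> sets borel" by simp
  have "prob {\<omega>\<in>space M. A 0 0 \<omega> \<in> - B} = 1 - prob {\<omega>\<in>space M. A 0 0 \<omega> \<in> B}"
    using prob_compl[of "{\<omega>\<in>space M. A 0 0 \<omega> \<in> B}"] by (simp add: set_diff_eq) (simp add: conj_commute cong: conj_cong)
  moreover have "measure Q (- B) = 1 - measure Q B"
    using Q.prob_compl[of B] mark_law(2) sp by (simp add: Compl_eq_Diff_UNIV)
  ultimately have "measure Q B = prob {\<omega>\<in>space M. A 0 0 \<omega> \<in> B}"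
    using first_mark_ge[OF B] first_mark_ge[of "- B"] by simp
  then show "emeasure (distr M borel (A 0 0)) B = emeasure Q B"
    by (simp add: emeasure_distr emeasure_eq_measure Q.emeasure_eq_measure vimage_def Int_def conj_commute)
qed (simp add: mark_law)

section \<open>Clusters given their parents\<close>

lemma parent_sequence_measurable:
  "(\<lambda>\<omega> i. (\<Gamma> i \<omega>, A i 0 \<omega>)) \<in> M \<rightarrow>\<^sub>M (\<Pi>\<^sub>M i\<in>UNIV. borel)"
  by (intro measurable_PiM_single') (auto intro!: borel_measurable_Pair \<Gamma>_measurable A_measurable)

lemma subalgebra_parent_sigma: "subalgebra M (parent_sigma M \<Gamma> A)"
  unfolding subalgebra_def parent_sigma_def
  using measurable_sets[OF parent_sequence_measurable] by (auto simp: sets_vimage_algebra2 space_PiM)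

lemma parent_sigma_component:
  shows "\<Gamma> i \<in> borel_measurable (parent_sigma M \<Gamma> A)" and "A i 0 \<in> borel_measurable (parent_sigma M \<Gamma> A)"
proof -
  have "(\<lambda>\<omega> i. (\<Gamma> i \<omega>, A i 0 \<omega>)) \<in> parent_sigma M \<Gamma> A \<rightarrow>\<^sub>M (\<Pi>\<^sub>M i\<in>UNIV. borel)"
    unfolding parent_sigma_def by (rule measurable_vimage_algebra1) (auto simp: space_PiM)
  from measurable_compose[OF this measurable_component_singleton[of i UNIV]]
  have *: "(\<lambda>\<omega>. (\<Gamma> i \<omega>, A i 0 \<omega>)) \<in> borel_measurable (parent_sigma M \<Gamma> A)" by simp
  show "\<Gamma> i \<in> borel_measurable (parent_sigma M \<Gamma> A)"
    using measurable_compose[OF * borel_measurable_continuous_onI[OF continuous_on_fst[OF continuous_on_id]]] by simp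
  show "A i 0 \<in> borel_measurable (parent_sigma M \<Gamma> A)"
    using measurable_compose[OF * borel_measurable_continuous_onI[OF continuous_on_snd[OF continuous_on_id]]] by simp
qed

lemma kernel_prob:
  shows "prob_space (\<kappa> a)" "sets (\<kappa> a) = sets Mp" "space (\<kappa> a) = space Mp"
  using measurable_space[OF kernel, of a] by (auto simp: space_prob_algebra dest: sets_eq_imp_space_eq)

lemma kernel_measure_measurable: "C \<in> sets Mp \<Longrightarrow> (\<lambda>a. measure (\<kappa> a) C) \<in> borel_measurable borel"
  by (rule measurable_compose[OF kernel measurable_measure_prob_algebra])

lemma kernel_integral_measurable:
  "w \<in> borel_measurable Mp \<Longrightarrow> (\<lambda>a. \<integral>\<mu>. w \<mu> \<partial>\<kappa> a) \<in> borel_measurable borel"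
  for w :: "_ \<Rightarrow> complex"
  by (rule measurable_compose[OF measurable_prob_algebraD[OF kernel] integral_measurable_subprob_algebra])

lemma norm_kernel_integral_le:
  assumes "\<And>\<mu>. norm (w \<mu> :: complex) \<le> 1"
  shows "norm (\<integral>\<mu>. w \<mu> \<partial>\<kappa> a) \<le> 1"
proof -
  interpret k: prob_space "\<kappa> a" by (rule kernel_prob)
  show ?thesis using assms by (rule k.norm_integral_le_1)
qed

text \<open>The defining property of the conditional expectation, with a complex weight that is treated through its real
and imaginary part.\<close>

lemma progeny_sets_law:
  fixes X :: "'w \<Rightarrow> complex"
  assumes X: "X \<in> borel_measurable (parent_sigma M \<Gamma> A)" and X_le: "\<And>\<omega>. norm (X \<omega>) \<le> 1"
    and C: "\<And>i. i < n \<Longrightarrow> C i \<in> sets Mp"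
  shows "(\<integral>\<omega>. X \<omega> * (\<Prod>i<n. of_real (indicator (C i) (progeny_process K T A i \<omega>))) \<partial>M) =
    (\<integral>\<omega>. X \<omega> * (\<Prod>i<n. of_real (measure (\<kappa> (A i 0 \<omega>)) (C i))) \<partial>M)"
proof -
  interpret S: finite_measure_subalgebra M "parent_sigma M \<Gamma> A"
    by standard (rule subalgebra_parent_sigma)
  define E where "E = {\<omega>\<in>space M. \<forall>i\<in>{..<n}. progeny_process K T A i \<omega> \<in> C i}"
  have E: "E \<in> sets M"
  proof -
    have "{\<omega>\<in>space M. progeny_process K T A i \<omega> \<in> C i} \<in> sets M" if "i \<in> {..<n}" for i
      using measurable_sets[OF progeny_measurable C[of i], of i] that by (simp add: vimage_def Int_def conj_commute)
    then show ?thesis unfolding E_def by (intro sets.sets_Collect_finite_All) auto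
  qed
  define c where "c \<omega> = (\<Prod>i<n. measure (\<kappa> (A i 0 \<omega>)) (C i))" for \<omega>
  have c_meas: "c \<in> borel_measurable M" unfolding c_def
    using C by (intro borel_measurable_prod measurable_compose[OF A_measurable kernel_measure_measurable]) auto
  have c_le: "\<bar>c \<omega>\<bar> \<le> 1" for \<omega>
    using prob_space.prob_le_1[OF kernel_prob(1)] unfolding c_def by (simp add: prod_nonneg prod_le_1)
  have X_meas: "X \<in> borel_measurable M" by (rule measurable_from_subalg[OF subalgebra_parent_sigma X])
  have ae: "AE \<omega> in M. real_cond_exp M (parent_sigma M \<Gamma> A) (indicator E) \<omega> = c \<omega>"
    unfolding E_def c_def by (rule progeny_conditional_law) (use C in auto)
  have real: "(\<integral>\<omega>. x \<omega> * indicator E \<omega> \<partial>M) = (\<integral>\<omega>. x \<omega> * c \<omega> \<partial>M)"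
    if x: "x \<in> borel_measurable (parent_sigma M \<Gamma> A)" and x_le: "\<And>\<omega>. \<bar>x \<omega>\<bar> \<le> 1" for x :: "'w \<Rightarrow> real"
  proof -
    have x_meas: "x \<in> borel_measurable M" by (rule measurable_from_subalg[OF subalgebra_parent_sigma x])
    have "integrable M (\<lambda>\<omega>. x \<omega> * indicator E \<omega>)"
      using x_meas x_le E by (intro integrable_const_bound[where B = 1] AE_I2) (auto simp: abs_mult split: split_indicator)
    from S.real_cond_exp_intg(2)[OF this x] E
    have "(\<integral>\<omega>. x \<omega> * indicator E \<omega> \<partial>M) = (\<integral>\<omega>. x \<omega> * real_cond_exp M (parent_sigma M \<Gamma> A) (indicator E) \<omega> \<partial>M)"
      by simp
    also have "\<dots> = (\<integral>\<omega>. x \<omega> * c \<omega> \<partial>M)"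
    proof (rule integral_cong_AE)
      show "AE \<omega> in M. x \<omega> * real_cond_exp M (parent_sigma M \<Gamma> A) (indicator E) \<omega> = x \<omega> * c \<omega>"
        using ae by eventually_elim simp
    qed (use x_meas c_meas in measurable)
    finally show ?thesis .
  qed
  have parts: "(\<integral>\<omega>. X \<omega> * of_real (d \<omega>) \<partial>M) =
      Complex (\<integral>\<omega>. Re (X \<omega>) * d \<omega> \<partial>M) (\<integral>\<omega>. Im (X \<omega>) * d \<omega> \<partial>M)"
    if d: "d \<in> borel_measurable M" "\<And>\<omega>. \<bar>d \<omega>\<bar> \<le> 1" for d :: "'w \<Rightarrow> real"
  proof -
    have "integrable M (\<lambda>\<omega>. X \<omega> * of_real (d \<omega>))"
      using X_meas d X_le
      by (intro integrable_const_bound[where B = 1] AE_I2) (auto simp: norm_mult mult_le_one)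
    then show ?thesis by (intro complex_eqI) (simp_all flip: integral_Re integral_Im)
  qed
  have Re_Im: "(\<lambda>\<omega>. Re (X \<omega>)) \<in> borel_measurable (parent_sigma M \<Gamma> A)"
    "(\<lambda>\<omega>. Im (X \<omega>)) \<in> borel_measurable (parent_sigma M \<Gamma> A)" using X by auto
  have "(\<integral>\<omega>. X \<omega> * (\<Prod>i<n. of_real (indicator (C i) (progeny_process K T A i \<omega>))) \<partial>M) =
      (\<integral>\<omega>. X \<omega> * of_real (indicator E \<omega>) \<partial>M)"
  proof (rule Bochner_Integration.integral_cong[OF refl])
    fix \<omega> assume \<omega>: "\<omega> \<in> space M"
    have "(\<Prod>i<n. indicator (C i) (progeny_process K T A i \<omega>)) = (indicator E \<omega> :: real)"
    proof (cases "\<omega> \<in> E")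
      case True then show ?thesis by (simp add: E_def)
    next
      case False
      then obtain i where "i < n" "progeny_process K T A i \<omega> \<notin> C i" using \<omega> by (auto simp: E_def)
      then show ?thesis using False by (auto intro!: prod_zero bexI[of _ i])
    qed
    then show "X \<omega> * (\<Prod>i<n. of_real (indicator (C i) (progeny_process K T A i \<omega>))) = X \<omega> * of_real (indicator E \<omega>)"
      by (metis of_real_prod)
  qed
  also have "\<dots> = (\<integral>\<omega>. X \<omega> * of_real (c \<omega>) \<partial>M)"
    using E c_meas c_le real[OF Re_Im(1)] real[OF Re_Im(2)] order_trans[OF abs_Re_le_cmod X_le] order_trans[OF abs_Im_le_cmod X_le]
    by (subst (1 2) parts) (auto split: split_indicator)
  finally show ?thesis by (simp add: c_def)
qed

text \<open>Replaces the indicators by bounded functions, one cluster after the other: the induction is on the number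
\<open>k\<close> of leading factors that are already general.\<close>

lemma progeny_functions_law:
  fixes X :: "'w \<Rightarrow> complex" and v :: "nat \<Rightarrow> (real \<times> 'a) measure \<Rightarrow> complex"
  assumes X: "X \<in> borel_measurable (parent_sigma M \<Gamma> A)" and X_le: "\<And>\<omega>. norm (X \<omega>) \<le> 1"
    and v: "\<And>i. v i \<in> borel_measurable Mp" and v_le: "\<And>i \<mu>. norm (v i \<mu>) \<le> 1"
  shows "(\<integral>\<omega>. X \<omega> * (\<Prod>i<n. v i (progeny_process K T A i \<omega>)) \<partial>M) =
    (\<integral>\<omega>. X \<omega> * (\<Prod>i<n. (\<integral>\<mu>. v i \<mu> \<partial>\<kappa> (A i 0 \<omega>))) \<partial>M)"
proof -
  have X_meas: "X \<in> borel_measurable M" by (rule measurable_from_subalg[OF subalgebra_parent_sigma X])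
  have ind: "\<And>v. (\<And>i. v i \<in> borel_measurable Mp) \<Longrightarrow> (\<And>i \<mu>. norm (v i \<mu> :: complex) \<le> 1) \<Longrightarrow>
      (\<And>i. k \<le> i \<Longrightarrow> \<exists>C\<in>sets Mp. v i = (\<lambda>\<mu>. of_real (indicator C \<mu>))) \<Longrightarrow>
      (\<integral>\<omega>. X \<omega> * (\<Prod>i<n. v i (progeny_process K T A i \<omega>)) \<partial>M) =
      (\<integral>\<omega>. X \<omega> * (\<Prod>i<n. (\<integral>\<mu>. v i \<mu> \<partial>\<kappa> (A i 0 \<omega>))) \<partial>M)" for k
  proof (induction k)
    case 0
    then obtain C where C: "\<And>i. C i \<in> sets Mp" "\<And>i. v i = (\<lambda>\<mu>. of_real (indicator (C i) \<mu>))"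
      by (metis le0)
    have "(\<integral>\<mu>. v i \<mu> \<partial>\<kappa> a) = of_real (measure (\<kappa> a) (C i))" for i a
    proof -
      interpret k: prob_space "\<kappa> a" by (rule kernel_prob)
      show ?thesis unfolding C(2) integral_complex_of_real
        using C(1)[of i] sets.sets_into_space[OF C(1)[of i]] by (simp add: kernel_prob Int_absorb2)
    qed
    with progeny_sets_law[OF X X_le C(1), where n = n] show ?case by (simp add: C(2))
  next
    case (Suc k)
    show ?case
    proof (cases "k < n")
      case False
      \<comment> \<open>Factors beyond \<open>n\<close> do not occur in the products and may be replaced by \<open>0\<close>, which is an indicator.\<close>
      define v' where "v' i = (if i < n then v i else (\<lambda>\<mu>. of_real (indicator {} \<mu>)))" for i
      have "(\<integral>\<omega>. X \<omega> * (\<Prod>i<n. v' i (progeny_process K T A i \<omega>)) \<partial>M) =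
          (\<integral>\<omega>. X \<omega> * (\<Prod>i<n. (\<integral>\<mu>. v' i \<mu> \<partial>\<kappa> (A i 0 \<omega>))) \<partial>M)"
        by (rule Suc.IH) (use Suc.prems False in \<open>auto simp: v'_def intro!: bexI[of _ "{}"]\<close>)
      then show ?thesis by (simp add: v'_def)
    next
      case True
      \<comment> \<open>Only the factor \<open>k\<close> varies; by the induction hypothesis the identity holds if it is an indicator.\<close>
      define Y where "Y \<omega> = X \<omega> * (\<Prod>i\<in>{..<n} - {k}. v i (progeny_process K T A i \<omega>))" for \<omega>
      define Z where "Z \<omega> = X \<omega> * (\<Prod>i\<in>{..<n} - {k}. (\<integral>\<mu>. v i \<mu> \<partial>\<kappa> (A i 0 \<omega>)))" for \<omega>
      have split: "(\<Prod>i<n. w i) = w k * (\<Prod>i\<in>{..<n} - {k}. w i)" for w :: "nat \<Rightarrow> complex"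
        using True by (intro prod.remove) auto
      have "(\<integral>\<omega>. Y \<omega> * v k (progeny_process K T A k \<omega>) \<partial>M) = (\<integral>\<omega>. Z \<omega> * (\<integral>\<mu>. v k \<mu> \<partial>\<kappa> (A k 0 \<omega>)) \<partial>M)"
      proof (rule conditional_expectation_of_kernel)
        show "Y \<in> borel_measurable M" unfolding Y_def
          by (intro borel_measurable_times X_meas borel_measurable_prod measurable_compose[OF progeny_measurable] Suc.prems)
        show "Z \<in> borel_measurable M" unfolding Z_def
          by (intro borel_measurable_times X_meas borel_measurable_prod
              measurable_compose[OF A_measurable kernel_integral_measurable] Suc.prems)
        show "norm (Y \<omega>) \<le> 1" for \<omega> unfolding Y_def norm_mult
          by (intro mult_le_one X_le norm_prod_le_1 Suc.prems norm_ge_zero)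
        show "norm (Z \<omega>) \<le> 1" for \<omega> unfolding Z_def norm_mult
          by (intro mult_le_one X_le norm_prod_le_1 norm_kernel_integral_le Suc.prems norm_ge_zero)
        show "(\<lambda>\<omega>. \<kappa> (A k 0 \<omega>)) \<in> M \<rightarrow>\<^sub>M prob_algebra Mp"
          by (rule measurable_compose[OF A_measurable kernel])
        fix C :: "(real \<times> 'a) measure set" assume C: "C \<in> sets Mp"
        define v' where "v' = v(k := (\<lambda>\<mu>. of_real (indicator C \<mu>)))"
        have "(\<integral>\<omega>. X \<omega> * (\<Prod>i<n. v' i (progeny_process K T A i \<omega>)) \<partial>M) =
            (\<integral>\<omega>. X \<omega> * (\<Prod>i<n. (\<integral>\<mu>. v' i \<mu> \<partial>\<kappa> (A i 0 \<omega>))) \<partial>M)"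
        proof (rule Suc.IH)
          show "v' i \<in> borel_measurable Mp" for i using Suc.prems(1)[of i] C by (auto simp: v'_def)
          show "norm (v' i \<mu>) \<le> 1" for i \<mu> using Suc.prems(2)[of i \<mu>] by (auto simp: v'_def split: split_indicator)
          show "\<exists>C\<in>sets Mp. v' i = (\<lambda>\<mu>. of_real (indicator C \<mu>))" if "k \<le> i" for i
            using Suc.prems(3)[of i] that C by (cases "i = k") (auto simp: v'_def)
        qed
        moreover have "(\<integral>\<mu>. v' k \<mu> \<partial>\<kappa> a) = of_real (measure (\<kappa> a) C)" for a
        proof -
          interpret k: prob_space "\<kappa> a" by (rule kernel_prob)
          show ?thesis unfolding v'_def fun_upd_same integral_complex_of_real
            using C sets.sets_into_space[OF C] by (simp add: kernel_prob Int_absorb2)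
        qed
        ultimately show "(\<integral>\<omega>. Y \<omega> * of_real (indicator C (progeny_process K T A k \<omega>)) \<partial>M) =
            (\<integral>\<omega>. Z \<omega> * of_real (measure (\<kappa> (A k 0 \<omega>)) C) \<partial>M)"
          unfolding split Y_def Z_def by (simp add: v'_def mult_ac)
      qed (use Suc.prems progeny_measurable in auto)
      then show ?thesis unfolding split Y_def Z_def by (simp add: mult_ac)
    qed
  qed
  define v' where "v' i = (if i < n then v i else (\<lambda>\<mu>. of_real (indicator {} \<mu>)))" for i
  have "(\<integral>\<omega>. X \<omega> * (\<Prod>i<n. v' i (progeny_process K T A i \<omega>)) \<partial>M) =
      (\<integral>\<omega>. X \<omega> * (\<Prod>i<n. (\<integral>\<mu>. v' i \<mu> \<partial>\<kappa> (A i 0 \<omega>))) \<partial>M)"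
  proof (rule ind)
    show "\<exists>C\<in>sets Mp. v' i = (\<lambda>\<mu>. of_real (indicator C \<mu>))" if "n \<le> i" for i
      using that by (auto simp: v'_def intro!: bexI[of _ "{}"])
  qed (use v v_le in \<open>auto simp: v'_def\<close>)
  then show ?thesis by (simp add: v'_def)
qed

section \<open>The compound Poisson law of the immigrant claims\<close>

context
  fixes f :: "'a \<Rightarrow> real"
  assumes f_measurable [measurable]: "f \<in> borel_measurable borel" and f_nonneg: "\<And>s. 0 \<le> f s"
begin

lemma mark_functional_measurable: "(\<lambda>p. ennreal (f (snd p))) \<in> borel_measurable state_space"
proof -
  have "snd \<in> borel_measurable (borel :: (real \<times> 'a) measure)"
    by (intro borel_measurable_continuous_onI continuous_intros)
  from measurable_compose[OF this f_measurable] show ?thesis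
    unfolding state_space_def by (intro measurable_restrict_space1) auto
qed

definition progeny_total :: "(real \<times> 'a) measure \<Rightarrow> real" where
  "progeny_total \<mu> = enn2real (\<integral>\<^sup>+p. ennreal (f (snd p)) \<partial>\<mu>)"

lemma progeny_total_measurable [measurable]: "progeny_total \<in> borel_measurable Mp"
  unfolding progeny_total_def using nn_integral_measurable_Mp[OF mark_functional_measurable] by measurable

text \<open>Separates the mark of the parent, which is known given the parent process, from a measurable functional of the
progeny process, whose conditional law is the kernel.\<close>

lemma cluster_total_eq:
  assumes "\<omega> \<in> space M"
  shows "cluster_total f K A i \<omega> = f (A i 0 \<omega>) + progeny_total (progeny_process K T A i \<omega>)"
proof -
  have "(\<integral>\<^sup>+p. ennreal (f (snd p)) \<partial>progeny_process K T A i \<omega>) =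
      (\<integral>\<^sup>+j. ennreal (f (A i j \<omega>)) \<partial>count_space {1..K i \<omega>})"
    unfolding progeny_process_def using assms T_nonneg
    by (subst nn_integral_dirac_sum[OF _ mark_functional_measurable]) (auto simp: space_state_space)
  also have "\<dots> = ennreal (\<Sum>j=1..K i \<omega>. f (A i j \<omega>))"
    by (simp add: nn_integral_count_space_finite f_nonneg)
  finally have "progeny_total (progeny_process K T A i \<omega>) = (\<Sum>j=1..K i \<omega>. f (A i j \<omega>))"
    by (simp add: progeny_total_def sum_nonneg f_nonneg)
  then show ?thesis
    by (simp add: cluster_total_def sum.atLeast_Suc_atMost)
qed

lemma cluster_total_measurable [measurable]: "cluster_total f K A i \<in> borel_measurable M"
proof -
  have "(\<lambda>\<omega>. f (A i 0 \<omega>) + progeny_total (progeny_process K T A i \<omega>)) \<in> borel_measurable M"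
    by (intro borel_measurable_add measurable_compose[OF A_measurable f_measurable]
        measurable_compose[OF progeny_measurable progeny_total_measurable])
  then show ?thesis by (subst measurable_cong[OF cluster_total_eq])
qed

text \<open>The characteristic function of the total of a cluster whose parent has mark \<open>a\<close>.\<close>

definition cluster_transform :: "real \<Rightarrow> 'a \<Rightarrow> complex" where
  "cluster_transform u a = iexp (u * f a) * (\<integral>\<mu>. iexp (u * progeny_total \<mu>) \<partial>\<kappa> a)"

lemma progeny_iexp_measurable: "(\<lambda>\<mu>. iexp (u * progeny_total \<mu>)) \<in> borel_measurable Mp"
  by measurable

lemma cluster_transform_measurable: "cluster_transform u \<in> borel_measurable borel"
  unfolding cluster_transform_def
  by (intro borel_measurable_times kernel_integral_measurable progeny_iexp_measurable) measurable

lemma norm_cluster_transform_le: "norm (cluster_transform u a) \<le> 1"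
  unfolding cluster_transform_def norm_mult
  by (intro mult_le_one norm_kernel_integral_le) auto

text \<open>The factors that come from the marks of the parents join the weight \<open>X\<close>; the others are integrated against
the kernels.\<close>

lemma cluster_totals_given_parents:
  assumes X: "X \<in> borel_measurable (parent_sigma M \<Gamma> A)" and X_le: "\<And>\<omega>. norm (X \<omega> :: complex) \<le> 1"
  shows "(\<integral>\<omega>. X \<omega> * (\<Prod>i<n. iexp (u * cluster_total f K A i \<omega>)) \<partial>M) =
    (\<integral>\<omega>. X \<omega> * (\<Prod>i<n. cluster_transform u (A i 0 \<omega>)) \<partial>M)"
proof -
  define X' where "X' \<omega> = X \<omega> * (\<Prod>i<n. iexp (u * f (A i 0 \<omega>)))" for \<omega>
  have "(\<integral>\<omega>. X \<omega> * (\<Prod>i<n. iexp (u * cluster_total f K A i \<omega>)) \<partial>M) =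
      (\<integral>\<omega>. X' \<omega> * (\<Prod>i<n. iexp (u * progeny_total (progeny_process K T A i \<omega>))) \<partial>M)"
    by (intro Bochner_Integration.integral_cong refl)
       (simp add: cluster_total_eq X'_def distrib_left exp_add prod.distrib mult.assoc)
  also have "\<dots> = (\<integral>\<omega>. X' \<omega> * (\<Prod>i<n. (\<integral>\<mu>. iexp (u * progeny_total \<mu>) \<partial>\<kappa> (A i 0 \<omega>))) \<partial>M)"
  proof (rule progeny_functions_law)
    have "(\<lambda>a. iexp (u * f a)) \<in> borel_measurable borel" by measurable
    from measurable_compose[OF parent_sigma_component(2) this]
    show "X' \<in> borel_measurable (parent_sigma M \<Gamma> A)"
      unfolding X'_def by (intro borel_measurable_times X borel_measurable_prod)
    show "norm (X' \<omega>) \<le> 1" for \<omega>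
      unfolding X'_def norm_mult by (intro mult_le_one X_le norm_prod_le_1) auto
  qed (auto intro: progeny_iexp_measurable)
  also have "\<dots> = (\<integral>\<omega>. X \<omega> * (\<Prod>i<n. cluster_transform u (A i 0 \<omega>)) \<partial>M)"
    by (simp add: X'_def cluster_transform_def prod.distrib mult.assoc)
  finally show ?thesis .
qed

lemma char_cluster_total:
  "(\<integral>\<omega>. iexp (u * cluster_total f K A 0 \<omega>) \<partial>M) = (\<integral>a. cluster_transform u a \<partial>Q)"
proof -
  have "(\<integral>\<omega>. iexp (u * cluster_total f K A 0 \<omega>) \<partial>M) = (\<integral>\<omega>. cluster_transform u (A 0 0 \<omega>) \<partial>M)"
    using cluster_totals_given_parents[where X = "\<lambda>_. 1" and n = 1 and u = u] by simp
  also have "\<dots> = (\<integral>a. cluster_transform u a \<partial>distr M borel (A 0 0))"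
    by (rule integral_distr[symmetric, OF A_measurable cluster_transform_measurable])
  finally show ?thesis by (simp only: first_mark_law)
qed

text \<open>The claims of all clusters started by time \<open>t\<close>, whenever they occur.\<close>

definition immigrant_total :: "real \<Rightarrow> 'w \<Rightarrow> real" where
  "immigrant_total t \<omega> = (\<Sum>i<parent_count t \<omega>. cluster_total f K A i \<omega>)"

lemma immigrant_total_measurable [measurable]: "immigrant_total t \<in> borel_measurable M"
  unfolding immigrant_total_def
proof (rule measurable_compose_countable[where f = "\<lambda>n \<omega>. \<Sum>i<n. cluster_total f K A i \<omega>"])
  show "(\<lambda>\<omega>. \<Sum>i<n. cluster_total f K A i \<omega>) \<in> borel_measurable M" for n
    by (intro borel_measurable_sum cluster_total_measurable)
qed (rule parent_count_measurable)

text \<open>Conditionally on the parents, the product of the exponentials has the expectation of a product of cluster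
transforms over the parents; the generating functional of the Poisson process evaluates it. The mean
transform under \<open>Q\<close> is the characteristic function of the total of cluster \<open>0\<close>, because the mark of the first parent
has law \<open>Q\<close>.\<close>

lemma char_immigrant_total:
  assumes t: "0 \<le> t"
  shows "(\<integral>\<omega>. iexp (u * immigrant_total t \<omega>) \<partial>M) =
    exp (of_real (\<nu> * t) * ((\<integral>\<omega>. iexp (u * cluster_total f K A 0 \<omega>) \<partial>M) - 1))"
proof -
  define Y1 where "Y1 n \<omega> = (\<Prod>i<n. iexp (u * cluster_total f K A i \<omega>))" for n \<omega>
  define Y2 where "Y2 n \<omega> = (\<Prod>i<n. cluster_transform u (A i 0 \<omega>))" for n \<omega>
  have "(\<lambda>n. \<integral>\<omega>. of_real (indicator {n} (parent_count t \<omega>)) * Y1 n \<omega> \<partial>M) sums (\<integral>\<omega>. Y1 (parent_count t \<omega>) \<omega> \<partial>M)"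
  proof (rule integral_over_countable_value[OF parent_count_measurable])
    show "Y1 n \<in> borel_measurable M" for n
    proof -
      have "(\<lambda>\<omega>. iexp (u * cluster_total f K A i \<omega>)) \<in> borel_measurable M" for i by measurable
      then show ?thesis unfolding Y1_def by (intro borel_measurable_prod)
    qed
  qed (auto simp: Y1_def intro!: norm_prod_le_1)
  moreover have "(\<lambda>n. \<integral>\<omega>. of_real (indicator {n} (parent_count t \<omega>)) * Y2 n \<omega> \<partial>M) sums (\<integral>\<omega>. Y2 (parent_count t \<omega>) \<omega> \<partial>M)"
  proof (rule integral_over_countable_value[OF parent_count_measurable])
    show "Y2 n \<in> borel_measurable M" for n
      unfolding Y2_def by (intro borel_measurable_prod measurable_compose[OF A_measurable cluster_transform_measurable])
  qed (auto simp: Y2_def intro!: norm_prod_le_1 norm_cluster_transform_le)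
  moreover have "(\<integral>\<omega>. of_real (indicator {n} (parent_count t \<omega>)) * Y1 n \<omega> \<partial>M) =
      (\<integral>\<omega>. of_real (indicator {n} (parent_count t \<omega>)) * Y2 n \<omega> \<partial>M)" for n
    unfolding Y1_def Y2_def
  proof (rule cluster_totals_given_parents)
    have "parent_count t \<in> parent_sigma M \<Gamma> A \<rightarrow>\<^sub>M count_space UNIV"
    proof (rule measurable_card)
      fix i
      show "{\<omega> \<in> space (parent_sigma M \<Gamma> A). i \<in> {i. \<Gamma> i \<omega> \<le> t}} \<in> sets (parent_sigma M \<Gamma> A)"
        using measurable_sets[OF parent_sigma_component(1)[of i], of "{..t}"]
        by (simp add: vimage_def Int_def conj_commute)
    qed
    then have "(\<lambda>\<omega>. indicator {n} (parent_count t \<omega>) :: real) \<in> borel_measurable (parent_sigma M \<Gamma> A)"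
      by (rule indicator_discrete_measurable)
    then show "(\<lambda>\<omega>. complex_of_real (indicator {n} (parent_count t \<omega>))) \<in> borel_measurable (parent_sigma M \<Gamma> A)"
      by (rule measurable_compose) simp
  qed (simp split: split_indicator)
  ultimately have "(\<integral>\<omega>. Y1 (parent_count t \<omega>) \<omega> \<partial>M) = (\<integral>\<omega>. Y2 (parent_count t \<omega>) \<omega> \<partial>M)"
    by (simp add: sums_unique2)
  also have "\<dots> = exp (of_real (\<nu> * t) * ((\<integral>a. cluster_transform u a \<partial>Q) - 1))"
    unfolding Y2_def
    by (rule generating_functional[OF t cluster_transform_measurable norm_cluster_transform_le])
  finally have "(\<integral>\<omega>. Y1 (parent_count t \<omega>) \<omega> \<partial>M) =
      exp (of_real (\<nu> * t) * ((\<integral>a. cluster_transform u a \<partial>Q) - 1))" .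
  moreover have "iexp (u * immigrant_total t \<omega>) = Y1 (parent_count t \<omega>) \<omega>" for \<omega>
    by (simp add: Y1_def immigrant_total_def exp_sum sum_distrib_left)
  ultimately show ?thesis by (simp only: char_cluster_total)
qed

end

end

section \<open>Total claim and residue\<close>

text \<open>If the family is not summable, the left-hand side is \<open>0\<close> by convention, and so is the real value of
\<open>\<infinity>\<close>.\<close>

lemma infsum_nonneg_eq_enn2real:
  fixes g :: "'i \<Rightarrow> real"
  assumes nonneg: "\<And>x. 0 \<le> g x"
  shows "infsum g S = enn2real (\<integral>\<^sup>+x. ennreal (g x) \<partial>count_space S)"
proof -
  have "infsum g S = (\<integral>x. g x \<partial>count_space S)"
  proof (cases "g summable_on S")
    case True
    then have "Infinite_Set_Sum.abs_summable_on g S"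
      using abs_summable_equivalent[of g S] summable_on_iff_abs_summable_on_real[of g S] by simp
    from infsetsum_infsum[OF this] show ?thesis by (simp add: infsetsum_def)
  next
    case False
    then have "\<not> Infinite_Set_Sum.abs_summable_on g S"
      using abs_summable_equivalent[of g S] summable_on_iff_abs_summable_on_real[of g S] by simp
    then have "(\<integral>x. g x \<partial>count_space S) = 0"
      unfolding Infinite_Set_Sum.abs_summable_on_def by (rule not_integrable_integral_eq)
    with False show ?thesis by (simp add: infsum_not_exists)
  qed
  also have "\<dots> = enn2real (\<integral>\<^sup>+x. ennreal (g x) \<partial>count_space S)"
    using nonneg by (intro integral_eq_nn_integral) auto
  finally show ?thesis .
qed

text \<open>Writing the sum over the random index set as a double series with indicators makes measurability evident, on
the whole space and not only where the set is finite.\<close>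

lemma nn_integral_random_index_set_measurable:
  fixes P :: "nat \<Rightarrow> nat \<Rightarrow> 'w \<Rightarrow> bool" and g :: "nat \<Rightarrow> nat \<Rightarrow> 'w \<Rightarrow> ennreal"
  assumes P: "\<And>i j. {\<omega>\<in>space M. P i j \<omega>} \<in> sets M" and g: "\<And>i j. g i j \<in> borel_measurable M"
  shows "(\<lambda>\<omega>. \<integral>\<^sup>+(i, j). g i j \<omega> \<partial>count_space {(i, j). P i j \<omega>}) \<in> borel_measurable M"
proof -
  have "(\<integral>\<^sup>+(i, j). g i j \<omega> \<partial>count_space {(i, j). P i j \<omega>}) = (\<Sum>i. \<Sum>j. if P i j \<omega> then g i j \<omega> else 0)" for \<omega>
  proof -
    have "(\<integral>\<^sup>+(i, j). g i j \<omega> \<partial>count_space {(i, j). P i j \<omega>}) =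
        (\<integral>\<^sup>+p. (case p of (i, j) \<Rightarrow> if P i j \<omega> then g i j \<omega> else 0) \<partial>count_space UNIV)"
      by (subst nn_integral_count_space_indicator, simp, intro nn_integral_cong) (auto split: split_indicator)
    also have "\<dots> = (\<integral>\<^sup>+i. \<integral>\<^sup>+j. (if P i j \<omega> then g i j \<omega> else 0) \<partial>count_space UNIV \<partial>count_space UNIV)"
      by (subst nn_integral_fst_count_space[symmetric]) simp
    also have "\<dots> = (\<Sum>i. \<Sum>j. if P i j \<omega> then g i j \<omega> else 0)"
      by (simp add: nn_integral_count_space_nat)
    finally show ?thesis .
  qed
  moreover have "(\<lambda>\<omega>. if P i j \<omega> then g i j \<omega> else 0) \<in> borel_measurable M" for i j
    using P g by (intro measurable_If) auto
  ultimately show ?thesis by (simp add: borel_measurable_suminf)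
qed

context marked_poisson_cluster
begin

context
  fixes f :: "'a \<Rightarrow> real"
  assumes f_measurable: "f \<in> borel_measurable borel" and f_nonneg: "\<And>s. 0 \<le> f s"
begin

definition claims_before :: "real \<Rightarrow> 'w \<Rightarrow> (nat \<times> nat) set" where
  "claims_before t \<omega> = {(i, j). j \<le> K i \<omega> \<and> \<Gamma> i \<omega> + T i j \<omega> \<le> t}"

definition claims_after :: "real \<Rightarrow> 'w \<Rightarrow> (nat \<times> nat) set" where
  "claims_after t \<omega> = {(i, j). 0 \<le> \<Gamma> i \<omega> \<and> \<Gamma> i \<omega> \<le> t \<and> t < \<Gamma> i \<omega> + T i j \<omega> \<and> 1 \<le> j \<and> j \<le> K i \<omega>}"

lemma point_nonneg:
  assumes "\<omega> \<in> space M" "j \<le> K i \<omega>"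
  shows "0 \<le> T i j \<omega>"
  using assms T_nonneg[of \<omega> j i] T_parent[of \<omega> i] by (cases "j = 0") auto

text \<open>Like the residue below, the total claim is a sum of nonnegative terms over a random set of indices. If the sum
is infinite, the Bochner integral and the real value of \<open>\<infinity>\<close> are both \<open>0\<close>.\<close>

lemma total_claim_eq:
  assumes \<omega>: "\<omega> \<in> space M"
  shows "total_claim f (cluster_process \<Gamma> K T A \<omega>) t =
    enn2real (\<integral>\<^sup>+(i, j). ennreal (f (A i j \<omega>)) \<partial>count_space (claims_before t \<omega>))"
proof -
  let ?N = "cluster_process \<Gamma> K T A \<omega>" and ?S = "SIGMA i:UNIV. {0..K i \<omega>}"
  let ?x = "\<lambda>(i, j). (\<Gamma> i \<omega> + T i j \<omega>, A i j \<omega>)"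
  let ?g = "\<lambda>p::real \<times> 'a. indicator ({0..t} \<times> UNIV) p * ennreal (f (snd p))"
  have x: "?x p \<in> space state_space" if "p \<in> ?S" for p
    using that \<omega> by (auto simp: space_state_space intro!: add_nonneg_nonneg \<Gamma>_nonneg point_nonneg)
  have N: "sets ?N = sets state_space" by (simp add: cluster_process_def)
  have B: "({0..t} \<times> UNIV :: (real \<times> 'a) set) \<in> sets state_space" by (rule Times_in_state_space) auto
  have g: "?g \<in> borel_measurable state_space"
    using B mark_functional_measurable[OF f_measurable f_nonneg]
    by (intro borel_measurable_times_ennreal borel_measurable_indicator)
  have fm: "(\<lambda>p. f (snd p)) \<in> borel_measurable state_space"
    using borel_measurable_enn2real[OF mark_functional_measurable[OF f_measurable f_nonneg]]
    by (simp add: f_nonneg)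
  have "total_claim f ?N t = enn2real (\<integral>\<^sup>+p. ennreal (indicator ({0..t} \<times> UNIV) p *\<^sub>R f (snd p)) \<partial>?N)"
    unfolding total_claim_def set_lebesgue_integral_def
  proof (rule integral_eq_nn_integral)
    have "(\<lambda>p. indicator ({0..t} \<times> UNIV) p *\<^sub>R f (snd p)) \<in> borel_measurable state_space"
      using B fm by (intro borel_measurable_scaleR borel_measurable_indicator)
    then show "(\<lambda>p. indicator ({0..t} \<times> UNIV) p *\<^sub>R f (snd p)) \<in> borel_measurable ?N"
      by (subst measurable_cong_sets[OF N refl])
  qed (simp add: f_nonneg)
  also have "(\<integral>\<^sup>+p. ennreal (indicator ({0..t} \<times> UNIV) p *\<^sub>R f (snd p)) \<partial>?N) = (\<integral>\<^sup>+p. ?g p \<partial>?N)"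
    by (intro nn_integral_cong) (auto split: split_indicator)
  also have "\<dots> = (\<integral>\<^sup>+p. ?g (?x p) \<partial>count_space ?S)"
    unfolding cluster_process_def by (rule nn_integral_dirac_sum[OF x g])
  also have "\<dots> = (\<integral>\<^sup>+p. (\<lambda>(i, j). ennreal (f (A i j \<omega>))) p * indicator (claims_before t \<omega>) p \<partial>count_space UNIV)"
    using x
    by (subst nn_integral_count_space_indicator, simp, intro nn_integral_cong)
       (auto simp: claims_before_def space_state_space split: split_indicator prod.splits)
  also have "\<dots> = (\<integral>\<^sup>+(i, j). ennreal (f (A i j \<omega>)) \<partial>count_space (claims_before t \<omega>))"
    by (subst nn_integral_count_space_indicator) simp_all
  finally show ?thesis .
qed

lemma residue_eq:
  "residue f \<Gamma> K T A t \<omega> = enn2real (\<integral>\<^sup>+(i, j). ennreal (f (A i j \<omega>)) \<partial>count_space (claims_after t \<omega>))"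
  unfolding residue_def claims_after_def[symmetric]
  by (subst infsum_nonneg_eq_enn2real) (auto simp: f_nonneg case_prod_beta')

lemma mark_value_measurable: "(\<lambda>\<omega>. ennreal (f (A i j \<omega>))) \<in> borel_measurable M"
  using measurable_compose[OF A_measurable f_measurable] by (rule measurable_compose) simp

lemma total_claim_measurable: "(\<lambda>\<omega>. total_claim f (cluster_process \<Gamma> K T A \<omega>) t) \<in> borel_measurable M"
proof -
  have "(\<lambda>\<omega>. enn2real (\<integral>\<^sup>+(i, j). ennreal (f (A i j \<omega>)) \<partial>count_space (claims_before t \<omega>))) \<in> borel_measurable M"
    unfolding claims_before_def
    by (intro borel_measurable_enn2real nn_integral_random_index_set_measurable mark_value_measurable)
       measurable
  then show ?thesis by (subst measurable_cong[OF total_claim_eq])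
qed

lemma residue_measurable: "residue f \<Gamma> K T A t \<in> borel_measurable M"
proof -
  have "(\<lambda>\<omega>. enn2real (\<integral>\<^sup>+(i, j). ennreal (f (A i j \<omega>)) \<partial>count_space (claims_after t \<omega>))) \<in> borel_measurable M"
    unfolding claims_after_def
    by (intro borel_measurable_enn2real nn_integral_random_index_set_measurable mark_value_measurable)
       measurable
  then show ?thesis by (subst measurable_cong[OF residue_eq])
qed

text \<open>A claim of a cluster started by time \<open>t\<close> occurs either by time \<open>t\<close> or later. As delays are
nonnegative, every claim up to time \<open>t\<close> belongs to such a cluster, and as the parent has delay \<open>0\<close>, the later
claims have \<open>j \<ge> 1\<close>.\<close>

lemma total_claim_plus_residue:
  assumes \<omega>: "\<omega> \<in> space M" and fin: "finite {i. \<Gamma> i \<omega> \<le> t}"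
  shows "total_claim f (cluster_process \<Gamma> K T A \<omega>) t + residue f \<Gamma> K T A t \<omega> = immigrant_total f t \<omega>"
proof -
  let ?g = "\<lambda>(i, j). f (A i j \<omega>)"
  define S where "S = (SIGMA i:{i. \<Gamma> i \<omega> \<le> t}. {0..K i \<omega>})"
  have S: "finite S" unfolding S_def using fin by (intro finite_SigmaI) auto
  have union: "S = claims_before t \<omega> \<union> claims_after t \<omega>"
  proof (intro set_eqI iffI)
    fix p assume "p \<in> S"
    then obtain i j where p: "p = (i, j)" "\<Gamma> i \<omega> \<le> t" "j \<le> K i \<omega>" by (auto simp: S_def)
    show "p \<in> claims_before t \<omega> \<union> claims_after t \<omega>"
      using p \<omega> \<Gamma>_nonneg[OF \<omega>, of i] T_parent[OF \<omega>, of i]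
      by (cases "j = 0") (auto simp: claims_before_def claims_after_def)
  next
    fix p assume "p \<in> claims_before t \<omega> \<union> claims_after t \<omega>"
    then obtain i j where p: "p = (i, j)" "j \<le> K i \<omega>" "\<Gamma> i \<omega> \<le> t \<or> \<Gamma> i \<omega> + T i j \<omega> \<le> t"
      by (auto simp: claims_before_def claims_after_def)
    then show "p \<in> S" using point_nonneg[OF \<omega> p(2)] by (auto simp: S_def)
  qed
  have disj: "claims_before t \<omega> \<inter> claims_after t \<omega> = {}"
    by (auto simp: claims_before_def claims_after_def)
  have sum_eq: "enn2real (\<integral>\<^sup>+(i, j). ennreal (f (A i j \<omega>)) \<partial>count_space R) = sum ?g R" if "R \<subseteq> S" for R
  proof -
    have "(\<integral>\<^sup>+(i, j). ennreal (f (A i j \<omega>)) \<partial>count_space R) = (\<Sum>p\<in>R. ennreal (?g p))"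
      using finite_subset[OF that S]
      by (subst nn_integral_count_space_finite) (auto simp: case_prod_beta')
    also have "\<dots> = ennreal (sum ?g R)" by (rule sum_ennreal) (auto simp: f_nonneg)
    finally show ?thesis by (simp add: sum_nonneg f_nonneg case_prod_beta')
  qed
  have "total_claim f (cluster_process \<Gamma> K T A \<omega>) t + residue f \<Gamma> K T A t \<omega> =
      sum ?g (claims_before t \<omega>) + sum ?g (claims_after t \<omega>)"
    unfolding total_claim_eq[OF \<omega>] residue_eq using union by (intro arg_cong2[where f = "(+)"] sum_eq) auto
  also have "\<dots> = sum ?g S"
    unfolding union using S disj union by (intro sum.union_disjoint[symmetric]) auto
  also have "\<dots> = (\<Sum>i\<in>{i. \<Gamma> i \<omega> \<le> t}. \<Sum>j=0..K i \<omega>. f (A i j \<omega>))"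
    unfolding S_def using fin by (subst sum.Sigma) auto
  also have "\<dots> = immigrant_total f t \<omega>"
    unfolding immigrant_total_def[OF f_measurable f_nonneg] cluster_total_def by (subst parents_before_eq[OF \<omega> fin]) simp
  finally show ?thesis .
qed

end

end

section \<open>Convergence of the normalized claims\<close>

text \<open>Slow variation gives positivity only for large arguments; monotonicity of the tail extends it to all.\<close>

lemma regularly_varying_tail_of_rv:
  assumes "prob_space M" and Z: "regularly_varying_rv M \<alpha> Z"
  shows "regularly_varying_tail (\<lambda>x. measure (distr M borel Z) {x<..}) \<alpha>"
proof -
  interpret prob_space M by fact
  have Zm: "Z \<in> borel_measurable M" using Z by (simp add: regularly_varying_rv_def)
  interpret D: real_distribution "distr M borel Z" using Zm by (rule real_distribution_distr)
  define F where "F x = measure (distr M borel Z) {x<..}" for x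
  obtain l where l: "eventually (\<lambda>x. 0 < l x) at_top" "\<And>c. 0 < c \<Longrightarrow> ((\<lambda>x. l (c * x) / l x) \<longlongrightarrow> 1) at_top"
    and tail: "\<And>x. 0 < x \<Longrightarrow> prob {\<omega>\<in>space M. Z \<omega> > x} = x powr (- \<alpha>) * l x"
    using Z by (auto simp: regularly_varying_rv_def slowly_varying_def)
  have F: "F x = x powr (- \<alpha>) * l x" if "0 < x" for x
    using tail[OF that] Zm by (simp add: F_def measure_distr vimage_def Int_def conj_commute)
  have anti: "F y \<le> F x" if "x \<le> y" for x y
    unfolding F_def using that by (intro D.finite_measure_mono) auto
  have ev0: "eventually (\<lambda>x::real. 0 < x) at_top" by (rule eventually_gt_at_top)
  show ?thesis
    unfolding F_def[symmetric]
  proof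
    show "F y \<le> F x" if "x \<le> y" for x y using that by (rule anti)
    show "F x \<le> 1" for x unfolding F_def by (rule D.prob_le_1)
    show "0 < F x" for x
    proof -
      have "eventually (\<lambda>y. 0 < l y \<and> 0 < y \<and> x \<le> y) at_top"
        using l(1) ev0 eventually_ge_at_top[of x] by eventually_elim auto
      then obtain y where y: "0 < l y" "0 < y" "x \<le> y"
        using eventually_happens'[OF trivial_limit_at_top_linorder] by blast
      then have "0 < F y" by (simp add: F)
      with anti[OF y(3)] show ?thesis by simp
    qed
    fix c :: real assume c: "0 < c"
    have "((\<lambda>x. c powr (- \<alpha>) * (l (c * x) / l x)) \<longlongrightarrow> c powr (- \<alpha>) * 1) at_top"
      by (intro tendsto_intros l c)
    moreover have "eventually (\<lambda>x. c powr (- \<alpha>) * (l (c * x) / l x) = F (c * x) / F x) at_top"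
      using ev0 by eventually_elim (use c in \<open>simp add: F powr_mult\<close>)
    ultimately show "((\<lambda>x. F (c * x) / F x) \<longlongrightarrow> c powr (- \<alpha>)) at_top"
      by (simp add: tendsto_cong)
  qed
qed

text \<open>Levy's continuity theorem along every sequence of times that tends to infinity.\<close>

lemma converges_in_distribution_of_char:
  assumes "prob_space M" and Z: "\<And>t. Z t \<in> borel_measurable M" and G: "real_distribution G"
    and lim: "\<And>u. ((\<lambda>t. \<integral>\<omega>. iexp (u * Z t \<omega>) \<partial>M) \<longlongrightarrow> char G u) at_top"
  shows "converges_in_distribution M Z G"
  unfolding converges_in_distribution_def
proof (intro conjI allI impI Z)
  interpret prob_space M by fact
  fix x assume x: "isCont (cdf G) x"
  show "((\<lambda>t. cdf (distr M borel (Z t)) x) \<longlongrightarrow> cdf G x) at_top"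
  proof (rule tendsto_at_topI_sequentially)
    fix s :: "nat \<Rightarrow> real" assume s: "filterlim s at_top sequentially"
    have "weak_conv_m (\<lambda>n. distr M borel (Z (s n))) G"
    proof (rule levy_continuity[OF _ G])
      show "real_distribution (distr M borel (Z (s n)))" for n using Z by (rule real_distribution_distr)
      fix u
      have "char (distr M borel (Z (s n))) u = (\<integral>\<omega>. iexp (u * Z (s n) \<omega>) \<partial>M)" for n
        unfolding char_def using Z by (subst integral_distr) auto
      then show "(\<lambda>n. char (distr M borel (Z (s n))) u) \<longlonglongrightarrow> char G u"
        using filterlim_compose[OF lim[of u] s] by simp
    qed
    then show "(\<lambda>n. cdf (distr M borel (Z (s n))) x) \<longlonglongrightarrow> cdf G x"
      using x by (simp add: weak_conv_m_def weak_conv_def)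
  qed
qed

text \<open>Where the variables differ by at most \<open>\<delta>\<close> the exponentials differ by at most \<open>\<bar>u\<bar> \<delta>\<close>, and
elsewhere by at most \<open>2\<close>.\<close>

lemma (in prob_space) char_perturbation:
  assumes [measurable]: "Y \<in> borel_measurable M" "Z \<in> borel_measurable M" and \<delta>: "0 \<le> \<delta>"
  shows "norm ((\<integral>\<omega>. iexp (u * Y \<omega>) \<partial>M) - (\<integral>\<omega>. iexp (u * Z \<omega>) \<partial>M)) \<le>
    \<bar>u\<bar> * \<delta> + 2 * prob {\<omega>\<in>space M. \<bar>Y \<omega> - Z \<omega>\<bar> > \<delta>}"
proof -
  let ?B = "{\<omega>\<in>space M. \<bar>Y \<omega> - Z \<omega>\<bar> > \<delta>}"
  have B: "?B \<in> sets M" by measurable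
  have intY: "integrable M (\<lambda>\<omega>. iexp (u * Y \<omega>))" and intZ: "integrable M (\<lambda>\<omega>. iexp (u * Z \<omega>))"
    by (auto intro!: integrable_iexp)
  have intB: "integrable M (\<lambda>\<omega>. \<bar>u\<bar> * \<delta> + 2 * indicator ?B \<omega>)"
    using B by (intro Bochner_Integration.integrable_add integrable_const integrable_mult_right integrable_real_indicator)
      (auto simp: emeasure_eq_measure)
  have "norm ((\<integral>\<omega>. iexp (u * Y \<omega>) \<partial>M) - (\<integral>\<omega>. iexp (u * Z \<omega>) \<partial>M)) =
      norm (\<integral>\<omega>. iexp (u * Y \<omega>) - iexp (u * Z \<omega>) \<partial>M)"
    using intY intZ by simp
  also have "\<dots> \<le> (\<integral>\<omega>. norm (iexp (u * Y \<omega>) - iexp (u * Z \<omega>)) \<partial>M)"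
    by (rule integral_norm_bound)
  also have "\<dots> \<le> (\<integral>\<omega>. \<bar>u\<bar> * \<delta> + 2 * indicator ?B \<omega> \<partial>M)"
  proof (rule integral_mono)
    fix \<omega> assume \<omega>: "\<omega> \<in> space M"
    define d where "d = u * (Y \<omega> - Z \<omega>)"
    have "iexp (u * Y \<omega>) - iexp (u * Z \<omega>) = iexp (u * Z \<omega>) * (iexp d - 1)"
      by (simp add: d_def algebra_simps flip: exp_add)
    then have "norm (iexp (u * Y \<omega>) - iexp (u * Z \<omega>)) = norm (iexp d - 1)"
      by (simp add: norm_mult)
    then have le: "norm (iexp (u * Y \<omega>) - iexp (u * Z \<omega>)) \<le> 2"
      "norm (iexp (u * Y \<omega>) - iexp (u * Z \<omega>)) \<le> \<bar>u\<bar> * \<bar>Y \<omega> - Z \<omega>\<bar>"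
      using iexp_approx1[of d 0] iexp_approx2[of d 0] by (auto simp: d_def abs_mult)
    have u\<delta>: "0 \<le> \<bar>u\<bar> * \<delta>" using \<delta> by simp
    show "norm (iexp (u * Y \<omega>) - iexp (u * Z \<omega>)) \<le> \<bar>u\<bar> * \<delta> + 2 * indicator ?B \<omega>"
    proof (cases "\<omega> \<in> ?B")
      case True
      then have "indicator ?B \<omega> = (1 :: real)" by (rule indicator_simps)
      with le(1) u\<delta> show ?thesis by linarith
    next
      case False
      then have "\<bar>u\<bar> * \<bar>Y \<omega> - Z \<omega>\<bar> \<le> \<bar>u\<bar> * \<delta>"
        using \<omega> by (intro mult_left_mono) auto
      moreover have "indicator ?B \<omega> = (0 :: real)" using False by (rule indicator_simps)
      ultimately show ?thesis using le(2) by linarith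
    qed
  qed (use intY intZ intB in auto)
  also have "\<dots> = \<bar>u\<bar> * \<delta> + 2 * prob ?B"
  proof -
    have "integrable M (\<lambda>\<omega>. 2 * indicator ?B \<omega> :: real)"
      using B by (intro integrable_mult_right integrable_real_indicator) (auto simp: emeasure_eq_measure)
    then show ?thesis using B prob_space by simp
  qed
  finally show ?thesis .
qed

context regularly_varying_tail
begin

text \<open>With \<open>F\<close> the tail, \<open>t F(a\<^bsub>\<lfloor>t\<rfloor>\<^esub>)\<close> tends to \<open>1\<close> and \<open>t F(C a\<^bsub>\<lfloor>\<nu> t\<rfloor>\<^esub>)\<close> to
\<open>C\<^bsup>-\<alpha>\<^esup> / \<nu>\<close>. If \<open>C\<close> makes the second limit \<open>1 / 4\<close>, the tail is eventually smaller at
\<open>C a\<^bsub>\<lfloor>\<nu> t\<rfloor>\<^esub>\<close> than at \<open>a\<^bsub>\<lfloor>t\<rfloor>\<^esub>\<close>, and a decreasing function orders the arguments the other way.\<close>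

lemma norming_sequence_ratio_bounded:
  fixes a :: "nat \<Rightarrow> real" and \<nu> :: real
  assumes \<nu>: "0 < \<nu>" and \<alpha>: "0 < \<alpha>"
    and a: "filterlim a at_top sequentially" and na: "(\<lambda>n. real n * F (a n)) \<longlonglongrightarrow> 1"
  obtains C where "0 < C" "eventually (\<lambda>t. a (nat \<lfloor>t\<rfloor>) \<le> C * a (nat \<lfloor>\<nu> * t\<rfloor>)) at_top"
proof -
  define C where "C = (\<nu> / 4) powr (- 1 / \<alpha>)"
  have C: "0 < C" "C powr (- \<alpha>) = \<nu> / 4" using \<nu> \<alpha> by (auto simp: C_def powr_powr)
  have floor1: "filterlim (\<lambda>t::real. nat \<lfloor>t\<rfloor>) at_top at_top" by real_asymp
  have floor\<nu>: "filterlim (\<lambda>t::real. nat \<lfloor>\<nu> * t\<rfloor>) at_top at_top" using \<nu> by real_asymp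
  have "((\<lambda>t. (t / real (nat \<lfloor>t\<rfloor>)) * (real (nat \<lfloor>t\<rfloor>) * F (a (nat \<lfloor>t\<rfloor>)))) \<longlongrightarrow> 1 * 1) at_top"
  proof (rule tendsto_mult)
    show "((\<lambda>t::real. t / real (nat \<lfloor>t\<rfloor>)) \<longlongrightarrow> 1) at_top" by real_asymp
  qed (rule filterlim_compose[OF na floor1])
  then have "eventually (\<lambda>t. 1 / 2 < (t / real (nat \<lfloor>t\<rfloor>)) * (real (nat \<lfloor>t\<rfloor>) * F (a (nat \<lfloor>t\<rfloor>)))) at_top"
    by (rule order_tendstoD) simp
  moreover have "((\<lambda>t. (t / real (nat \<lfloor>\<nu> * t\<rfloor>)) * (real (nat \<lfloor>\<nu> * t\<rfloor>) * F (a (nat \<lfloor>\<nu> * t\<rfloor>) * C))) \<longlongrightarrow>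
      1 / \<nu> * C powr (- \<alpha>)) at_top"
  proof (rule tendsto_mult)
    show "((\<lambda>t::real. t / real (nat \<lfloor>\<nu> * t\<rfloor>)) \<longlongrightarrow> 1 / \<nu>) at_top" using \<nu> by real_asymp (simp add: inverse_eq_divide)
  qed (rule filterlim_compose[OF scaled_tail_tendsto[OF a na C(1)] floor\<nu>])
  then have "eventually (\<lambda>t. (t / real (nat \<lfloor>\<nu> * t\<rfloor>)) * (real (nat \<lfloor>\<nu> * t\<rfloor>) * F (a (nat \<lfloor>\<nu> * t\<rfloor>) * C)) < 1 / 2) at_top"
    by (rule order_tendstoD) (use \<nu> C in simp)
  moreover have "eventually (\<lambda>t::real. 0 < nat \<lfloor>t\<rfloor>) at_top"
    by (rule eventually_compose_filterlim[OF eventually_gt_at_top floor1])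
  moreover have "eventually (\<lambda>t. 0 < nat \<lfloor>\<nu> * t\<rfloor>) at_top"
    by (rule eventually_compose_filterlim[OF eventually_gt_at_top floor\<nu>])
  moreover have "eventually (\<lambda>t::real. 0 < t) at_top" by (rule eventually_gt_at_top)
  ultimately have "eventually (\<lambda>t. a (nat \<lfloor>t\<rfloor>) \<le> C * a (nat \<lfloor>\<nu> * t\<rfloor>)) at_top"
  proof eventually_elim
    case (elim t)
    have cancel: "(t / real n) * (real n * z) = t * z" if "0 < n" for n z
      using that by simp
    note elim(2,1)[unfolded cancel[OF elim(3)] cancel[OF elim(4)]]
    then have "t * F (a (nat \<lfloor>\<nu> * t\<rfloor>) * C) < t * F (a (nat \<lfloor>t\<rfloor>))" by (rule less_trans)
    then have "F (a (nat \<lfloor>\<nu> * t\<rfloor>) * C) < F (a (nat \<lfloor>t\<rfloor>))" using elim by simp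
    then have "\<not> a (nat \<lfloor>\<nu> * t\<rfloor>) * C \<le> a (nat \<lfloor>t\<rfloor>)" using antimono by (meson not_less)
    then show ?case by (simp add: mult.commute)
  qed
  with C(1) show thesis by (rule that)
qed

end

text \<open>The exponent of the centred and scaled compound Poisson sum. Replacing \<open>\<nu> t\<close> by its integer part costs a
factor that tends to \<open>1\<close>.\<close>

lemma compound_poisson_exponent_tendsto:
  fixes a :: "nat \<Rightarrow> real"
  assumes \<mu>: "real_distribution \<mu>" and nonneg: "AE y in \<mu>. 0 \<le> y"
    and F: "regularly_varying_tail (\<lambda>x. measure \<mu> {x<..}) \<alpha>" and \<alpha>: "1 < \<alpha>" "\<alpha> < 2" and \<nu>: "0 < \<nu>"
    and a: "filterlim a at_top sequentially" and na: "(\<lambda>n. real n * measure \<mu> {a n<..}) \<longlonglongrightarrow> 1"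
  shows "((\<lambda>t. of_real (\<nu> * t) * (char \<mu> (u / a (nat \<lfloor>\<nu> * t\<rfloor>)) - 1 -
      \<i> * (u / a (nat \<lfloor>\<nu> * t\<rfloor>)) * (\<integral>y. y \<partial>\<mu>))) \<longlongrightarrow> stable_exponent \<alpha> u) at_top"
proof -
  interpret F: regularly_varying_tail "\<lambda>x. measure \<mu> {x<..}" \<alpha> by fact
  have int: "integrable \<mu> (\<lambda>y. y)" by (rule integrable_of_regularly_varying_tail[OF \<mu> nonneg F \<alpha>(1)])
  define c where "c n = real n *\<^sub>R (\<integral>x. (indicator {0<..} x * measure \<mu> {a n * x<..}) *\<^sub>R stable_kernel u x \<partial>lborel)" for n
  have c: "c \<longlonglongrightarrow> stable_exponent \<alpha> u"
    unfolding c_def by (rule F.scaled_tail_integral_tendsto[OF \<alpha> a na])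
  have floor\<nu>: "filterlim (\<lambda>t::real. nat \<lfloor>\<nu> * t\<rfloor>) at_top at_top" using \<nu> by real_asymp
  have "((\<lambda>t. (\<nu> * t / real (nat \<lfloor>\<nu> * t\<rfloor>)) *\<^sub>R c (nat \<lfloor>\<nu> * t\<rfloor>)) \<longlongrightarrow> 1 *\<^sub>R stable_exponent \<alpha> u) at_top"
  proof (rule tendsto_scaleR)
    show "((\<lambda>t. \<nu> * t / real (nat \<lfloor>\<nu> * t\<rfloor>)) \<longlongrightarrow> 1) at_top" using \<nu> by real_asymp
  qed (rule filterlim_compose[OF c floor\<nu>])
  moreover have "eventually (\<lambda>n. 0 < a n \<and> 0 < n) sequentially"
    using a eventually_gt_at_top[of "0::nat"] by (intro eventually_conj) (simp_all add: filterlim_at_top_dense)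
  from eventually_compose_filterlim[OF this floor\<nu>]
  have "eventually (\<lambda>t. (\<nu> * t / real (nat \<lfloor>\<nu> * t\<rfloor>)) *\<^sub>R c (nat \<lfloor>\<nu> * t\<rfloor>) =
      of_real (\<nu> * t) * (char \<mu> (u / a (nat \<lfloor>\<nu> * t\<rfloor>)) - 1 -
        \<i> * (u / a (nat \<lfloor>\<nu> * t\<rfloor>)) * (\<integral>y. y \<partial>\<mu>))) at_top"
  proof eventually_elim
    case (elim t)
    define n where "n = nat \<lfloor>\<nu> * t\<rfloor>"
    have n: "0 < a n" "0 < n" using elim by (simp_all only: n_def)
    show ?case
      unfolding n_def[symmetric] char_scaled_tail_formula[OF \<mu> nonneg int n(1)] c_def
      using n(2) by (simp add: scaleR_conv_of_real)
  qed
  ultimately show ?thesis by (simp add: tendsto_cong)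
qed

theorem proposition4p1:
  fixes M :: "'w measure" and M' :: "'d measure"
    and \<nu> \<alpha> :: real
    and Q :: "'a::polish_space measure"
    and \<kappa> :: "'a \<Rightarrow> (real \<times> 'a) measure measure"
    and \<Gamma> :: "nat \<Rightarrow> 'w \<Rightarrow> real" and K :: "nat \<Rightarrow> 'w \<Rightarrow> nat"
    and T :: "nat \<Rightarrow> nat \<Rightarrow> 'w \<Rightarrow> real" and A :: "nat \<Rightarrow> nat \<Rightarrow> 'w \<Rightarrow> 'a"
    and f :: "'a \<Rightarrow> real" and D :: "'d \<Rightarrow> real" and a :: "nat \<Rightarrow> real"
  assumes "marked_poisson_cluster M \<nu> Q \<kappa> \<Gamma> K T A"
    and "f \<in> borel_measurable borel" and "\<And>s. 0 \<le> f s"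
    and "1 < \<alpha>" and "\<alpha> < 2"
    and "\<And>i. regularly_varying_rv M \<alpha> (cluster_total f K A i)"
    and "prob_space M'" and "D \<in> borel_measurable M'"
    and "distr M' borel D = distr M borel (cluster_total f K A 0)"
    and "filterlim a at_top sequentially"
    and "(\<lambda>n. real n * measure M' {\<omega>\<in>space M'. D \<omega> > a n}) \<longlonglongrightarrow> 1"
    and "small_o_in_prob M (residue f \<Gamma> K T A) (\<lambda>t. a (nat \<lfloor>t\<rfloor>))"
  shows "\<exists>G. stable_law \<alpha> G \<and>
    converges_in_distribution M
      (\<lambda>t \<omega>. (total_claim f (cluster_process \<Gamma> K T A \<omega>) t - t * \<nu> * integral\<^sup>L M' D)
               / a (nat \<lfloor>\<nu> * t\<rfloor>)) G"
proof -
  interpret C: marked_poisson_cluster M \<nu> Q \<kappa> \<Gamma> K T A by fact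
  note fm = assms(2,3) and \<alpha> = assms(4,5) and a = assms(10)
  define \<mu> where "\<mu> = distr M borel (cluster_total f K A 0)"
  define m where "m = integral\<^sup>L M' D"
  define b where "b t = a (nat \<lfloor>\<nu> * t\<rfloor>)" for t
  define Z where "Z t \<omega> = (total_claim f (cluster_process \<Gamma> K T A \<omega>) t - t * \<nu> * m) / b t" for t \<omega>
  define Y where "Y t \<omega> = (C.immigrant_total f t \<omega> - t * \<nu> * m) / b t" for t \<omega>
  have Dm: "cluster_total f K A 0 \<in> borel_measurable M" by (rule C.cluster_total_measurable[OF fm])
  have \<mu>: "real_distribution \<mu>" unfolding \<mu>_def using Dm by (rule C.real_distribution_distr)
  have nonneg: "AE y in \<mu>. 0 \<le> y"
    unfolding \<mu>_def using Dm assms(3) by (subst AE_distr_iff) (auto simp: cluster_total_def sum_nonneg)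
  have F: "regularly_varying_tail (\<lambda>x. measure \<mu> {x<..}) \<alpha>"
    unfolding \<mu>_def by (rule regularly_varying_tail_of_rv[OF C.prob_space_axioms assms(6)])
  interpret F: regularly_varying_tail "\<lambda>x. measure \<mu> {x<..}" \<alpha> by (rule F)
  have m: "m = (\<integral>y. y \<partial>\<mu>)"
    unfolding m_def \<mu>_def assms(9)[symmetric] using assms(8) by (subst integral_distr) auto
  have na: "(\<lambda>n. real n * measure \<mu> {a n<..}) \<longlonglongrightarrow> 1"
    using assms(8,11) unfolding \<mu>_def assms(9)[symmetric]
    by (simp add: measure_distr vimage_def Int_def conj_commute)
  have Ym: "Y t \<in> borel_measurable M" for t
    unfolding Y_def using C.immigrant_total_measurable[OF fm] by measurable
  have Zm: "Z t \<in> borel_measurable M" for t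
    unfolding Z_def using C.total_claim_measurable[OF fm] by measurable
  have floor\<nu>: "filterlim (\<lambda>t::real. nat \<lfloor>\<nu> * t\<rfloor>) at_top at_top" using C.nu_pos by real_asymp
  have b_top: "filterlim b at_top at_top" unfolding b_def by (rule filterlim_compose[OF a floor\<nu>])
  have char_D: "char \<mu> u = (\<integral>\<omega>. iexp (u * cluster_total f K A 0 \<omega>) \<partial>M)" for u
    unfolding char_def \<mu>_def using Dm by (subst integral_distr) auto

  \<comment> \<open>The immigrant claims: the centring is absorbed into the compound Poisson exponent.\<close>
  have char_Y: "((\<lambda>t. \<integral>\<omega>. iexp (u * Y t \<omega>) \<partial>M) \<longlongrightarrow> exp (stable_exponent \<alpha> u)) at_top" for u
  proof -
    have "((\<lambda>t. exp (of_real (\<nu> * t) * (char \<mu> (u / b t) - 1 - \<i> * (u / b t) * m))) \<longlongrightarrow>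
        exp (stable_exponent \<alpha> u)) at_top"
      unfolding b_def m
      by (intro tendsto_exp compound_poisson_exponent_tendsto[OF \<mu> nonneg F \<alpha> C.nu_pos a na])
    moreover have "eventually (\<lambda>t. exp (of_real (\<nu> * t) * (char \<mu> (u / b t) - 1 - \<i> * (u / b t) * m)) =
        (\<integral>\<omega>. iexp (u * Y t \<omega>) \<partial>M)) at_top"
      using eventually_ge_at_top[of 0]
    proof eventually_elim
      case (elim t)
      have "(\<integral>\<omega>. iexp (u * Y t \<omega>) \<partial>M) =
          (\<integral>\<omega>. iexp (- (u / b t * (t * \<nu> * m))) * iexp (u / b t * C.immigrant_total f t \<omega>) \<partial>M)"
        by (intro Bochner_Integration.integral_cong refl)
           (simp add: Y_def exp_add[symmetric] diff_divide_distrib algebra_simps)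
      also have "\<dots> = iexp (- (u / b t * (t * \<nu> * m))) * exp (of_real (\<nu> * t) * (char \<mu> (u / b t) - 1))"
        by (simp only: integral_mult_right_zero C.char_immigrant_total[OF fm elim] char_D)
      also have "\<dots> = exp (of_real (\<nu> * t) * (char \<mu> (u / b t) - 1 - \<i> * (u / b t) * m))"
        by (simp add: exp_add[symmetric] algebra_simps)
      finally show ?case by simp
    qed
    ultimately show ?thesis by (simp add: tendsto_cong)
  qed

  have "0 < \<alpha>" using \<alpha> by simp
  from F.norming_sequence_ratio_bounded[OF C.nu_pos this a na]
  obtain c where c: "0 < c" "eventually (\<lambda>t. a (nat \<lfloor>t\<rfloor>) \<le> c * b t) at_top"
    unfolding b_def by blast
  \<comment> \<open>Almost surely \<open>Y - Z\<close> is the residue divided by \<open>b\<close>, and \<open>a\<^bsub>\<lfloor>t\<rfloor>\<^esub> \<le> c b\<close> brings it to the scale of the assumption.\<close>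
  have prob_YZ: "((\<lambda>t. C.prob {\<omega>\<in>space M. \<bar>Y t \<omega> - Z t \<omega>\<bar> > \<delta>}) \<longlongrightarrow> 0) at_top" if \<delta>: "0 < \<delta>" for \<delta>
  proof (rule tendsto_sandwich[where f = "\<lambda>_. 0"])
    show "((\<lambda>t. C.prob {\<omega>\<in>space M. \<bar>residue f \<Gamma> K T A t \<omega> / a (nat \<lfloor>t\<rfloor>)\<bar> > \<delta> / c}) \<longlongrightarrow> 0) at_top"
      using assms(12) \<delta> c(1) by (simp add: small_o_in_prob_def)
    have "eventually (\<lambda>n. 0 < a n) sequentially" using a by (simp add: filterlim_at_top_dense)
    moreover have "filterlim (\<lambda>t::real. nat \<lfloor>t\<rfloor>) at_top at_top" by real_asymp
    ultimately have "eventually (\<lambda>t::real. 0 < a (nat \<lfloor>t\<rfloor>)) at_top" by (rule eventually_compose_filterlim)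
    moreover have "eventually (\<lambda>t. 0 < b t) at_top" using b_top by (simp add: filterlim_at_top_dense)
    moreover note c(2) eventually_ge_at_top[of "0::real"]
    ultimately show "eventually (\<lambda>t. C.prob {\<omega>\<in>space M. \<bar>Y t \<omega> - Z t \<omega>\<bar> > \<delta>} \<le>
        C.prob {\<omega>\<in>space M. \<bar>residue f \<Gamma> K T A t \<omega> / a (nat \<lfloor>t\<rfloor>)\<bar> > \<delta> / c}) at_top"
    proof eventually_elim
      case (elim t)
      show ?case
      proof (rule C.finite_measure_mono_AE)
        show "AE \<omega> in M. \<omega> \<in> {\<omega>\<in>space M. \<bar>Y t \<omega> - Z t \<omega>\<bar> > \<delta>} \<longrightarrow>
            \<omega> \<in> {\<omega>\<in>space M. \<bar>residue f \<Gamma> K T A t \<omega> / a (nat \<lfloor>t\<rfloor>)\<bar> > \<delta> / c}"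
          using C.AE_finite_parents_before[OF elim(4)] AE_space
        proof eventually_elim
          fix \<omega> assume \<omega>: "finite {i. \<Gamma> i \<omega> \<le> t}" "\<omega> \<in> space M"
          have "Y t \<omega> - Z t \<omega> = residue f \<Gamma> K T A t \<omega> / b t"
            unfolding Y_def Z_def C.total_claim_plus_residue[OF fm \<omega>(2,1), symmetric]
            by (simp add: diff_divide_distrib add_divide_distrib)
          moreover have "\<delta> / c < \<bar>r\<bar> / a (nat \<lfloor>t\<rfloor>)" if "\<delta> < \<bar>r\<bar> / b t" for r
          proof -
            have "\<delta> / c < \<bar>r\<bar> / (c * b t)" using that elim c(1) by (simp add: field_simps)
            also have "\<dots> \<le> \<bar>r\<bar> / a (nat \<lfloor>t\<rfloor>)" using elim c(1) by (intro divide_left_mono) auto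
            finally show ?thesis .
          qed
          ultimately show "\<omega> \<in> {\<omega>\<in>space M. \<bar>Y t \<omega> - Z t \<omega>\<bar> > \<delta>} \<longrightarrow>
              \<omega> \<in> {\<omega>\<in>space M. \<bar>residue f \<Gamma> K T A t \<omega> / a (nat \<lfloor>t\<rfloor>)\<bar> > \<delta> / c}"
            using elim \<omega> by (simp add: abs_divide)
        qed
        show "{\<omega>\<in>space M. \<bar>residue f \<Gamma> K T A t \<omega> / a (nat \<lfloor>t\<rfloor>)\<bar> > \<delta> / c} \<in> sets M"
          using C.residue_measurable[OF fm] by measurable
      qed
    qed
  qed auto

  have char_Z: "((\<lambda>t. \<integral>\<omega>. iexp (u * Z t \<omega>) \<partial>M) \<longlongrightarrow> exp (stable_exponent \<alpha> u)) at_top" for u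
  proof -
    have "((\<lambda>t. (\<integral>\<omega>. iexp (u * Y t \<omega>) \<partial>M) - (\<integral>\<omega>. iexp (u * Z t \<omega>) \<partial>M)) \<longlongrightarrow> 0) at_top"
    proof (rule tendstoI)
      fix e :: real assume e: "0 < e"
      \<comment> \<open>The denominator \<open>\<bar>u\<bar> + 1\<close> instead of \<open>\<bar>u\<bar>\<close> covers \<open>u = 0\<close>.\<close>
      define \<delta> where "\<delta> = e / (2 * (\<bar>u\<bar> + 1))"
      have \<delta>: "0 < \<delta>" "\<bar>u\<bar> * \<delta> \<le> e / 2"
        using e by (auto simp: \<delta>_def field_simps)
      have "eventually (\<lambda>t. C.prob {\<omega>\<in>space M. \<bar>Y t \<omega> - Z t \<omega>\<bar> > \<delta>} < e / 4) at_top"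
        using e by (intro order_tendstoD(2)[OF prob_YZ[OF \<delta>(1)]]) auto
      then show "eventually (\<lambda>t. dist ((\<integral>\<omega>. iexp (u * Y t \<omega>) \<partial>M) - (\<integral>\<omega>. iexp (u * Z t \<omega>) \<partial>M)) 0 < e) at_top"
      proof eventually_elim
        case (elim t)
        then show ?case
          using C.char_perturbation[OF Ym[of t] Zm[of t], of \<delta> u] \<delta> by (simp add: dist_norm)
      qed
    qed
    from tendsto_diff[OF char_Y[of u] this] show ?thesis by simp
  qed

  \<comment> \<open>The limit law is constructed along integer times; its characteristic function then gives convergence along all times.\<close>
  obtain G where G: "real_distribution G" "\<And>u. char G u = exp (stable_exponent \<alpha> u)"
  proof (rule levy_limit_exists)
    show "real_distribution (distr M borel (Z (real n)))" for n using Zm by (rule C.real_distribution_distr)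
    show "(\<lambda>n. char (distr M borel (Z (real n))) u) \<longlonglongrightarrow> exp (stable_exponent \<alpha> u)" for u
    proof -
      have "char (distr M borel (Z (real n))) u = (\<integral>\<omega>. iexp (u * Z (real n) \<omega>) \<partial>M)" for n
        unfolding char_def using Zm by (subst integral_distr) auto
      then show ?thesis
        using filterlim_compose[OF char_Z[of u] filterlim_real_sequentially] by simp
    qed
    show "isCont (\<lambda>u. exp (stable_exponent \<alpha> u)) 0"
      using \<alpha> by (intro isCont_exp' isCont_stable_exponent_0) auto
  qed auto
  have "stable_law \<alpha> G" by (rule stable_law_of_char[OF \<alpha> G])
  moreover have "converges_in_distribution M Z G"
    using char_Z by (intro converges_in_distribution_of_char C.prob_space_axioms Zm G(1)) (simp add: G(2))
  ultimately show ?thesis unfolding Z_def b_def m_def by blast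
qed

end
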